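(* Let $\mathsf M$ be a model category equipped with a natural cylinder object $Q_{\le 1}$, and suppose that the functor $Q_1:\mathsf M\to\mathsf M$ preserves finite colimits. Then $Q_{\le 1}$ is coherent if and only if the following two conditions are satisfied: 1. for any cofibration $f:X\to Y$ in $\mathsf M$, the map $Q_1(X)\coprod_{X\sqcup X}(Y\sqcup Y)\to Q_1(Y)$ is a cofibration that is acyclic if $f$ is acyclic; 2. for any cofibration $f:X\to Y$ in $\mathsf M$ and for any of the two coface morphisms $\square[0]\to\square[1]$, the induced morphism $Q_1(X)\coprod_X Y\to Q_1(Y)$ is an acyclic cofibration.
   Context: **Cubes.** $\square$ is the subcategory of posets with objects $\square[n]=\{0<1\}^n$, $n\ge 0$, whose morphisms are compositions of products of the maps $\delta^i:\ast\to\{0<1\}$ (value $i\in\{0,1\}$) and $\sigma:\{0<1\}\to\ast$. It is strict monoidal with $\square[n]\otimes\square[m]=\square[n+m]$. Cubical sets are presheaves on $\square$. Cofaces: $\delta_k^i=\mathrm{id}_{\square[k]}\otimes\delta^i\otimes \mathrm{id}:\square[n-1]\to\square[n]$, $0\le k\le n-1$. $\partial\square[n]\subset\square[n]$ is the union of the images of all cofaces ($\partial\square[0]=\emptyset$); $\sqcap^{k,\epsilon}[n]\subset\square[n]$ ($n\ge1$, $0\le k\le n-1$, $\epsilon\in\{0,1\}$) is the union of the images of all cofaces other than $\delta_k^\epsilon$. Cubical sets carry a model structure (weak equivalences: maps sent to weak homotopy equivalences by the colimit-preserving functor to simplicial sets with $\square[n]\mapsto\Delta[1]^n$; cofibrations: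 monomorphisms), in which fibrations (resp. acyclic fibrations) are the maps with the right lifting property against all $\sqcap^{k,\epsilon}[n]\to\square[n]$ (resp. all $\partial\square[n]\to\square[n]$). **Model category.** A category with finite limits and colimits, with wide subcategories of weak equivalences, cofibrations, fibrations containing all isomorphisms and satisfying the usual axioms (both factorisations; cofibrations are the maps with the left lifting property against acyclic fibrations and acyclic cofibrations those with the left lifting property against fibrations; closure under retracts; 2-out-of-3). **Natural cylinder.** Let $\square_{\le1}\subset\square$ be the full subcategory on $\square[0],\square[1]$. A natural cylinder object on $\mathsf M$ is a functor $Q_{\le1}:\square_{\le1}\to\mathrm{Fun}(\mathsf M,\mathsf M)$ sending $\square[0]$ to $\mathrm{id}_{\mathsf M}$ and $\square[1]$ to $Q_1$; so there are natural maps $X\sqcup X\to Q_1(X)\to X$. It extends uniquely to a strict monoidal functor $\square\to(\mathrm{Fun}(\mathsf M,\mathsf M),\circ)$, $\square[n]\mapsto Q_n=Q_1^{\circ n}$. **Coherent.** Define cubical sets $\mathsf M^Q(X,Y)_n=\hom_{\mathsf M}(Q_nX,Y)$. The natural cylinder $Q_{\le1}$ is coherent if the induced left square structure is homotopical, that is: for any cofibration $f:X\to X'$ and fibration $g:Y\to Y'$ in $\mathsf M$, the map of cubical sets $\mathsf M^Q(X',Y)\to\mathsf M^Q(X,Y)\times_{\mathsf M^Q(X,Y')}\mathsf M^Q(X',Y')$ is a fibration, acyclic if $f$ or $g$ is acyclic; $Q_0(X)\to X$ is a weak equivalence for every $X$; and $Q_0(\emptyset)$ is cofibrant (the last two hold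 automatically here since $Q_0=\mathrm{id}$). *)

theory Defs
  imports Main "HOL-Library.FuncSet"
begin

section \<open>Categories, functors, finite limits and colimits\<close>

record ('o, 'm) cat =
  Obj :: "'o set"
  Arr :: "'m set"
  Dom :: "'m \<Rightarrow> 'o"
  Cod :: "'m \<Rightarrow> 'o"
  Ide :: "'o \<Rightarrow> 'm"
  Comp :: "'m \<Rightarrow> 'm \<Rightarrow> 'm"  (* Comp C g f is g after f *)

definition hom :: "('o, 'm, 'z) cat_scheme \<Rightarrow> 'o \<Rightarrow> 'o \<Rightarrow> 'm set" where
  "hom C a b = {f \<in> Arr C. Dom C f = a \<and> Cod C f = b}"

locale category =
  fixes C :: "('o, 'm, 'z) cat_scheme"
  assumes dom_obj: "f \<in> Arr C \<Longrightarrow> Dom C f \<in> Obj C"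
    and cod_obj: "f \<in> Arr C \<Longrightarrow> Cod C f \<in> Obj C"
    and ide_hom: "a \<in> Obj C \<Longrightarrow> Ide C a \<in> hom C a a"
    and comp_hom: "f \<in> hom C a b \<Longrightarrow> g \<in> hom C b c \<Longrightarrow> Comp C g f \<in> hom C a c"
    and comp_ide: "f \<in> hom C a b \<Longrightarrow> Comp C f (Ide C a) = f"
    and ide_comp: "f \<in> hom C a b \<Longrightarrow> Comp C (Ide C b) f = f"
    and comp_assoc: "f \<in> hom C a b \<Longrightarrow> g \<in> hom C b c \<Longrightarrow> h \<in> hom C c d \<Longrightarrow>
                       Comp C h (Comp C g f) = Comp C (Comp C h g) f"

definition iso :: "('o, 'm, 'z) cat_scheme \<Rightarrow> 'm \<Rightarrow> bool" where
  "iso C f \<longleftrightarrow> f \<in> Arr C \<and>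
     (\<exists>g \<in> hom C (Cod C f) (Dom C f).
        Comp C g f = Ide C (Dom C f) \<and> Comp C f g = Ide C (Cod C f))"

definition initial :: "('o, 'm, 'z) cat_scheme \<Rightarrow> 'o \<Rightarrow> bool" where
  "initial C e \<longleftrightarrow> e \<in> Obj C \<and> (\<forall>a \<in> Obj C. \<exists>!f. f \<in> hom C e a)"

definition full_subcat :: "('o, 'm) cat \<Rightarrow> 'o set \<Rightarrow> ('o, 'm) cat" where
  "full_subcat C S =
     C\<lparr>Obj := Obj C \<inter> S, Arr := {f \<in> Arr C. Dom C f \<in> S \<and> Cod C f \<in> S}\<rparr>"

record ('a, 'b, 'o, 'm) func =
  fo :: "'a \<Rightarrow> 'o"
  fa :: "'b \<Rightarrow> 'm"

definition is_functor ::
    "('a, 'b, 'y) cat_scheme \<Rightarrow> ('o, 'm, 'z) cat_scheme \<Rightarrow> ('a, 'b, 'o, 'm) func \<Rightarrow> bool" where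
  "is_functor C D F \<longleftrightarrow>
     (\<forall>a \<in> Obj C. fo F a \<in> Obj D) \<and>
     (\<forall>f \<in> Arr C. fa F f \<in> hom D (fo F (Dom C f)) (fo F (Cod C f))) \<and>
     (\<forall>a \<in> Obj C. fa F (Ide C a) = Ide D (fo F a)) \<and>
     (\<forall>a b c f g. f \<in> hom C a b \<longrightarrow> g \<in> hom C b c \<longrightarrow>
        fa F (Comp C g f) = Comp D (fa F g) (fa F f))"

definition is_cone ::
    "('o, 'm, 'z) cat_scheme \<Rightarrow> ('a, 'b) cat \<Rightarrow> ('a, 'b, 'o, 'm) func \<Rightarrow> 'o \<Rightarrow> ('a \<Rightarrow> 'm) \<Rightarrow> bool" where
  "is_cone C J D L p \<longleftrightarrow> L \<in> Obj C \<and>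
     (\<forall>j \<in> Obj J. p j \<in> hom C L (fo D j)) \<and>
     (\<forall>u \<in> Arr J. Comp C (fa D u) (p (Dom J u)) = p (Cod J u))"

definition is_limit ::
    "('o, 'm, 'z) cat_scheme \<Rightarrow> ('a, 'b) cat \<Rightarrow> ('a, 'b, 'o, 'm) func \<Rightarrow> 'o \<Rightarrow> ('a \<Rightarrow> 'm) \<Rightarrow> bool" where
  "is_limit C J D L p \<longleftrightarrow> is_cone C J D L p \<and>
     (\<forall>L' p'. is_cone C J D L' p' \<longrightarrow>
        (\<exists>!h. h \<in> hom C L' L \<and> (\<forall>j \<in> Obj J. Comp C (p j) h = p' j)))"

definition is_cocone ::
    "('o, 'm, 'z) cat_scheme \<Rightarrow> ('a, 'b) cat \<Rightarrow> ('a, 'b, 'o, 'm) func \<Rightarrow> 'o \<Rightarrow> ('a \<Rightarrow> 'm) \<Rightarrow> bool" where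
  "is_cocone C J D L i \<longleftrightarrow> L \<in> Obj C \<and>
     (\<forall>j \<in> Obj J. i j \<in> hom C (fo D j) L) \<and>
     (\<forall>u \<in> Arr J. Comp C (i (Cod J u)) (fa D u) = i (Dom J u))"

definition is_colimit ::
    "('o, 'm, 'z) cat_scheme \<Rightarrow> ('a, 'b) cat \<Rightarrow> ('a, 'b, 'o, 'm) func \<Rightarrow> 'o \<Rightarrow> ('a \<Rightarrow> 'm) \<Rightarrow> bool" where
  "is_colimit C J D L i \<longleftrightarrow> is_cocone C J D L i \<and>
     (\<forall>L' i'. is_cocone C J D L' i' \<longrightarrow>
        (\<exists>!h. h \<in> hom C L L' \<and> (\<forall>j \<in> Obj J. Comp C h (i j) = i' j)))"

text \<open>Every finite category is isomorphic to one whose objects and arrows are natural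
  numbers, so it is enough to let finite shapes range over the following.\<close>

definition finite_shape :: "(nat, nat) cat \<Rightarrow> bool" where
  "finite_shape J \<longleftrightarrow> category J \<and> finite (Obj J) \<and> finite (Arr J)"

definition has_finite_limits :: "('o, 'm, 'z) cat_scheme \<Rightarrow> bool" where
  "has_finite_limits C \<longleftrightarrow>
     (\<forall>J D. finite_shape J \<and> is_functor J C D \<longrightarrow> (\<exists>L p. is_limit C J D L p))"

definition has_finite_colimits :: "('o, 'm, 'z) cat_scheme \<Rightarrow> bool" where
  "has_finite_colimits C \<longleftrightarrow>
     (\<forall>J D. finite_shape J \<and> is_functor J C D \<longrightarrow> (\<exists>L i. is_colimit C J D L i))"

definition preserves_finite_colimits ::
    "('a, 'b, 'y) cat_scheme \<Rightarrow> ('o, 'm, 'z) cat_scheme \<Rightarrow> ('a, 'b, 'o, 'm) func \<Rightarrow> bool" where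
  "preserves_finite_colimits C C' F \<longleftrightarrow>
     (\<forall>J D L i. finite_shape J \<and> is_functor J C D \<and> is_colimit C J D L i \<longrightarrow>
        is_colimit C' J \<lparr>fo = \<lambda>j. fo F (fo D j), fa = \<lambda>u. fa F (fa D u)\<rparr>
          (fo F L) (\<lambda>j. fa F (i j)))"

text \<open>\<open>copairing C p q a b h\<close>: the arrow \<open>h\<close> restricts to \<open>a\<close> along \<open>p\<close> and to \<open>b\<close> along \<open>q\<close>.
  It is unique when \<open>p, q\<close> are the coprojections of a coproduct or of a pushout.\<close>

definition copairing :: "('o, 'm, 'z) cat_scheme \<Rightarrow> 'm \<Rightarrow> 'm \<Rightarrow> 'm \<Rightarrow> 'm \<Rightarrow> 'm \<Rightarrow> bool" where
  "copairing C p q a b h \<longleftrightarrow> h \<in> hom C (Cod C p) (Cod C a) \<and> Comp C h p = a \<and> Comp C h q = b"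

definition is_coproduct :: "('o, 'm, 'z) cat_scheme \<Rightarrow> 'o \<Rightarrow> 'o \<Rightarrow> 'm \<Rightarrow> 'm \<Rightarrow> bool" where
  "is_coproduct C X Y p q \<longleftrightarrow>
     p \<in> Arr C \<and> q \<in> Arr C \<and> Dom C p = X \<and> Dom C q = Y \<and> Cod C p = Cod C q \<and>
     (\<forall>Z a b. a \<in> hom C X Z \<longrightarrow> b \<in> hom C Y Z \<longrightarrow> (\<exists>!h. copairing C p q a b h))"

definition is_pushout :: "('o, 'm, 'z) cat_scheme \<Rightarrow> 'm \<Rightarrow> 'm \<Rightarrow> 'm \<Rightarrow> 'm \<Rightarrow> bool" where
  "is_pushout C f g p q \<longleftrightarrow>
     f \<in> Arr C \<and> g \<in> Arr C \<and> Dom C f = Dom C g \<and>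
     p \<in> Arr C \<and> q \<in> Arr C \<and> Dom C p = Cod C f \<and> Dom C q = Cod C g \<and> Cod C p = Cod C q \<and>
     Comp C p f = Comp C q g \<and>
     (\<forall>Z a b. a \<in> hom C (Cod C f) Z \<longrightarrow> b \<in> hom C (Cod C g) Z \<longrightarrow>
        Comp C a f = Comp C b g \<longrightarrow> (\<exists>!h. copairing C p q a b h))"


section \<open>The strict monoidal category of endofunctors\<close>

definition is_nat_trans ::
    "('a, 'b, 'y) cat_scheme \<Rightarrow> ('o, 'm, 'z) cat_scheme \<Rightarrow>
     ('a, 'b, 'o, 'm) func \<Rightarrow> ('a, 'b, 'o, 'm) func \<Rightarrow> ('a \<Rightarrow> 'm) \<Rightarrow> bool" where
  "is_nat_trans C D F G t \<longleftrightarrow>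
     (\<forall>a \<in> Obj C. t a \<in> hom D (fo F a) (fo G a)) \<and>
     (\<forall>f \<in> Arr C. Comp D (t (Cod C f)) (fa F f) = Comp D (fa G f) (t (Dom C f)))"

type_synonym ('a, 'b, 'o, 'm) ntrans =
  "('a, 'b, 'o, 'm) func \<times> ('a, 'b, 'o, 'm) func \<times> ('a \<Rightarrow> 'm)"

definition component :: "('a, 'b, 'o, 'm) ntrans \<Rightarrow> 'a \<Rightarrow> 'm" where
  "component t a = snd (snd t) a"

text \<open>Functors and transformations are taken extensional (\<open>undefined\<close> off the source
  category), so that equality in the functor category is honest equality.\<close>

definition ext_functors ::
    "('a, 'b, 'y) cat_scheme \<Rightarrow> ('o, 'm, 'z) cat_scheme \<Rightarrow> ('a, 'b, 'o, 'm) func set" where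
  "ext_functors C D =
     {F. is_functor C D F \<and> fo F \<in> extensional (Obj C) \<and> fa F \<in> extensional (Arr C)}"

definition funcat ::
    "('a, 'b, 'y) cat_scheme \<Rightarrow> ('o, 'm, 'z) cat_scheme \<Rightarrow>
     (('a, 'b, 'o, 'm) func, ('a, 'b, 'o, 'm) ntrans) cat" where
  "funcat C D =
     \<lparr>Obj = ext_functors C D,
      Arr = {(F, G, t). F \<in> ext_functors C D \<and> G \<in> ext_functors C D \<and>
                        is_nat_trans C D F G t \<and> t \<in> extensional (Obj C)},
      Dom = fst,
      Cod = (\<lambda>t. fst (snd t)),
      Ide = (\<lambda>F. (F, F, \<lambda>X \<in> Obj C. Ide D (fo F X))),
      Comp = (\<lambda>s t. (fst t, fst (snd s),
                     \<lambda>X \<in> Obj C. Comp D (component s X) (component t X)))\<rparr>"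

definition id_functor :: "('o, 'm, 'z) cat_scheme \<Rightarrow> ('o, 'm, 'o, 'm) func" where
  "id_functor C = \<lparr>fo = \<lambda>X \<in> Obj C. X, fa = \<lambda>f \<in> Arr C. f\<rparr>"

definition functor_comp ::
    "('o, 'm, 'z) cat_scheme \<Rightarrow> ('o, 'm, 'o, 'm) func \<Rightarrow> ('o, 'm, 'o, 'm) func \<Rightarrow>
     ('o, 'm, 'o, 'm) func" where
  "functor_comp C F G = \<lparr>fo = compose (Obj C) (fo F) (fo G), fa = compose (Arr C) (fa F) (fa G)\<rparr>"

text \<open>The horizontal composite of \<open>s : F \<Rightarrow> F'\<close> and \<open>t : G \<Rightarrow> G'\<close> has as component at \<open>X\<close> the
  arrow \<open>F (G X) \<rightarrow> F (G' X) \<rightarrow> F' (G' X)\<close>.\<close>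

definition horizontal_comp ::
    "('o, 'm, 'z) cat_scheme \<Rightarrow> ('o, 'm, 'o, 'm) ntrans \<Rightarrow> ('o, 'm, 'o, 'm) ntrans \<Rightarrow>
     ('o, 'm, 'o, 'm) ntrans" where
  "horizontal_comp C s t =
     (case s of (F, F', \<sigma>) \<Rightarrow> case t of (G, G', \<tau>) \<Rightarrow>
        (functor_comp C F G, functor_comp C F' G',
         \<lambda>X \<in> Obj C. Comp C (\<sigma> (fo G' X)) (fa F (\<tau> X))))"


section \<open>The category of cubes\<close>

text \<open>The object \<open>n\<close> stands for the poset of Boolean lists of length \<open>n\<close>; an arrow is a
  triple of source, target and underlying map, the latter extensional on the source.\<close>

type_synonym cube_arr = "nat \<times> nat \<times> (bool list \<Rightarrow> bool list)"

definition cube :: "nat \<Rightarrow> bool list set" where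
  "cube n = {x. length x = n}"

definition cube_ide :: "nat \<Rightarrow> cube_arr" where
  "cube_ide n = (n, n, \<lambda>x \<in> cube n. x)"

definition cube_comp :: "cube_arr \<Rightarrow> cube_arr \<Rightarrow> cube_arr" where
  "cube_comp v u =
     (case v of (n', p, g) \<Rightarrow> case u of (m, n, f) \<Rightarrow> (m, p, compose (cube m) g f))"

definition cube_tensor :: "cube_arr \<Rightarrow> cube_arr \<Rightarrow> cube_arr" where
  "cube_tensor u v =
     (case u of (m, n, f) \<Rightarrow> case v of (m', n', g) \<Rightarrow>
        (m + m', n + n', \<lambda>x \<in> cube (m + m'). f (take m x) @ g (drop m x)))"

definition delta :: "bool \<Rightarrow> cube_arr" where
  "delta i = (0, 1, \<lambda>x \<in> cube 0. [i])"

definition sigma :: cube_arr where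
  "sigma = (1, 0, \<lambda>x \<in> cube 1. [])"

inductive_set cube_arrs :: "cube_arr set" where
  ide: "cube_ide n \<in> cube_arrs"
| delta: "delta i \<in> cube_arrs"
| sigma: "sigma \<in> cube_arrs"
| tensor: "u \<in> cube_arrs \<Longrightarrow> v \<in> cube_arrs \<Longrightarrow> cube_tensor u v \<in> cube_arrs"
| comp: "u \<in> cube_arrs \<Longrightarrow> v \<in> cube_arrs \<Longrightarrow> fst (snd u) = fst v \<Longrightarrow> cube_comp v u \<in> cube_arrs"

definition square :: "(nat, cube_arr) cat" where
  "square = \<lparr>Obj = UNIV, Arr = cube_arrs, Dom = fst, Cod = (\<lambda>u. fst (snd u)),
             Ide = cube_ide, Comp = cube_comp\<rparr>"

definition square_le1 :: "(nat, cube_arr) cat" where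
  "square_le1 = full_subcat square {0, 1}"

definition coface :: "nat \<Rightarrow> nat \<Rightarrow> bool \<Rightarrow> cube_arr" where
  "coface n k i = cube_tensor (cube_tensor (cube_ide k) (delta i)) (cube_ide (n - 1 - k))"


section \<open>Cubical sets\<close>

record 'a cset =
  cells :: "nat \<Rightarrow> 'a set"
  act :: "cube_arr \<Rightarrow> 'a \<Rightarrow> 'a"

definition cubical_set :: "'a cset \<Rightarrow> bool" where
  "cubical_set K \<longleftrightarrow>
     (\<forall>m n u x. u \<in> hom square m n \<longrightarrow> x \<in> cells K n \<longrightarrow> act K u x \<in> cells K m) \<and>
     (\<forall>n x. x \<in> cells K n \<longrightarrow> act K (Ide square n) x = x) \<and>
     (\<forall>l m n u v x. u \<in> hom square l m \<longrightarrow> v \<in> hom square m n \<longrightarrow> x \<in> cells K n \<longrightarrow>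
        act K (Comp square v u) x = act K u (act K v x))"

definition cubical_map :: "'a cset \<Rightarrow> 'b cset \<Rightarrow> (nat \<Rightarrow> 'a \<Rightarrow> 'b) \<Rightarrow> bool" where
  "cubical_map K L h \<longleftrightarrow> cubical_set K \<and> cubical_set L \<and>
     (\<forall>n x. x \<in> cells K n \<longrightarrow> h n x \<in> cells L n) \<and>
     (\<forall>m n u x. u \<in> hom square m n \<longrightarrow> x \<in> cells K n \<longrightarrow> h m (act K u x) = act L u (h n x))"

definition cset_fibre_product ::
    "'a cset \<Rightarrow> 'b cset \<Rightarrow> (nat \<Rightarrow> 'a \<Rightarrow> 'c) \<Rightarrow> (nat \<Rightarrow> 'b \<Rightarrow> 'c) \<Rightarrow> ('a \<times> 'b) cset" where
  "cset_fibre_product K L p q =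
     \<lparr>cells = \<lambda>n. {(x, y). x \<in> cells K n \<and> y \<in> cells L n \<and> p n x = q n y},
      act = \<lambda>u (x, y). (act K u x, act L u y)\<rparr>"

definition std_cube :: "nat \<Rightarrow> cube_arr cset" where
  "std_cube n = \<lparr>cells = \<lambda>m. hom square m n, act = \<lambda>u x. Comp square x u\<rparr>"

text \<open>The union, inside the standard cube, of the images of the cofaces \<open>coface n k i\<close>
  for \<open>(k, i)\<close> in the set \<open>S\<close>.\<close>

definition coface_union :: "nat \<Rightarrow> (nat \<times> bool) set \<Rightarrow> cube_arr cset" where
  "coface_union n S =
     (std_cube n)\<lparr>cells := \<lambda>m. {x. \<exists>(k, i) \<in> S. \<exists>y \<in> hom square m (n - 1).
                                    x = Comp square (coface n k i) y}\<rparr>"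

definition boundary :: "nat \<Rightarrow> cube_arr cset" where
  "boundary n = coface_union n {(j, i). j < n}"

definition open_box :: "nat \<Rightarrow> nat \<Rightarrow> bool \<Rightarrow> cube_arr cset" where
  "open_box n k \<epsilon> = coface_union n ({(j, i). j < n} - {(k, \<epsilon>)})"

text \<open>Right lifting property of \<open>p : K \<rightarrow> L\<close> against the inclusion of \<open>A\<close> into \<open>B\<close>.\<close>

definition cubical_rlp ::
    "'c cset \<Rightarrow> 'c cset \<Rightarrow> 'a cset \<Rightarrow> 'b cset \<Rightarrow> (nat \<Rightarrow> 'a \<Rightarrow> 'b) \<Rightarrow> bool" where
  "cubical_rlp A B K L p \<longleftrightarrow>
     (\<forall>a b. cubical_map A K a \<and> cubical_map B L b \<and>
            (\<forall>n. \<forall>x \<in> cells A n. p n (a n x) = b n x) \<longrightarrow>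
        (\<exists>h. cubical_map B K h \<and>
             (\<forall>n. \<forall>x \<in> cells A n. h n x = a n x) \<and>
             (\<forall>n. \<forall>x \<in> cells B n. p n (h n x) = b n x)))"

text \<open>In the model structure on cubical sets whose cofibrations are the monomorphisms and whose
  weak equivalences are those of the associated simplicial sets, the fibrations are the maps
  lifting against open boxes, and the acyclic ones those lifting against boundaries.\<close>

definition cubical_fibration ::
    "'a cset \<Rightarrow> 'b cset \<Rightarrow> (nat \<Rightarrow> 'a \<Rightarrow> 'b) \<Rightarrow> bool" where
  "cubical_fibration K L p \<longleftrightarrow> cubical_map K L p \<and>
     (\<forall>n k \<epsilon>. k < n \<longrightarrow> cubical_rlp (open_box n k \<epsilon>) (std_cube n) K L p)"

definition cubical_acyclic_fibration ::
    "'a cset \<Rightarrow> 'b cset \<Rightarrow> (nat \<Rightarrow> 'a \<Rightarrow> 'b) \<Rightarrow> bool" where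
  "cubical_acyclic_fibration K L p \<longleftrightarrow> cubical_map K L p \<and>
     (\<forall>n. cubical_rlp (boundary n) (std_cube n) K L p)"


section \<open>Model categories\<close>

record ('o, 'm) model_cat = "('o, 'm) cat" +
  Weq :: "'m set"
  Cof :: "'m set"
  Fib :: "'m set"

definition wide_subcat_with_isos :: "('o, 'm, 'z) cat_scheme \<Rightarrow> 'm set \<Rightarrow> bool" where
  "wide_subcat_with_isos C S \<longleftrightarrow> S \<subseteq> Arr C \<and> (\<forall>f. iso C f \<longrightarrow> f \<in> S) \<and>
     (\<forall>f \<in> S. \<forall>g \<in> S. Cod C f = Dom C g \<longrightarrow> Comp C g f \<in> S)"

definition has_llp :: "('o, 'm, 'z) cat_scheme \<Rightarrow> 'm \<Rightarrow> 'm set \<Rightarrow> bool" where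
  "has_llp C f S \<longleftrightarrow>
     (\<forall>g \<in> S. \<forall>a \<in> hom C (Dom C f) (Dom C g). \<forall>b \<in> hom C (Cod C f) (Cod C g).
        Comp C g a = Comp C b f \<longrightarrow>
        (\<exists>h \<in> hom C (Cod C f) (Dom C g). Comp C h f = a \<and> Comp C g h = b))"

definition is_retract :: "('o, 'm, 'z) cat_scheme \<Rightarrow> 'm \<Rightarrow> 'm \<Rightarrow> bool" where
  "is_retract C f g \<longleftrightarrow> f \<in> Arr C \<and> g \<in> Arr C \<and>
     (\<exists>i \<in> hom C (Dom C f) (Dom C g). \<exists>r \<in> hom C (Dom C g) (Dom C f).
      \<exists>j \<in> hom C (Cod C f) (Cod C g). \<exists>s \<in> hom C (Cod C g) (Cod C f).
        Comp C r i = Ide C (Dom C f) \<and> Comp C s j = Ide C (Cod C f) \<and>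
        Comp C g i = Comp C j f \<and> Comp C f r = Comp C s g)"

definition retract_closed :: "('o, 'm, 'z) cat_scheme \<Rightarrow> 'm set \<Rightarrow> bool" where
  "retract_closed C S \<longleftrightarrow> (\<forall>f. \<forall>g \<in> S. is_retract C f g \<longrightarrow> f \<in> S)"

definition factorises :: "('o, 'm, 'z) cat_scheme \<Rightarrow> 'm set \<Rightarrow> 'm set \<Rightarrow> bool" where
  "factorises C S T \<longleftrightarrow>
     (\<forall>f \<in> Arr C. \<exists>i \<in> S. \<exists>p \<in> T. Cod C i = Dom C p \<and> Dom C i = Dom C f \<and> Comp C p i = f)"

definition two_out_of_three :: "('o, 'm, 'z) cat_scheme \<Rightarrow> 'm set \<Rightarrow> bool" where
  "two_out_of_three C S \<longleftrightarrow>
     (\<forall>f \<in> Arr C. \<forall>g \<in> Arr C. Cod C f = Dom C g \<longrightarrow>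
        (f \<in> S \<and> g \<in> S \<longrightarrow> Comp C g f \<in> S) \<and>
        (f \<in> S \<and> Comp C g f \<in> S \<longrightarrow> g \<in> S) \<and>
        (g \<in> S \<and> Comp C g f \<in> S \<longrightarrow> f \<in> S))"

locale model_category =
  category M for M :: "('o, 'm) model_cat" +
  assumes finite_limits: "has_finite_limits M"
    and finite_colimits: "has_finite_colimits M"
    and weq_subcat: "wide_subcat_with_isos M (Weq M)"
    and cof_subcat: "wide_subcat_with_isos M (Cof M)"
    and fib_subcat: "wide_subcat_with_isos M (Fib M)"
    and fact_acof_fib: "factorises M (Cof M \<inter> Weq M) (Fib M)"
    and fact_cof_afib: "factorises M (Cof M) (Fib M \<inter> Weq M)"
    and cof_llp: "Cof M = {f \<in> Arr M. has_llp M f (Fib M \<inter> Weq M)}"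
    and acof_llp: "Cof M \<inter> Weq M = {f \<in> Arr M. has_llp M f (Fib M)}"
    and weq_retract: "retract_closed M (Weq M)"
    and cof_retract: "retract_closed M (Cof M)"
    and fib_retract: "retract_closed M (Fib M)"
    and weq_two_out_of_three: "two_out_of_three M (Weq M)"

definition cofibrant :: "('o, 'm) model_cat \<Rightarrow> 'o \<Rightarrow> bool" where
  "cofibrant M X \<longleftrightarrow> X \<in> Obj M \<and> (\<forall>e i. initial M e \<longrightarrow> i \<in> hom M e X \<longrightarrow> i \<in> Cof M)"


section \<open>Natural cylinders and coherence\<close>

type_synonym ('o, 'm) cubical_functor =
  "(nat, cube_arr, ('o, 'm, 'o, 'm) func, ('o, 'm, 'o, 'm) ntrans) func"

definition natural_cylinder ::
    "('o, 'm, 'z) cat_scheme \<Rightarrow> ('o, 'm) cubical_functor \<Rightarrow> bool" where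
  "natural_cylinder M Q \<longleftrightarrow> is_functor square_le1 (funcat M M) Q \<and> fo Q 0 = id_functor M"

definition strict_monoidal ::
    "('o, 'm, 'z) cat_scheme \<Rightarrow> ('o, 'm) cubical_functor \<Rightarrow> bool" where
  "strict_monoidal M E \<longleftrightarrow> is_functor square (funcat M M) E \<and>
     fo E 0 = id_functor M \<and>
     (\<forall>m n. fo E (m + n) = functor_comp M (fo E m) (fo E n)) \<and>
     (\<forall>u \<in> Arr square. \<forall>v \<in> Arr square.
        fa E (cube_tensor u v) = horizontal_comp M (fa E u) (fa E v))"

definition extends_cylinder ::
    "('o, 'm) cubical_functor \<Rightarrow> ('o, 'm) cubical_functor \<Rightarrow> bool" where
  "extends_cylinder Q E \<longleftrightarrow> (\<forall>n \<in> Obj square_le1. fo E n = fo Q n) \<and>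
     (\<forall>u \<in> Arr square_le1. fa E u = fa Q u)"

text \<open>A strict monoidal extension of a natural cylinder exists and is unique on the arrows of
  \<open>square\<close>; only the irrelevant values off these arrows are left to the choice operator.\<close>

definition cylinder_ext ::
    "('o, 'm, 'z) cat_scheme \<Rightarrow> ('o, 'm) cubical_functor \<Rightarrow> ('o, 'm) cubical_functor" where
  "cylinder_ext M Q = (SOME E. strict_monoidal M E \<and> extends_cylinder Q E)"

text \<open>The cubical set with \<open>n\<close>-cells the arrows \<open>Q\<^sub>n X \<rightarrow> Y\<close>, for \<open>E : n \<mapsto> Q\<^sub>n\<close>, and its
  functoriality in both arguments.\<close>

definition map_cset ::
    "('o, 'm, 'z) cat_scheme \<Rightarrow> ('o, 'm) cubical_functor \<Rightarrow> 'o \<Rightarrow> 'o \<Rightarrow> 'm cset" where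
  "map_cset M E X Y =
     \<lparr>cells = \<lambda>n. hom M (fo (fo E n) X) Y,
      act = \<lambda>u \<phi>. Comp M \<phi> (component (fa E u) X)\<rparr>"

definition precomp ::
    "('o, 'm, 'z) cat_scheme \<Rightarrow> ('o, 'm) cubical_functor \<Rightarrow> 'm \<Rightarrow> nat \<Rightarrow> 'm \<Rightarrow> 'm" where
  "precomp M E f n \<phi> = Comp M \<phi> (fa (fo E n) f)"

definition postcomp :: "('o, 'm, 'z) cat_scheme \<Rightarrow> 'm \<Rightarrow> nat \<Rightarrow> 'm \<Rightarrow> 'm" where
  "postcomp M g n \<phi> = Comp M g \<phi>"

definition gap_source ::
    "('o, 'm, 'z) cat_scheme \<Rightarrow> ('o, 'm) cubical_functor \<Rightarrow> 'm \<Rightarrow> 'm \<Rightarrow> 'm cset" where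
  "gap_source M E f g = map_cset M E (Cod M f) (Dom M g)"

definition gap_target ::
    "('o, 'm, 'z) cat_scheme \<Rightarrow> ('o, 'm) cubical_functor \<Rightarrow> 'm \<Rightarrow> 'm \<Rightarrow> ('m \<times> 'm) cset" where
  "gap_target M E f g =
     cset_fibre_product (map_cset M E (Dom M f) (Dom M g)) (map_cset M E (Cod M f) (Cod M g))
       (postcomp M g) (precomp M E f)"

definition gap_map ::
    "('o, 'm, 'z) cat_scheme \<Rightarrow> ('o, 'm) cubical_functor \<Rightarrow> 'm \<Rightarrow> 'm \<Rightarrow> nat \<Rightarrow> 'm \<Rightarrow> 'm \<times> 'm" where
  "gap_map M E f g n \<phi> = (precomp M E f n \<phi>, postcomp M g n \<phi>)"

text \<open>The map from \<open>Q\<^sub>0 X\<close> to \<open>X\<close> is \<open>Ide M X\<close>, since \<open>Q\<^sub>0\<close> is the identity functor.\<close>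

definition homotopical :: "('o, 'm) model_cat \<Rightarrow> ('o, 'm) cubical_functor \<Rightarrow> bool" where
  "homotopical M E \<longleftrightarrow>
     (\<forall>f \<in> Cof M. \<forall>g \<in> Fib M.
        cubical_fibration (gap_source M E f g) (gap_target M E f g) (gap_map M E f g) \<and>
        (f \<in> Weq M \<or> g \<in> Weq M \<longrightarrow>
          cubical_acyclic_fibration (gap_source M E f g) (gap_target M E f g) (gap_map M E f g))) \<and>
     (\<forall>X \<in> Obj M. Ide M X \<in> hom M (fo (fo E 0) X) X \<inter> Weq M) \<and>
     (\<forall>e. initial M e \<longrightarrow> cofibrant M (fo (fo E 0) e))"

definition coherent :: "('o, 'm) model_cat \<Rightarrow> ('o, 'm) cubical_functor \<Rightarrow> bool" where
  "coherent M Q \<longleftrightarrow> homotopical M (cylinder_ext M Q)"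


section \<open>The relative cylinder maps\<close>

text \<open>The natural map \<open>X \<rightarrow> Q\<^sub>1 X\<close> induced by the coface \<open>delta i\<close>.\<close>

definition cyl_incl :: "('o, 'm) cubical_functor \<Rightarrow> bool \<Rightarrow> 'o \<Rightarrow> 'm" where
  "cyl_incl Q i X = component (fa Q (delta i)) X"

text \<open>\<open>h\<close> is the induced arrow from the pushout of \<open>X \<squnion> X \<rightarrow> Q\<^sub>1 X\<close> and \<open>f \<squnion> f\<close> to \<open>Q\<^sub>1 Y\<close>, for
  some choice of the coproducts and of the pushout: \<open>s = f \<squnion> f\<close>, and \<open>c\<close>, \<open>d\<close> are the
  natural maps \<open>X \<squnion> X \<rightarrow> Q\<^sub>1 X\<close> and \<open>Y \<squnion> Y \<rightarrow> Q\<^sub>1 Y\<close>.\<close>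

definition is_boundary_map ::
    "('o, 'm, 'z) cat_scheme \<Rightarrow> ('o, 'm) cubical_functor \<Rightarrow> 'm \<Rightarrow> 'm \<Rightarrow> bool" where
  "is_boundary_map M Q f h \<longleftrightarrow>
     (\<exists>i0 i1 j0 j1 s c d p q.
        is_coproduct M (Dom M f) (Dom M f) i0 i1 \<and>
        is_coproduct M (Cod M f) (Cod M f) j0 j1 \<and>
        copairing M i0 i1 (Comp M j0 f) (Comp M j1 f) s \<and>
        copairing M i0 i1 (cyl_incl Q False (Dom M f)) (cyl_incl Q True (Dom M f)) c \<and>
        copairing M j0 j1 (cyl_incl Q False (Cod M f)) (cyl_incl Q True (Cod M f)) d \<and>
        is_pushout M c s p q \<and>
        copairing M p q (fa (fo Q 1) f) d h)"

text \<open>\<open>h\<close> is the induced arrow from the pushout of \<open>X \<rightarrow> Q\<^sub>1 X\<close> and \<open>f\<close> to \<open>Q\<^sub>1 Y\<close>, for some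
  choice of the pushout.\<close>

definition is_end_map ::
    "('o, 'm, 'z) cat_scheme \<Rightarrow> ('o, 'm) cubical_functor \<Rightarrow> bool \<Rightarrow> 'm \<Rightarrow> 'm \<Rightarrow> bool" where
  "is_end_map M Q i f h \<longleftrightarrow>
     (\<exists>p q. is_pushout M (cyl_incl Q i (Dom M f)) f p q \<and>
            copairing M p q (fa (fo Q 1) f) (cyl_incl Q i (Cod M f)) h)"

end

(*
  Since Q_(n+1) = Q_n o Q_1, the faces of the (n+1)-cube in the last direction can be absorbed into
  the source of a lifting problem. A lifting problem of the boundary of the (n+1)-cube against the
  gap map of f and g is thus one of the boundary of the n-cube against the gap map of f' and g,
  where f' is the map from the union of Q_1(X) with Y + Y to Q_1(Y); an open box is treated in the
  same way, except that f' is the map of condition 2 when the missing face is in the last direction.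
  As Q_n preserves the pushout defining f', an induction on n that lets f vary reduces everything
  to the lifting axioms of M. Conversely, lifting f' against g is exactly the case n = 1.

  The functor Q on all cubes is obtained by writing an arrow of cubes as a tensor product of
  generators, which is unique up to commuting degeneracies with cofaces.
*)
theory Submission
  imports Defs
begin

section \<open>Cubes\<close>

text \<open>A partial map out of a boundary or an open box is recorded by its restrictions to the
  faces and by their agreement where two faces meet (\<open>lifting_problem\<close>), so that
  lifting becomes a matter of equations in \<open>M\<close>. Such data can be read off from a
  partial map in every dimension. Rebuilding a partial map from the data is done for the interval
  alone, where the endpoints are disjoint and nothing has to be matched; the converse direction asks
  for no more. The agreement conditions drive the induction: the equation that a face must satisfy
  relative to f' combines its old equation with its agreement with the faces in the last direction.
  Both relative cylinders are handled at once by \<open>is_glueing\<close>, indexed by the set of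
  ends: a map out of the source of f' is a map on Q_1(X) and one map on Y for each end. Coherence is
  stated through a chosen monoidal extension, so one must first exist. An arrow of cubes is a bare
  function with many expressions in generators; the work goes into showing that the natural
  transformation attached to it does not depend on the expression.\<close>

lemma cube_arrs_PiE:
  "u \<in> cube_arrs \<Longrightarrow> snd (snd u) \<in> cube (fst u) \<rightarrow>\<^sub>E cube (fst (snd u))"
proof (induction rule: cube_arrs.induct)
  case (tensor u v)
  obtain m n f where u: "u = (m, n, f)" by (metis prod_cases3)
  obtain m' n' g where v: "v = (m', n', g)" by (metis prod_cases3)
  have "f (take m x) @ g (drop m x) \<in> cube (n + n')" if "x \<in> cube (m + m')" for x
  proof -
    have "take m x \<in> cube m" "drop m x \<in> cube m'" using that by (auto simp: cube_def)
    then have "f (take m x) \<in> cube n" "g (drop m x) \<in> cube n'"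
      using tensor u v by auto
    then show ?thesis by (auto simp: cube_def)
  qed
  then show ?case by (auto simp: u v cube_tensor_def)
next
  case (comp u v)
  obtain m n f where u: "u = (m, n, f)" by (metis prod_cases3)
  obtain m' n' g where v: "v = (m', n', g)" by (metis prod_cases3)
  show ?case
    using comp by (auto simp: u v cube_comp_def compose_def PiE_def Pi_def extensional_def)
qed (auto simp: cube_ide_def delta_def sigma_def cube_def split: if_splits)

lemma square_homD:
  assumes "u \<in> hom square m n"
  shows "u \<in> cube_arrs" "fst u = m" "fst (snd u) = n"
    "snd (snd u) \<in> cube m \<rightarrow>\<^sub>E cube n"
  using assms cube_arrs_PiE[of u] by (auto simp: hom_def square_def)

lemma square_homE:
  assumes "u \<in> hom square m n"
  obtains f where "u = (m, n, f)" "f \<in> cube m \<rightarrow>\<^sub>E cube n"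
  using square_homD[OF assms] by (metis prod.collapse)

lemma square_homI:
  "u \<in> cube_arrs \<Longrightarrow> fst u = m \<Longrightarrow> fst (snd u) = n \<Longrightarrow> u \<in> hom square m n"
  by (simp add: hom_def square_def)

lemma Comp_square [simp]: "Comp square v u = cube_comp v u"
  and Ide_square [simp]: "Ide square n = cube_ide n"
  and Obj_square [simp]: "Obj square = UNIV"
  and Arr_square [simp]: "Arr square = cube_arrs"
  and Dom_square [simp]: "Dom square u = fst u"
  and Cod_square [simp]: "Cod square u = fst (snd u)"
  by (simp_all add: square_def)

lemma fst_cube_comp [simp]: "fst (cube_comp v u) = fst u"
  and fst_snd_cube_comp [simp]: "fst (snd (cube_comp v u)) = fst (snd v)"
  by (simp_all add: cube_comp_def split: prod.split)

lemma category_square: "category square"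
proof
  show "Dom square f \<in> Obj square" "Cod square f \<in> Obj square" for f by simp_all
  show "Ide square a \<in> hom square a a" for a
    by (rule square_homI) (simp_all add: cube_arrs.ide, simp_all add: cube_ide_def)
  show "Comp square g f \<in> hom square a c" if "f \<in> hom square a b" "g \<in> hom square b c" for f g a b c
    using square_homD[OF that(1)] square_homD[OF that(2)]
    by (intro square_homI) (auto intro: cube_arrs.comp)
  show "Comp square f (Ide square a) = f" if f: "f \<in> hom square a b" for f a b
  proof -
    obtain u where "f = (a, b, u)" "u \<in> cube a \<rightarrow>\<^sub>E cube b" using square_homE[OF f] .
    then show ?thesis
      by (auto simp: cube_comp_def cube_ide_def compose_def fun_eq_iff PiE_def extensional_def)
  qed
  show "Comp square (Ide square b) f = f" if f: "f \<in> hom square a b" for f a b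
  proof -
    obtain u where "f = (a, b, u)" "u \<in> cube a \<rightarrow>\<^sub>E cube b" using square_homE[OF f] .
    then show ?thesis
      by (auto simp: cube_comp_def cube_ide_def compose_def fun_eq_iff PiE_def extensional_def)
  qed
  show "Comp square h (Comp square g f) = Comp square (Comp square h g) f"
    if fgh: "f \<in> hom square a b" "g \<in> hom square b c" "h \<in> hom square c d" for f g h a b c d
  proof -
    obtain u v w where "f = (a, b, u)" "u \<in> cube a \<rightarrow>\<^sub>E cube b" "g = (b, c, v)" "h = (c, d, w)"
      using square_homE[OF fgh(1)] square_homE[OF fgh(2)] square_homE[OF fgh(3)] by metis
    then show ?thesis
      by (auto simp: cube_comp_def compose_def fun_eq_iff)
  qed
qed

interpretation square: category square
  by (rule category_square)

lemma cube_ide_simps [simp]: "fst (cube_ide n) = n" "fst (snd (cube_ide n)) = n"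
  by (simp_all add: cube_ide_def)

lemma delta_hom: "delta i \<in> hom square 0 1"
  by (rule square_homI) (simp_all add: cube_arrs.delta, simp_all add: delta_def)

lemma sigma_hom: "sigma \<in> hom square 1 0"
  by (rule square_homI) (simp_all add: cube_arrs.sigma, simp_all add: sigma_def)

lemma fst_cube_tensor [simp]: "fst (cube_tensor u v) = fst u + fst v"
  and fst_snd_cube_tensor [simp]: "fst (snd (cube_tensor u v)) = fst (snd u) + fst (snd v)"
  by (simp_all add: cube_tensor_def split: prod.split)

lemma tensor_hom:
  "u \<in> hom square m n \<Longrightarrow> v \<in> hom square m' n' \<Longrightarrow> cube_tensor u v \<in> hom square (m + m') (n + n')"
  using square_homD[of u m n] square_homD[of v m' n']
  by (auto intro!: square_homI cube_arrs.tensor)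

text \<open>The list \<open>[]\<close> is the only point of the 0-cube. Hence a cell of an endpoint
  of the interval factors through that endpoint in only one way.\<close>

lemma hom_square_zero_unique:
  assumes "u \<in> hom square m 0" "v \<in> hom square m 0"
  shows "u = v"
proof -
  have "snd (snd u) = snd (snd v)"
  proof (rule PiE_ext)
    show "snd (snd u) \<in> cube m \<rightarrow>\<^sub>E cube 0" "snd (snd v) \<in> cube m \<rightarrow>\<^sub>E cube 0"
      using assms square_homD(4) by blast+
    then show "snd (snd u) x = snd (snd v) x" if "x \<in> cube m" for x
      using that by (auto simp: cube_def dest!: PiE_mem)
  qed
  then show ?thesis using square_homD(2,3)[OF assms(1)] square_homD(2,3)[OF assms(2)]
    by (metis prod.collapse)
qed

lemma tensor_cube_ide: "cube_tensor (cube_ide m) (cube_ide n) = cube_ide (m + n)"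
  by (auto simp: cube_tensor_def cube_ide_def cube_def fun_eq_iff)

lemma tensor_assoc:
  assumes "u \<in> cube_arrs" "v \<in> cube_arrs" "w \<in> cube_arrs"
  shows "cube_tensor (cube_tensor u v) w = cube_tensor u (cube_tensor v w)"
proof -
  obtain m n f m' n' g m'' n'' h where eqs: "u = (m, n, f)" "v = (m', n', g)" "w = (m'', n'', h)"
    by (metis prod_cases3)
  then show ?thesis
    by (auto simp: cube_tensor_def cube_def fun_eq_iff add.assoc drop_take add.commute[of m' m])
qed

lemma tensor_ide_zero: "u \<in> cube_arrs \<Longrightarrow> cube_tensor u (cube_ide 0) = u"
  using cube_arrs_PiE[of u]
  by (cases u) (auto simp: cube_tensor_def cube_ide_def cube_def fun_eq_iff PiE_def extensional_def)

lemma ide_zero_tensor: "u \<in> cube_arrs \<Longrightarrow> cube_tensor (cube_ide 0) u = u"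
  using cube_arrs_PiE[of u]
  by (cases u) (auto simp: cube_tensor_def cube_ide_def cube_def fun_eq_iff PiE_def extensional_def)

section \<open>Cofaces and the cubical identity\<close>

lemma coface_eq:
  assumes "k < n"
  shows "coface n k i = (n - 1, n, \<lambda>x \<in> cube (n - 1). take k x @ i # drop k x)"
  using assms
  by (auto simp: coface_def cube_tensor_def cube_ide_def delta_def cube_def fun_eq_iff)

lemma coface_hom: "k < n \<Longrightarrow> coface n k i \<in> hom square (n - 1) n"
  using tensor_hom[OF tensor_hom[OF square.ide_hom[of k] delta_hom[of i]] square.ide_hom[of "n - 1 - k"]]
  by (simp add: coface_def)

lemma coface_last: "coface (Suc n) n i = cube_tensor (cube_ide n) (delta i)"
  unfolding coface_def by (simp add: tensor_ide_zero cube_arrs.intros)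

text \<open>The trailing identities split off one interval, so a face outside the last direction is
  a face of the \<open>n\<close>-cube times an interval. Together with \<open>coface_last\<close>
  this sorts the faces for the inductive step.\<close>

lemma coface_Suc:
  assumes "k < n"
  shows "coface (Suc n) k i = cube_tensor (coface n k i) (cube_ide 1)"
proof -
  have *: "cube_ide (n - k) = cube_tensor (cube_ide (n - 1 - k)) (cube_ide 1)"
    using assms by (simp add: tensor_cube_ide Suc_diff_Suc)
  show ?thesis unfolding coface_def
    using * by (simp add: tensor_assoc cube_arrs.intros)
qed

text \<open>Two insertions into a list commute. The larger index drops by one because the entry at
  \<open>l\<close> is not yet there when \<open>i\<close> is inserted first.\<close>

lemma coface_coface:
  assumes "l < k" "k < n"
  shows "cube_comp (coface n k i) (coface (n - 1) l j)
       = cube_comp (coface n l j) (coface (n - 1) (k - 1) i)"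
proof -
  \<comment> \<open>Writing \<open>k\<close> as \<open>l + m + 1\<close> removes the truncated
    subtraction in \<open>k - 1\<close>.\<close>
  obtain m where k: "k = Suc (l + m)" using assms(1) less_iff_Suc_add by auto
  have "take k (take l x @ j # drop l x) @ i # drop k (take l x @ j # drop l x)
      = take l (take (k - 1) x @ i # drop (k - 1) x)
        @ j # drop l (take (k - 1) x @ i # drop (k - 1) x)"
    if "length x = n - 2" for x
  proof -
    have [simp]: "min (length x) l = l" "l - length x = 0" "min (length x) (l + m) = l + m"
      using that assms k by auto
    show ?thesis by (simp add: k drop_take add.commute)
  qed
  then show ?thesis
    using assms by (auto simp: coface_eq cube_comp_def compose_def cube_def fun_eq_iff)
qed

section \<open>Words\<close>

text \<open>A word is a tensor product of the identity of the interval, the degeneracy and the two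
  cofaces. It determines an arrow of cubes, and two words with the same arrow differ only by
  commuting \<open>Drop\<close> with \<open>Face\<close>.\<close>

datatype letter = Pass | Drop | Face bool

fun word_dom :: "letter list \<Rightarrow> nat" where
  "word_dom [] = 0"
| "word_dom (Pass # w) = Suc (word_dom w)"
| "word_dom (Drop # w) = Suc (word_dom w)"
| "word_dom (Face b # w) = word_dom w"

fun word_cod :: "letter list \<Rightarrow> nat" where
  "word_cod [] = 0"
| "word_cod (Pass # w) = Suc (word_cod w)"
| "word_cod (Drop # w) = word_cod w"
| "word_cod (Face b # w) = Suc (word_cod w)"

fun word_fun :: "letter list \<Rightarrow> bool list \<Rightarrow> bool list" where
  "word_fun [] x = []"
| "word_fun (Pass # w) x = hd x # word_fun w (tl x)"
| "word_fun (Drop # w) x = word_fun w (tl x)"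
| "word_fun (Face b # w) x = b # word_fun w x"

definition word_arr :: "letter list \<Rightarrow> cube_arr" where
  "word_arr w = (word_dom w, word_cod w, \<lambda>x \<in> cube (word_dom w). word_fun w x)"

text \<open>The words are zipped. A \<open>Face\<close> of the outer word consumes no input and a
  \<open>Drop\<close> of the inner word produces no output, so these are emitted at once; otherwise
  the first letter of \<open>v\<close> consumes the output of the first letter of \<open>w\<close>,
  and \<open>Drop\<close> after \<open>Face\<close> cancels. The values for words that do not match
  are arbitrary.\<close>

fun word_comp :: "letter list \<Rightarrow> letter list \<Rightarrow> letter list" where
  "word_comp (Face b # v) w = Face b # word_comp v w"
| "word_comp [] w = w"
| "word_comp (l # v) (Drop # w) = Drop # word_comp (l # v) w"
| "word_comp (Pass # v) (l # w) = l # word_comp v w"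
| "word_comp (Drop # v) (Pass # w) = Drop # word_comp v w"
| "word_comp (Drop # v) (Face b # w) = word_comp v w"
| "word_comp (l # v) [] = []"

lemma length_word_fun [simp]: "length (word_fun w x) = word_cod w"
  by (induction w x rule: word_fun.induct) auto

lemma word_dom_append [simp]: "word_dom (v @ w) = word_dom v + word_dom w"
  and word_cod_append [simp]: "word_cod (v @ w) = word_cod v + word_cod w"
  by (induction v rule: word_dom.induct) auto

lemma word_fun_append:
  "length x = word_dom v + word_dom w \<Longrightarrow>
    word_fun (v @ w) x = word_fun v (take (word_dom v) x) @ word_fun w (drop (word_dom v) x)"
  by (induction v x rule: word_fun.induct) (auto simp: tl_take drop_Suc hd_take)

lemma word_fun_cod_zero: "word_cod w = 0 \<Longrightarrow> word_fun w x = []"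
  by (metis length_0_conv length_word_fun)

lemma word_comp:
  "word_cod w = word_dom v \<Longrightarrow> word_dom (word_comp v w) = word_dom w"
  "word_cod w = word_dom v \<Longrightarrow> word_cod (word_comp v w) = word_cod v"
  "word_cod w = word_dom v \<Longrightarrow> word_fun (word_comp v w) x = word_fun v (word_fun w x)"
  by (induction v w arbitrary: x rule: word_comp.induct) (auto simp: word_fun_cod_zero)

lemma word_arr_append: "word_arr (v @ w) = cube_tensor (word_arr v) (word_arr w)"
  by (auto simp: word_arr_def cube_tensor_def cube_def fun_eq_iff word_fun_append)

lemma word_arr_comp:
  "word_cod w = word_dom v \<Longrightarrow> word_arr (word_comp v w) = cube_comp (word_arr v) (word_arr w)"
  by (auto simp: word_arr_def cube_comp_def compose_def cube_def fun_eq_iff word_comp)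

lemma fst_word_arr [simp]: "fst (word_arr w) = word_dom w"
  and fst_snd_word_arr [simp]: "fst (snd (word_arr w)) = word_cod w"
  by (simp_all add: word_arr_def)

lemma word_dom_replicate_Pass [simp]: "word_dom (replicate n Pass) = n"
  and word_cod_replicate_Pass [simp]: "word_cod (replicate n Pass) = n"
  by (induction n) auto

lemma word_fun_replicate_Pass: "length x = n \<Longrightarrow> word_fun (replicate n Pass) x = x"
  by (induction n arbitrary: x) (auto simp: length_Suc_conv)

lemma word_arr_simps:
  "word_arr (replicate n Pass) = cube_ide n"
  "word_arr [Face i] = delta i"
  "word_arr [Drop] = sigma"
  by (auto simp: word_arr_def cube_ide_def delta_def sigma_def cube_def fun_eq_iff
      word_fun_replicate_Pass)

text \<open>The generators are words, and words are closed under tensor (append) and composition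
  (\<open>word_comp\<close>). So every iterated composite of tensors flattens to a single tensor of
  generators.\<close>

lemma word_arr_surj: "u \<in> cube_arrs \<Longrightarrow> \<exists>w. word_arr w = u"
proof (induction rule: cube_arrs.induct)
  case (tensor u v)
  then show ?case by (metis word_arr_append)
next
  case (comp u v)
  then show ?case by (metis word_arr_comp fst_word_arr fst_snd_word_arr)
qed (use word_arr_simps in blast)+

text \<open>\<open>swap\<close> is the only proper relation: the cancellation of a degeneracy
  against a coface is carried out by \<open>word_comp\<close> and never has to be imposed on
  words.\<close>

inductive word_equiv :: "letter list \<Rightarrow> letter list \<Rightarrow> bool" where
  refl: "word_equiv w w"
| sym: "word_equiv v w \<Longrightarrow> word_equiv w v"
| trans: "word_equiv u v \<Longrightarrow> word_equiv v w \<Longrightarrow> word_equiv u w"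
| cong: "word_equiv v w \<Longrightarrow> word_equiv (l # v) (l # w)"
| swap: "word_equiv (Drop # Face b # w) (Face b # Drop # w)"

lemma word_equiv_dom_cod_fun:
  assumes "word_equiv v w"
  shows "word_dom v = word_dom w" "word_cod v = word_cod w"
    "length x = word_dom v \<Longrightarrow> word_fun v x = word_fun w x"
proof -
  have "word_dom v = word_dom w \<and> word_cod v = word_cod w \<and>
      (\<forall>x. length x = word_dom v \<longrightarrow> word_fun v x = word_fun w x)"
    using assms
  proof (induction rule: word_equiv.induct)
    case (cong v w l)
    then show ?case by (cases l) auto
  qed auto
  then show "word_dom v = word_dom w" "word_cod v = word_cod w"
    "length x = word_dom v \<Longrightarrow> word_fun v x = word_fun w x" by auto
qed

text \<open>A leading \<open>Pass\<close> would let the first output vary, so \<open>w\<close>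
  starts with some \<open>Drop\<close>s followed by \<open>Face b\<close>, and swapping moves that
  \<open>Face b\<close> to the front. The length is kept because it is the measure of the next
  induction.\<close>

lemma word_equiv_Face:
  assumes "\<And>x. length x = word_dom w \<Longrightarrow> \<exists>y. word_fun w x = b # y"
  shows "\<exists>w'. word_equiv w (Face b # w') \<and> length w = Suc (length w')"
  using assms
proof (induction w rule: word_dom.induct)
  case (2 w)
  \<comment> \<open>An input whose first entry is the negation of \<open>b\<close> is copied by
    \<open>Pass\<close> and refutes the hypothesis.\<close>
  then show ?case using "2.prems"[of "(\<not> b) # replicate (word_dom w) b"] by auto
next
  case (3 w)
  have "\<exists>y. word_fun w x = b # y" if "length x = word_dom w" for x
    using "3.prems"[of "b # x"] that by simp
  then obtain w' where "word_equiv w (Face b # w')" "length w = Suc (length w')"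
    using "3.IH" by blast
  then show ?case
    by (intro exI[of _ "Drop # w'"]) (auto intro: word_equiv.trans word_equiv.cong word_equiv.swap)
next
  case (4 c w)
  then show ?case
    using "4.prems"[of "replicate (word_dom w) b"] by (auto intro: word_equiv.refl)
qed auto

text \<open>Compare first letters. \<open>Pass\<close> makes the first output follow the first
  input, which neither \<open>Drop\<close> nor \<open>Face\<close> can imitate; equal letters
  cancel; and \<open>Face\<close> against \<open>Drop\<close> is settled by moving the matching
  \<open>Face\<close> to the front of the other word.\<close>

lemma word_equivI:
  assumes "word_dom v = word_dom w"
    and "\<And>x. length x = word_dom v \<Longrightarrow> word_fun v x = word_fun w x"
  shows "word_equiv v w"
  using assms
proof (induction "length v + length w" arbitrary: v w rule: less_induct)
  case less
  \<comment> \<open>After swapping, the tail to compare with is \<open>w''\<close>, which is no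
    subword of \<open>w\<close>. Hence the induction on total length instead of on
    structure.\<close>
  have Face: "word_equiv (Face b # v') (Drop # w')"
    if eq: "word_dom v' = Suc (word_dom w')"
      "\<And>x. length x = word_dom v' \<Longrightarrow> word_fun (Face b # v') x = word_fun (Drop # w') x"
      and len: "length v + length w = Suc (Suc (length v' + length w'))"
    for b v' w'
  proof -
    obtain w'' where w'': "word_equiv (Drop # w') (Face b # w'')" "length (Drop # w') = Suc (length w'')"
      using word_equiv_Face[of "Drop # w'" b] eq by (metis word_dom.simps(3) word_fun.simps(4))
    have "word_equiv v' w''"
    proof (rule less.hyps)
      show "length v' + length w'' < length v + length w" using w'' len by simp
      show "word_dom v' = word_dom w''" using word_equiv_dom_cod_fun(1)[OF w''(1)] eq by simp
      show "word_fun v' x = word_fun w'' x" if "length x = word_dom v'" for x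
        using word_equiv_dom_cod_fun(3)[OF w''(1), of x] eq(1) eq(2)[OF that] that by simp
    qed
    then show ?thesis using w''(1) by (meson word_equiv.cong word_equiv.sym word_equiv.trans)
  qed
  have tail: "word_equiv (l # v') (l # w')"
    if "v = l # v'" "w = l # w'" "word_dom v' = word_dom w'"
      "\<And>x. length x = word_dom v' \<Longrightarrow> word_fun v' x = word_fun w' x" for l v' w'
    using less.hyps[of v' w'] that by (intro word_equiv.cong) auto
  have cod: "word_cod v = word_cod w"
    using less.prems(2)[of "replicate (word_dom v) True"] by (metis length_replicate length_word_fun)
  \<comment> \<open>The right side never sees the first entry of \<open>x\<close>, whereas the left
    side displays it; two inputs differing only there give a contradiction.\<close>
  have hd_differs: "\<not> (\<forall>x. length x = Suc n \<longrightarrow> hd x # f x = word_fun u (tl x))"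
    for n u and f :: "bool list \<Rightarrow> bool list"
  proof
    assume *: "\<forall>x. length x = Suc n \<longrightarrow> hd x # f x = word_fun u (tl x)"
    show False
      using *[rule_format, of "True # replicate n True"] *[rule_format, of "False # replicate n True"]
      by (cases "word_fun u (replicate n True)") auto
  qed
  have hd_const: "\<not> (\<forall>x. length x = Suc n \<longrightarrow> hd x # f x = b # g x)"
    for n b and f g :: "bool list \<Rightarrow> bool list"
  proof
    assume *: "\<forall>x. length x = Suc n \<longrightarrow> hd x # f x = b # g x"
    show False using *[rule_format, of "(\<not> b) # replicate n True"] by auto
  qed
  show ?case
  proof (cases v)
    case Nil
    then show ?thesis using less.prems cod by (cases w rule: word_dom.cases) (auto intro: word_equiv.refl)
  next
    case v: (Cons l v')
    show ?thesis
    proof (cases w)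
      case Nil
      then show ?thesis using less.prems cod v by (cases l) auto
    next
      case w: (Cons l' w')
      have fun_eq: "word_fun (l # v') x = word_fun (l' # w') x" if "length x = word_dom (l # v')" for x
        using less.prems(2)[of x] that v w by simp
      have dom_eq: "word_dom (l # v') = word_dom (l' # w')" using less.prems(1) v w by simp
      have fun_eq': "word_fun (l' # w') x = word_fun (l # v') x" if "length x = word_dom (l' # w')" for x
        using fun_eq[of x] that dom_eq by simp
      show ?thesis
      proof (cases l; cases l')
        assume l: "l = Pass" "l' = Pass"
        then show ?thesis using tail[of Pass v' w'] dom_eq fun_eq[of "True # _"] v w by simp
      next
        assume l: "l = Pass" "l' = Drop"
        have "\<forall>x. length x = Suc (word_dom v') \<longrightarrow> hd x # word_fun v' (tl x) = word_fun w' (tl x)"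
          using fun_eq l by simp
        then show ?thesis using hd_differs[of "word_dom v'" "\<lambda>x. word_fun v' (tl x)" w'] by blast
      next
        fix b assume l: "l = Pass" "l' = Face b"
        have "\<forall>x. length x = Suc (word_dom v') \<longrightarrow> hd x # word_fun v' (tl x) = b # word_fun w' x"
          using fun_eq l by simp
        then show ?thesis using hd_const[of "word_dom v'" "\<lambda>x. word_fun v' (tl x)" b "word_fun w'"] by blast
      next
        assume l: "l = Drop" "l' = Pass"
        have "\<forall>x. length x = Suc (word_dom w') \<longrightarrow> hd x # word_fun w' (tl x) = word_fun v' (tl x)"
          using fun_eq' l by simp
        then show ?thesis using hd_differs[of "word_dom w'" "\<lambda>x. word_fun w' (tl x)" v'] by blast
      next
        assume l: "l = Drop" "l' = Drop"
        then show ?thesis using tail[of Drop v' w'] dom_eq fun_eq[of "True # _"] v w by simp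
      next
        fix b assume l: "l = Drop" "l' = Face b"
        have "word_equiv (Face b # w') (Drop # v')"
          by (rule Face) (use dom_eq fun_eq' v w l in simp_all)
        then show ?thesis using v w l word_equiv.sym by simp
      next
        fix b assume l: "l = Face b" "l' = Pass"
        have "\<forall>x. length x = Suc (word_dom w') \<longrightarrow> hd x # word_fun w' (tl x) = b # word_fun v' x"
          using fun_eq' l by simp
        then show ?thesis using hd_const[of "word_dom w'" "\<lambda>x. word_fun w' (tl x)" b "word_fun v'"] by blast
      next
        fix b assume l: "l = Face b" "l' = Drop"
        have "word_equiv (Face b # v') (Drop # w')"
          by (rule Face) (use dom_eq fun_eq v w l in simp_all)
        then show ?thesis using v w l by simp
      next
        fix b c assume l: "l = Face b" "l' = Face c"
        have "b = c" using fun_eq[of "replicate (word_dom v') True"] l by simp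
        then show ?thesis using tail[of "Face b" v' w'] dom_eq fun_eq v w l by simp
      qed
    qed
  qed
qed

lemma word_arr_eq_imp_equiv:
  assumes "word_arr v = word_arr w"
  shows "word_equiv v w"
proof (rule word_equivI)
  show "word_dom v = word_dom w" using assms by (metis fst_word_arr)
  show "word_fun v x = word_fun w x" if "length x = word_dom v" for x
    using that assms unfolding word_arr_def
    by (metis (mono_tags, lifting) cube_def mem_Collect_eq prod.inject restrict_apply')
qed

section \<open>The strict monoidal extension of a natural cylinder\<close>

context category
begin

abbreviation comp (infixr "\<cdot>" 70) where "g \<cdot> f \<equiv> Comp C g f"

lemma comp_simps [simp]:
  assumes "f \<in> Arr C" "g \<in> Arr C" "Cod C f = Dom C g"
  shows "g \<cdot> f \<in> Arr C" "Dom C (g \<cdot> f) = Dom C f" "Cod C (g \<cdot> f) = Cod C g"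
  using comp_hom[of f "Dom C f" "Cod C f" g "Cod C g"] assms by (auto simp: hom_def)

lemma comp_assoc' [simp]:
  assumes "f \<in> Arr C" "g \<in> Arr C" "h \<in> Arr C" "Cod C f = Dom C g" "Cod C g = Dom C h"
  shows "(h \<cdot> g) \<cdot> f = h \<cdot> g \<cdot> f"
  using comp_assoc[of f "Dom C f" "Cod C f" g "Cod C g" h "Cod C h"] assms by (simp add: hom_def)

lemma ide_simps [simp]:
  assumes "a \<in> Obj C"
  shows "Ide C a \<in> Arr C" "Dom C (Ide C a) = a" "Cod C (Ide C a) = a"
  using ide_hom[OF assms] by (auto simp: hom_def)

lemma comp_ide_simps [simp]:
  "f \<in> Arr C \<Longrightarrow> Dom C f = a \<Longrightarrow> f \<cdot> Ide C a = f"
  "f \<in> Arr C \<Longrightarrow> Cod C f = a \<Longrightarrow> Ide C a \<cdot> f = f"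
  using comp_ide[of f] ide_comp[of f] by (auto simp: hom_def)

text \<open>Composites are kept bracketed to the right, where \<open>g\<close> and \<open>f\<close>
  are separated by the bracket around \<open>f\<close> and its successor. This form lets a known
  value of their composite be substituted there.\<close>

lemma comp_extend:
  assumes "g \<cdot> f = k" "e \<in> Arr C" "f \<in> Arr C" "g \<in> Arr C" "Cod C e = Dom C f" "Cod C f = Dom C g"
  shows "g \<cdot> f \<cdot> e = k \<cdot> e"
  using assms comp_assoc' by metis

lemma comp_extend2:
  assumes "g \<cdot> f = g' \<cdot> f'" "e \<in> Arr C" "f \<in> Arr C" "g \<in> Arr C" "f' \<in> Arr C" "g' \<in> Arr C"
    "Cod C e = Dom C f" "Cod C f = Dom C g" "Cod C f' = Dom C g'" "Dom C f' = Dom C f"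
  shows "g \<cdot> f \<cdot> e = g' \<cdot> f' \<cdot> e"
  using assms comp_assoc' by metis

end

section \<open>Cylinder data and the natural transformation of a word\<close>

lemma is_functor_simps:
  assumes "is_functor C D F"
  shows "a \<in> Obj C \<Longrightarrow> fo F a \<in> Obj D"
    "f \<in> Arr C \<Longrightarrow> fa F f \<in> Arr D"
    "f \<in> Arr C \<Longrightarrow> Dom D (fa F f) = fo F (Dom C f)"
    "f \<in> Arr C \<Longrightarrow> Cod D (fa F f) = fo F (Cod C f)"
    "a \<in> Obj C \<Longrightarrow> fa F (Ide C a) = Ide D (fo F a)"
    "f \<in> Arr C \<Longrightarrow> g \<in> Arr C \<Longrightarrow> Cod C f = Dom C g \<Longrightarrow> fa F (Comp C g f) = Comp D (fa F g) (fa F f)"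
  using assms unfolding is_functor_def hom_def by auto

text \<open>A natural cylinder in components: \<open>q\<close> is Q_1, \<open>d\<close> the two
  endpoint inclusions, \<open>s\<close> the projection, with Q_0 already replaced by the identity.
  These are the generators and relations from which the monoidal extension is built.\<close>

locale interval_functor = category M for M :: "('o, 'm, 'z) cat_scheme" +
  fixes q :: "('o, 'm, 'o, 'm) func" and d :: "bool \<Rightarrow> 'o \<Rightarrow> 'm" and s :: "'o \<Rightarrow> 'm"
  assumes q_functor: "is_functor M M q"
    and d_hom: "X \<in> Obj M \<Longrightarrow> d b X \<in> hom M X (fo q X)"
    and d_natural: "f \<in> Arr M \<Longrightarrow> Comp M (d b (Cod M f)) f = Comp M (fa q f) (d b (Dom M f))"
    and s_hom: "X \<in> Obj M \<Longrightarrow> s X \<in> hom M (fo q X) X"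
    and s_natural: "f \<in> Arr M \<Longrightarrow> Comp M (s (Cod M f)) (fa q f) = Comp M f (s (Dom M f))"
    and s_d: "X \<in> Obj M \<Longrightarrow> Comp M (s X) (d b X) = Ide M X"
begin

abbreviation comp\<^sub>M (infixr "\<cdot>" 70) where "g \<cdot> f \<equiv> Comp M g f"

lemmas q_simps [simp] = is_functor_simps[OF q_functor]

lemma d_simps [simp]:
  "X \<in> Obj M \<Longrightarrow> d b X \<in> Arr M" "X \<in> Obj M \<Longrightarrow> Dom M (d b X) = X"
  "X \<in> Obj M \<Longrightarrow> Cod M (d b X) = fo q X"
  using d_hom by (auto simp: hom_def)

lemma s_simps [simp]:
  "X \<in> Obj M \<Longrightarrow> s X \<in> Arr M" "X \<in> Obj M \<Longrightarrow> Dom M (s X) = fo q X"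
  "X \<in> Obj M \<Longrightarrow> Cod M (s X) = X"
  using s_hom by (auto simp: hom_def)

lemmas dom_cod_obj [simp] = dom_obj cod_obj

definition power :: "nat \<Rightarrow> ('o, 'm, 'o, 'm) func" where
  "power n = \<lparr>fo = \<lambda>X \<in> Obj M. (fo q ^^ n) X, fa = \<lambda>f \<in> Arr M. (fa q ^^ n) f\<rparr>"

lemma fo_power [simp]: "X \<in> Obj M \<Longrightarrow> fo (power n) X = (fo q ^^ n) X"
  and fa_power [simp]: "f \<in> Arr M \<Longrightarrow> fa (power n) f = (fa q ^^ n) f"
  by (simp_all add: power_def)

lemma funpow_obj [simp]: "X \<in> Obj M \<Longrightarrow> (fo q ^^ n) X \<in> Obj M"
  by (induction n) auto

lemma funpow_arr [simp]:
  assumes "f \<in> Arr M"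
  shows "(fa q ^^ n) f \<in> Arr M" "Dom M ((fa q ^^ n) f) = (fo q ^^ n) (Dom M f)"
    "Cod M ((fa q ^^ n) f) = (fo q ^^ n) (Cod M f)"
  using assms by (induction n) auto

lemma funpow_ide [simp]: "X \<in> Obj M \<Longrightarrow> (fa q ^^ n) (Ide M X) = Ide M ((fo q ^^ n) X)"
  by (induction n) auto

lemma funpow_comp [simp]:
  "f \<in> Arr M \<Longrightarrow> g \<in> Arr M \<Longrightarrow> Cod M f = Dom M g \<Longrightarrow>
    (fa q ^^ n) (g \<cdot> f) = (fa q ^^ n) g \<cdot> (fa q ^^ n) f"
  by (induction n) auto

lemma power_ext_functor: "power n \<in> ext_functors M M"
  by (auto simp: ext_functors_def is_functor_def power_def hom_def)

lemma power_add: "power (m + n) = functor_comp M (power m) (power n)"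
  by (auto simp: power_def functor_comp_def compose_def funpow_add)

text \<open>The leftmost letter acts outermost, as in \<open>horizontal_comp\<close>: first the
  tail, inside \<open>q\<close> if the letter has the interval as source, then the component of the
  letter at the target of the tail.\<close>

fun word_trans :: "letter list \<Rightarrow> 'o \<Rightarrow> 'm" where
  "word_trans [] X = Ide M X"
| "word_trans (Pass # w) X = fa q (word_trans w X)"
| "word_trans (Drop # w) X = s ((fo q ^^ word_cod w) X) \<cdot> fa q (word_trans w X)"
| "word_trans (Face b # w) X = d b ((fo q ^^ word_cod w) X) \<cdot> word_trans w X"

lemma word_trans_simps [simp]:
  assumes "X \<in> Obj M"
  shows "word_trans w X \<in> Arr M" "Dom M (word_trans w X) = (fo q ^^ word_dom w) X"
    "Cod M (word_trans w X) = (fo q ^^ word_cod w) X"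
proof -
  have "word_trans w X \<in> Arr M \<and> Dom M (word_trans w X) = (fo q ^^ word_dom w) X \<and>
      Cod M (word_trans w X) = (fo q ^^ word_cod w) X"
    using assms by (induction w X rule: word_trans.induct) auto
  then show "word_trans w X \<in> Arr M" "Dom M (word_trans w X) = (fo q ^^ word_dom w) X"
    "Cod M (word_trans w X) = (fo q ^^ word_cod w) X" by auto
qed

lemma word_trans_natural:
  "f \<in> Arr M \<Longrightarrow>
    word_trans w (Cod M f) \<cdot> (fa q ^^ word_dom w) f = (fa q ^^ word_cod w) f \<cdot> word_trans w (Dom M f)"
proof (induction w rule: word_dom.induct)
  case (2 w)
  then show ?case by (simp flip: q_simps(6))
next
  case (3 w)
  have "fa q (word_trans w (Cod M f)) \<cdot> fa q ((fa q ^^ word_dom w) f)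
      = fa q ((fa q ^^ word_cod w) f) \<cdot> fa q (word_trans w (Dom M f))"
    using 3 by (simp flip: q_simps(6))
  then show ?case
    using 3 comp_extend2[OF s_natural[of "(fa q ^^ word_cod w) f"], of "fa q (word_trans w (Dom M f))"]
    by simp
next
  case (4 b w)
  then show ?case
    using comp_extend2[OF d_natural[of "(fa q ^^ word_cod w) f" b], of "word_trans w (Dom M f)"] by simp
qed simp

lemma s_extend:
  "f \<in> Arr M \<Longrightarrow> e \<in> Arr M \<Longrightarrow> Cod M e = fo q (Dom M f) \<Longrightarrow>
    s (Cod M f) \<cdot> fa q f \<cdot> e = f \<cdot> s (Dom M f) \<cdot> e"
  using comp_extend2[OF s_natural] by simp

lemma d_extend:
  "f \<in> Arr M \<Longrightarrow> e \<in> Arr M \<Longrightarrow> Cod M e = Dom M f \<Longrightarrow>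
    d b (Cod M f) \<cdot> f \<cdot> e = fa q f \<cdot> d b (Dom M f) \<cdot> e"
  using comp_extend2[OF d_natural] by simp

lemma s_d_extend: "e \<in> Arr M \<Longrightarrow> Cod M e = X \<Longrightarrow> s X \<cdot> d b X \<cdot> e = e"
  using comp_extend[OF s_d] by auto

text \<open>Each clause of \<open>word_comp\<close> mirrors a law: naturality of \<open>s\<close>
  when an inner \<open>Drop\<close> is pulled out, naturality of \<open>d\<close> when a
  \<open>Face\<close> passes the outer word, functoriality of \<open>q\<close> otherwise. The
  relation between \<open>s\<close> and \<open>d\<close> enters only where \<open>Drop\<close> meets
  \<open>Face\<close>.\<close>

lemma word_trans_comp:
  "word_cod w = word_dom v \<Longrightarrow> X \<in> Obj M \<Longrightarrow>
    word_trans (word_comp v w) X = word_trans v X \<cdot> word_trans w X"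
proof (induction v w rule: word_comp.induct)
  case ("3_1" v w)
  then show ?case
    using s_extend[of "word_trans (Pass # v) X" "fa q (word_trans w X)"] by (simp add: word_comp)
next
  case ("3_2" v w)
  then show ?case
    using s_extend[of "word_trans (Drop # v) X" "fa q (word_trans w X)"] by (simp add: word_comp)
next
  case ("4_1" v w)
  then show ?case by (simp add: word_comp)
next
  case ("4_2" v b w)
  then show ?case
    using d_extend[of "word_trans v X" "word_trans w X" b] by (simp add: word_comp)
next
  case (5 v w)
  then show ?case by (simp add: word_comp)
next
  case (6 v b w)
  then show ?case
    using d_extend[of "word_trans v X" "word_trans w X" b, symmetric]
      s_d_extend[of "word_trans v X \<cdot> word_trans w X"]
    by (simp add: word_comp)
qed (auto simp: word_comp)

lemma word_trans_append:
  "X \<in> Obj M \<Longrightarrow>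
    word_trans (v @ w) X
      = word_trans v ((fo q ^^ word_cod w) X) \<cdot> (fa q ^^ word_dom v) (word_trans w X)"
  by (induction v rule: word_dom.induct) (auto simp: funpow_add)

text \<open>The relation \<open>swap\<close> is naturality of \<open>s\<close> at an arrow
  \<open>d b\<close>.\<close>

lemma word_trans_equiv:
  "word_equiv v w \<Longrightarrow> X \<in> Obj M \<Longrightarrow> word_trans v X = word_trans w X"
proof (induction rule: word_equiv.induct)
  case (cong v w l)
  then show ?case using word_equiv_dom_cod_fun[OF cong(1)] by (cases l) auto
next
  case (swap b w)
  then show ?case
    using s_extend[of "d b ((fo q ^^ word_cod w) X)" "fa q (word_trans w X)"]
    by simp
qed auto

definition word_of :: "cube_arr \<Rightarrow> letter list" where
  "word_of u = (SOME w. word_arr w = u)"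

lemma word_arr_word_of: "u \<in> cube_arrs \<Longrightarrow> word_arr (word_of u) = u"
  unfolding word_of_def by (rule someI_ex) (rule word_arr_surj)

definition extension :: "('o, 'm) cubical_functor" where
  "extension = \<lparr>fo = power, fa = \<lambda>u. (power (fst u), power (fst (snd u)),
     \<lambda>X \<in> Obj M. word_trans (word_of u) X)\<rparr>"

text \<open>Independence of the chosen word. It lets composites and tensors be computed with
  \<open>word_comp\<close> and append although \<open>word_of\<close> makes unrelated
  choices.\<close>

lemma word_trans_word_of:
  assumes "u \<in> cube_arrs" "word_arr w = u" "X \<in> Obj M"
  shows "word_trans (word_of u) X = word_trans w X"
  using assms by (intro word_trans_equiv word_arr_eq_imp_equiv) (simp_all add: word_arr_word_of)

lemma word_trans_replicate_Pass:
  "X \<in> Obj M \<Longrightarrow> word_trans (replicate n Pass) X = Ide M ((fo q ^^ n) X)"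
  by (induction n) auto

lemma word_dom_word_of: "u \<in> cube_arrs \<Longrightarrow> word_dom (word_of u) = fst u"
  and word_cod_word_of: "u \<in> cube_arrs \<Longrightarrow> word_cod (word_of u) = fst (snd u)"
  by (metis word_arr_word_of fst_word_arr, metis word_arr_word_of fst_snd_word_arr)

lemma extension_functor: "is_functor square (funcat M M) extension"
proof -
  have "fa extension u \<in> hom (funcat M M) (power (fst u)) (power (fst (snd u)))"
    if "u \<in> cube_arrs" for u
    using that word_trans_natural[of _ "word_of u"]
    by (auto simp: hom_def funcat_def extension_def power_ext_functor is_nat_trans_def
        word_dom_word_of word_cod_word_of)
  moreover have "fa extension (cube_ide n) = Ide (funcat M M) (power n)" for n
    by (auto simp: extension_def funcat_def fun_eq_iff cube_arrs.ide
        word_trans_word_of[OF _ word_arr_simps(1)] word_trans_replicate_Pass)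
  moreover have "fa extension (cube_comp v u) = Comp (funcat M M) (fa extension v) (fa extension u)"
    if "u \<in> cube_arrs" "v \<in> cube_arrs" "fst (snd u) = fst v" for u v
  proof -
    have "word_trans (word_of (cube_comp v u)) X = word_trans (word_of v) X \<cdot> word_trans (word_of u) X"
      if X: "X \<in> Obj M" for X
    proof -
      have [simp]: "word_cod (word_of u) = word_dom (word_of v)"
        using \<open>fst (snd u) = fst v\<close> \<open>u \<in> cube_arrs\<close> \<open>v \<in> cube_arrs\<close>
        by (simp add: word_dom_word_of word_cod_word_of)
      have "word_arr (word_comp (word_of v) (word_of u)) = cube_comp v u"
        using \<open>u \<in> cube_arrs\<close> \<open>v \<in> cube_arrs\<close> by (simp add: word_arr_comp word_arr_word_of)
      then show ?thesis
        using X cube_arrs.comp[OF \<open>u \<in> cube_arrs\<close> \<open>v \<in> cube_arrs\<close> \<open>fst (snd u) = fst v\<close>]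
        by (simp add: word_trans_word_of word_trans_comp)
    qed
    then show ?thesis
      by (auto simp: extension_def funcat_def component_def fun_eq_iff)
  qed
  moreover have "fo extension n = power n" "power n \<in> Obj (funcat M M)" for n
    by (simp_all add: extension_def funcat_def power_ext_functor)
  ultimately show ?thesis
    unfolding is_functor_def by (simp del: split_paired_All) (metis square_homD(1,2,3))
qed

lemma extension_tensor:
  assumes "u \<in> cube_arrs" "v \<in> cube_arrs"
  shows "fa extension (cube_tensor u v) = horizontal_comp M (fa extension u) (fa extension v)"
proof -
  have "word_trans (word_of (cube_tensor u v)) X
      = word_trans (word_of u) ((fo q ^^ fst (snd v)) X) \<cdot> (fa q ^^ fst u) (word_trans (word_of v) X)"
    if X: "X \<in> Obj M" for X
  proof -
    have "word_arr (word_of u @ word_of v) = cube_tensor u v"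
      using assms by (simp add: word_arr_append word_arr_word_of)
    then show ?thesis
      using X cube_arrs.tensor[OF assms] assms
      by (simp add: word_trans_word_of word_trans_append word_dom_word_of word_cod_word_of)
  qed
  then show ?thesis
    using assms
    by (auto simp: extension_def horizontal_comp_def power_add fun_eq_iff
        word_dom_word_of word_cod_word_of)
qed

lemma extension_strict_monoidal: "strict_monoidal M extension"
  using extension_functor extension_tensor power_add
  by (auto simp: strict_monoidal_def extension_def power_def id_functor_def)

end

text \<open>\<open>Pass\<close> contributes two to the sum of source and target, the other letters
  one. With both at most one there are at most two letters, and the two orders of
  \<open>Drop\<close> and \<open>Face\<close> give the same arrow.\<close>

lemma square_le1_arr_cases:
  assumes "u \<in> cube_arrs" "fst u \<le> 1" "fst (snd u) \<le> 1"
  shows "u = cube_ide 0 \<or> u = cube_ide 1 \<or> u = sigma \<or> (\<exists>i. u = delta i \<or> u = cube_comp (delta i) sigma)"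
proof -
  obtain w where w: "u = word_arr w" using word_arr_surj assms(1) by metis
  have dc: "word_dom w \<le> 1" "word_cod w \<le> 1" using assms w by auto
  have swap: "word_arr [Face b, Drop] = cube_comp (delta b) sigma" for b
    using word_arr_comp[of "[Drop]" "[Face b]"] by (simp add: word_arr_simps)
  then have swap': "word_arr [Drop, Face b] = cube_comp (delta b) sigma" for b
    by (simp add: word_arr_def fun_eq_iff)
  have short: "word_dom v + word_cod v = 0 \<Longrightarrow> v = []" for v
    by (cases v rule: word_dom.cases) auto
  have one: "(word_dom v = 0 \<longrightarrow> word_cod v \<le> 1 \<longrightarrow> v = [] \<or> (\<exists>b. v = [Face b])) \<and>
     (word_dom v \<le> 1 \<longrightarrow> word_cod v = 0 \<longrightarrow> v = [] \<or> v = [Drop])" for v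
    using short by (cases v rule: word_dom.cases) auto
  have "w \<in> {[], [Pass], [Drop]} \<union> (\<Union>b. {[Face b], [Drop, Face b], [Face b, Drop]})"
    using dc short one by (cases w rule: word_dom.cases) auto
  moreover have "word_arr [] = cube_ide 0" "word_arr [Pass] = cube_ide 1"
    using word_arr_simps(1)[of 0] word_arr_simps(1)[of 1] by simp_all
  ultimately show ?thesis
    by (auto simp: w swap swap' word_arr_simps)
qed

lemma funcat_arrD:
  assumes "t \<in> hom (funcat C D) F G"
  shows "F \<in> ext_functors C D" "G \<in> ext_functors C D" "is_nat_trans C D F G (component t)"
    "component t \<in> extensional (Obj C)" "t = (F, G, component t)"
proof -
  have [simp]: "component (F, G, t) = t" for t by (simp add: component_def fun_eq_iff)
  show "F \<in> ext_functors C D" "G \<in> ext_functors C D" "is_nat_trans C D F G (component t)"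
    "component t \<in> extensional (Obj C)" "t = (F, G, component t)"
    using assms by (auto simp: hom_def funcat_def)
qed

text \<open>It gives access to the properties of the chosen \<open>cylinder_ext\<close>. By
  \<open>square_le1_arr_cases\<close>, agreement with \<open>Q\<close> comes down to identities,
  \<open>sigma\<close>, \<open>delta\<close> and the composites of the latter two.\<close>

lemma strict_monoidal_extension_exists:
  assumes "category M" and "natural_cylinder M Q"
  shows "\<exists>E. strict_monoidal M E \<and> extends_cylinder Q E"
proof -
  interpret category M by fact
  have Q: "is_functor square_le1 (funcat M M) Q" and Q0: "fo Q 0 = id_functor M"
    using assms(2) by (auto simp: natural_cylinder_def)
  have le1: "Obj square_le1 = {0, 1}" "hom square_le1 m n = (if m \<le> 1 \<and> n \<le> 1 then hom square m n else {})"
    "Ide square_le1 = cube_ide" "Comp square_le1 = cube_comp" "Dom square_le1 = fst"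
    for m n
    by (auto simp: square_le1_def full_subcat_def square_def hom_def)
  have hom: "fa Q u \<in> hom (funcat M M) (fo Q m) (fo Q n)"
    if "u \<in> hom square m n" "m \<le> 1" "n \<le> 1" for u m n
  proof -
    have "u \<in> Arr square_le1" "Dom square_le1 u = m" "Cod square_le1 u = n"
      using that by (auto simp: square_le1_def full_subcat_def hom_def)
    then show ?thesis using Q unfolding is_functor_def by blast
  qed
  have ide: "fa Q (cube_ide n) = Ide (funcat M M) (fo Q n)" if "n \<le> 1" for n
  proof -
    have "n \<in> Obj square_le1" using that le1 by auto
    then show ?thesis using Q le1 unfolding is_functor_def by metis
  qed
  have comp: "fa Q (cube_comp v u) = Comp (funcat M M) (fa Q v) (fa Q u)"
    if "u \<in> hom square l m" "v \<in> hom square m n" "l \<le> 1" "m \<le> 1" "n \<le> 1" for u v l m n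
  proof -
    have "u \<in> hom square_le1 l m" "v \<in> hom square_le1 m n" using that le1(2) by auto
    then show ?thesis using Q le1(4) unfolding is_functor_def by metis
  qed
  define q where "q = fo Q 1"
  define d where "d b X = component (fa Q (delta b)) X" for b X
  define s where "s X = component (fa Q sigma) X" for X
  have dQ: "fa Q (delta b) \<in> hom (funcat M M) (id_functor M) q" for b
    using hom[OF delta_hom] Q0 by (simp add: q_def)
  have sQ: "fa Q sigma \<in> hom (funcat M M) q (id_functor M)"
    using hom[OF sigma_hom] Q0 by (simp add: q_def)
  have sd: "cube_comp sigma (delta b) = cube_ide 0" for b
    by (auto simp: cube_comp_def sigma_def delta_def cube_ide_def compose_def cube_def fun_eq_iff)
  interpret interval_functor M q d s
  proof
    show "is_functor M M q"
      using funcat_arrD(1)[OF sQ] by (simp add: ext_functors_def)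
    show "d b X \<in> hom M X (fo q X)" if "X \<in> Obj M" for b X
      using funcat_arrD(3)[OF dQ[of b]] that by (auto simp: is_nat_trans_def id_functor_def d_def)
    show "s X \<in> hom M (fo q X) X" if "X \<in> Obj M" for X
      using funcat_arrD(3)[OF sQ] that by (auto simp: is_nat_trans_def id_functor_def s_def)
    show "Comp M (d b (Cod M f)) f = Comp M (fa q f) (d b (Dom M f))" if "f \<in> Arr M" for b f
      using funcat_arrD(3)[OF dQ[of b]] that by (auto simp: is_nat_trans_def id_functor_def d_def)
    show "Comp M (s (Cod M f)) (fa q f) = Comp M f (s (Dom M f))" if "f \<in> Arr M" for f
      using funcat_arrD(3)[OF sQ] that by (auto simp: is_nat_trans_def id_functor_def s_def)
    show "Comp M (s X) (d b X) = Ide M X" if "X \<in> Obj M" for b X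
    proof -
      have "Comp (funcat M M) (fa Q sigma) (fa Q (delta b)) = Ide (funcat M M) (id_functor M)"
        using comp[OF delta_hom sigma_hom, of b] ide[of 0] Q0 sd by simp
      then have "component (Comp (funcat M M) (fa Q sigma) (fa Q (delta b))) X
          = component (Ide (funcat M M) (id_functor M)) X" by simp
      then show ?thesis
        using that by (simp add: funcat_def component_def d_def s_def id_functor_def)
    qed
  qed
  have fo_eq: "power 0 = fo Q 0" "power 1 = fo Q 1"
  proof -
    show "power 0 = fo Q 0" by (simp add: Q0 power_def id_functor_def)
    \<comment> \<open>\<open>power\<close> restricts to \<open>Obj M\<close> and
      \<open>Arr M\<close>, so equality with \<open>q\<close> itself rests on \<open>q\<close> being
      extensional.\<close>
    have "fo q \<in> extensional (Obj M)" "fa q \<in> extensional (Arr M)"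
      using funcat_arrD(1)[OF sQ] by (auto simp: ext_functors_def)
    then have "power 1 = q" by (simp add: power_def extensional_restrict)
    then show "power 1 = fo Q 1" by (simp only: q_def)
  qed
  have power_id: "power 0 = id_functor M" "power (Suc 0) = q"
    using fo_eq by (simp_all add: Q0 q_def)
  have fa_ide: "fa extension (cube_ide n) = fa Q (cube_ide n)" if "n \<le> 1" for n
  proof -
    have "fo extension n = fo Q n"
      using that fo_eq by (cases n) (auto simp: extension_def)
    then show ?thesis
      using is_functor_simps(5)[OF extension_functor, of n] ide[OF that] by simp
  qed
  have fa_delta: "fa extension (delta b) = fa Q (delta b)" for b
  proof -
    have "(\<lambda>X \<in> Obj M. word_trans (word_of (delta b)) X) = component (fa Q (delta b))"
      using funcat_arrD(4)[OF dQ[of b]]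
      by (auto simp: fun_eq_iff word_trans_word_of[OF _ word_arr_simps(2)] cube_arrs.delta
          extensional_def simp flip: d_def)
    then show ?thesis
      using funcat_arrD(5)[OF dQ[of b]] power_id square_homD(2,3)[OF delta_hom[of b]]
      by (simp add: extension_def)
  qed
  have fa_sigma: "fa extension sigma = fa Q sigma"
  proof -
    have "(\<lambda>X \<in> Obj M. word_trans (word_of sigma) X) = component (fa Q sigma)"
      using funcat_arrD(4)[OF sQ]
      by (auto simp: fun_eq_iff word_trans_word_of[OF _ word_arr_simps(3)] cube_arrs.sigma
          extensional_def simp flip: s_def)
    then show ?thesis
      using funcat_arrD(5)[OF sQ] power_id square_homD(2,3)[OF sigma_hom]
      by (simp add: extension_def)
  qed
  have "fa extension (cube_comp (delta b) sigma) = fa Q (cube_comp (delta b) sigma)" for b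
    using comp[OF sigma_hom delta_hom, of b] is_functor_simps(6)[OF extension_functor, of sigma "delta b"]
      square_homD[OF sigma_hom] square_homD[OF delta_hom[of b]]
    by (simp add: fa_delta fa_sigma)
  then have "fa extension u = fa Q u" if "u \<in> Arr square_le1" for u
    using that square_le1_arr_cases[of u] fa_ide fa_delta fa_sigma
    by (auto simp: square_le1_def full_subcat_def)
  then have "extends_cylinder Q extension"
    using fo_eq by (auto simp: extends_cylinder_def le1 extension_def)
  then show ?thesis using extension_strict_monoidal by blast
qed

section \<open>Coproducts and pushouts\<close>

text \<open>In \<open>bipartite_shape V E src tgt\<close> no two arrows in \<open>E\<close> are composable, so one of the arguments
  of \<open>Comp\<close> is always an identity.\<close>

definition bipartite_shape ::
    "nat set \<Rightarrow> nat set \<Rightarrow> (nat \<Rightarrow> nat) \<Rightarrow> (nat \<Rightarrow> nat) \<Rightarrow> (nat, nat) cat" where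
  "bipartite_shape V E src tgt =
     \<lparr>Obj = V, Arr = V \<union> E, Dom = \<lambda>f. if f \<in> V then f else src f,
      Cod = \<lambda>f. if f \<in> V then f else tgt f, Ide = \<lambda>a. a,
      Comp = \<lambda>g f. if f \<in> V then g else f\<rparr>"

definition bipartite :: "nat set \<Rightarrow> nat set \<Rightarrow> (nat \<Rightarrow> nat) \<Rightarrow> (nat \<Rightarrow> nat) \<Rightarrow> bool" where
  "bipartite V E src tgt \<longleftrightarrow> finite V \<and> finite E \<and> V \<inter> E = {} \<and> src ` E \<subseteq> V \<and> tgt ` E \<subseteq> V \<and>
     src ` E \<inter> tgt ` E = {}"

lemma finite_shape_bipartite:
  assumes "bipartite V E src tgt"
  shows "finite_shape (bipartite_shape V E src tgt)"
proof -
  have "category (bipartite_shape V E src tgt)"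
    using assms by unfold_locales (auto simp: bipartite_shape_def bipartite_def hom_def split: if_splits)
  then show ?thesis
    using assms by (auto simp: finite_shape_def bipartite_shape_def bipartite_def)
qed

definition bipartite_diagram ::
    "('o, 'm, 'z) cat_scheme \<Rightarrow> nat set \<Rightarrow> (nat \<Rightarrow> 'o) \<Rightarrow> (nat \<Rightarrow> 'm) \<Rightarrow> (nat, nat, 'o, 'm) func" where
  "bipartite_diagram C V F G = \<lparr>fo = F, fa = \<lambda>u. if u \<in> V then Ide C (F u) else G u\<rparr>"

context category
begin

lemma bipartite_diagram_functor:
  assumes "bipartite V E src tgt" "\<And>v. v \<in> V \<Longrightarrow> F v \<in> Obj C"
    "\<And>e. e \<in> E \<Longrightarrow> G e \<in> hom C (F (src e)) (F (tgt e))"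
  shows "is_functor (bipartite_shape V E src tgt) C (bipartite_diagram C V F G)"
  using assms
  by (auto simp: is_functor_def bipartite_shape_def bipartite_def bipartite_diagram_def
      hom_def[of "bipartite_shape _ _ _ _"] hom_def split: if_splits)

lemma bipartite_cocone_iff:
  assumes "bipartite V E src tgt" "is_functor (bipartite_shape V E src tgt) C D"
  shows "is_cocone C (bipartite_shape V E src tgt) D L i \<longleftrightarrow>
    L \<in> Obj C \<and> (\<forall>v \<in> V. i v \<in> hom C (fo D v) L) \<and> (\<forall>e \<in> E. i (tgt e) \<cdot> fa D e = i (src e))"
proof -
  have "fa D v = Ide C (fo D v)" if "v \<in> V" for v
    using assms(2) that by (auto simp: is_functor_def bipartite_shape_def)
  then show ?thesis
    using assms(1) by (auto simp: is_cocone_def bipartite_shape_def bipartite_def hom_def)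
qed

end

abbreviation "coproduct_shape \<equiv> bipartite_shape {0, 1} {} (\<lambda>_. 0) (\<lambda>_. 0)"
text \<open>The apex is 0, and subtracting 2 makes 3 the leg from 0 to 1 and 4 the leg from 0 to
  2.\<close>

abbreviation "pushout_shape \<equiv> bipartite_shape {0, 1, 2} {3, 4} (\<lambda>_. 0) (\<lambda>e. e - 2)"

lemma bipartite_shapes:
  "bipartite {0, 1} {} (\<lambda>_. 0) (\<lambda>_. 0)" "bipartite {0, 1, 2} {3, 4} (\<lambda>_. 0) (\<lambda>e. e - 2)"
  by (auto simp: bipartite_def)

context category
begin

lemma coproduct_iff_colimit:
  assumes "is_functor coproduct_shape C D"
  shows "is_colimit C coproduct_shape D L i \<longleftrightarrow>
    is_coproduct C (fo D 0) (fo D 1) (i 0) (i 1) \<and> Cod C (i 0) = L"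
proof
  assume L: "is_colimit C coproduct_shape D L i"
  then have i: "i 0 \<in> hom C (fo D 0) L" "i 1 \<in> hom C (fo D 1) L"
    unfolding is_colimit_def bipartite_cocone_iff[OF bipartite_shapes(1) assms] by auto
  have "\<exists>!h. copairing C (i 0) (i 1) a b h"
    if ab: "a \<in> hom C (fo D 0) Z" "b \<in> hom C (fo D 1) Z" for Z a b
  proof -
    have "is_cocone C coproduct_shape D Z (\<lambda>j. if j = 0 then a else b)"
      unfolding bipartite_cocone_iff[OF bipartite_shapes(1) assms]
      using ab by (auto simp: hom_def cod_obj)
    then have "\<exists>!h. h \<in> hom C L Z \<and>
        (\<forall>j \<in> Obj coproduct_shape. h \<cdot> i j = (if j = 0 then a else b))"
      using L by (simp add: is_colimit_def)
    then show ?thesis using i ab by (simp add: copairing_def hom_def bipartite_shape_def)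
  qed
  then show "is_coproduct C (fo D 0) (fo D 1) (i 0) (i 1) \<and> Cod C (i 0) = L"
    using i by (simp add: is_coproduct_def hom_def)
next
  assume L: "is_coproduct C (fo D 0) (fo D 1) (i 0) (i 1) \<and> Cod C (i 0) = L"
  then have i: "i 0 \<in> hom C (fo D 0) L" "i 1 \<in> hom C (fo D 1) L"
    by (auto simp: is_coproduct_def hom_def)
  have "\<exists>!h. h \<in> hom C L Z \<and> (\<forall>j \<in> Obj coproduct_shape. h \<cdot> i j = i' j)"
    if "is_cocone C coproduct_shape D Z i'" for Z i'
  proof -
    have i': "i' 0 \<in> hom C (fo D 0) Z" "i' 1 \<in> hom C (fo D 1) Z"
      using that unfolding bipartite_cocone_iff[OF bipartite_shapes(1) assms] by auto
    then have "\<exists>!h. copairing C (i 0) (i 1) (i' 0) (i' 1) h"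
      using L unfolding is_coproduct_def by blast
    then show ?thesis using i i' by (simp add: copairing_def hom_def bipartite_shape_def)
  qed
  then show "is_colimit C coproduct_shape D L i"
    unfolding is_colimit_def bipartite_cocone_iff[OF bipartite_shapes(1) assms]
    using i by (auto simp: hom_def cod_obj)
qed

text \<open>Preservation of colimits is a hypothesis about diagrams, while the relative cylinders
  use bare pushout squares; this translates. A cocone also has a component at the apex, forced by
  the leg 3, whence the equation for \<open>i 0\<close>.\<close>

lemma pushout_iff_colimit:
  assumes D: "is_functor pushout_shape C D"
  shows "is_colimit C pushout_shape D L i \<longleftrightarrow>
    is_pushout C (fa D 3) (fa D 4) (i 1) (i 2) \<and> Cod C (i 1) = L \<and> i 0 = i 1 \<cdot> fa D 3"
proof -
  have fg: "fa D 3 \<in> hom C (fo D 0) (fo D 1)" "fa D 4 \<in> hom C (fo D 0) (fo D 2)"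
    using D by (auto simp: is_functor_def bipartite_shape_def)
  note cocone_iff = bipartite_cocone_iff[OF bipartite_shapes(2) D]
  show ?thesis
  proof
    assume L: "is_colimit C pushout_shape D L i"
    then have i: "i 0 \<in> hom C (fo D 0) L" "i 1 \<in> hom C (fo D 1) L" "i 2 \<in> hom C (fo D 2) L"
      "i 1 \<cdot> fa D 3 = i 0" "i 2 \<cdot> fa D 4 = i 0"
      unfolding is_colimit_def cocone_iff by auto
    have "\<exists>!h. copairing C (i 1) (i 2) a b h"
      if ab: "a \<in> hom C (fo D 1) Z" "b \<in> hom C (fo D 2) Z" "a \<cdot> fa D 3 = b \<cdot> fa D 4" for Z a b
    proof -
      define i' where "i' j = (if j = 0 then a \<cdot> fa D 3 else if j = 1 then a else b)" for j :: nat
      have "is_cocone C pushout_shape D Z i'"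
        unfolding cocone_iff using ab fg by (auto simp: hom_def cod_obj i'_def)
      then have "\<exists>!h. h \<in> hom C L Z \<and> (\<forall>j \<in> Obj pushout_shape. h \<cdot> i j = i' j)"
        using L by (simp add: is_colimit_def)
      moreover have "h \<cdot> i 0 = i' 0" if "h \<in> hom C L Z" "h \<cdot> i 1 = a" for h
        using comp_assoc[OF fg(1) i(2) that(1)] that(2) i(4) by (simp add: i'_def)
      ultimately have "\<exists>!h. h \<in> hom C L Z \<and> h \<cdot> i 1 = a \<and> h \<cdot> i 2 = b"
        by (auto simp: bipartite_shape_def i'_def)
      then show ?thesis using i ab by (simp add: copairing_def hom_def)
    qed
    then show "is_pushout C (fa D 3) (fa D 4) (i 1) (i 2) \<and> Cod C (i 1) = L \<and> i 0 = i 1 \<cdot> fa D 3"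
      using i fg by (simp add: is_pushout_def hom_def)
  next
    assume L: "is_pushout C (fa D 3) (fa D 4) (i 1) (i 2) \<and> Cod C (i 1) = L \<and> i 0 = i 1 \<cdot> fa D 3"
    then have i: "i 0 \<in> hom C (fo D 0) L" "i 1 \<in> hom C (fo D 1) L" "i 2 \<in> hom C (fo D 2) L"
      "i 1 \<cdot> fa D 3 = i 0" "i 2 \<cdot> fa D 4 = i 0"
      using fg by (auto simp: is_pushout_def hom_def)
    have "\<exists>!h. h \<in> hom C L Z \<and> (\<forall>j \<in> Obj pushout_shape. h \<cdot> i j = i' j)"
      if "is_cocone C pushout_shape D Z i'" for Z i'
    proof -
      have i': "i' 1 \<in> hom C (fo D 1) Z" "i' 2 \<in> hom C (fo D 2) Z"
        "i' 1 \<cdot> fa D 3 = i' 0" "i' 2 \<cdot> fa D 4 = i' 0"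
        using that unfolding cocone_iff by auto
      then have "\<exists>!h. copairing C (i 1) (i 2) (i' 1) (i' 2) h"
        using L fg unfolding is_pushout_def hom_def by auto
      moreover have "h \<cdot> i 0 = i' 0" if "h \<in> hom C L Z" "h \<cdot> i 1 = i' 1" for h
        using comp_assoc[OF fg(1) i(2) that(1)] that(2) i(4) i'(3) by simp
      ultimately show ?thesis using i i'
        by (auto simp: copairing_def hom_def bipartite_shape_def)
    qed
    then show "is_colimit C pushout_shape D L i"
      unfolding is_colimit_def cocone_iff using i by (auto simp: hom_def cod_obj)
  qed
qed

lemma coproduct_exists:
  assumes "has_finite_colimits C" "X \<in> Obj C" "Y \<in> Obj C"
  shows "\<exists>p q. is_coproduct C X Y p q"
proof -
  define D where "D = bipartite_diagram C {0, 1} (\<lambda>v. if v = 0 then X else Y) (\<lambda>_. undefined)"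
  have D: "is_functor coproduct_shape C D"
    unfolding D_def using assms by (intro bipartite_diagram_functor bipartite_shapes) auto
  then obtain L i where "is_colimit C coproduct_shape D L i"
    using assms(1) finite_shape_bipartite[OF bipartite_shapes(1)] unfolding has_finite_colimits_def
    by blast
  then show ?thesis
    unfolding coproduct_iff_colimit[OF D] by (auto simp: D_def bipartite_diagram_def)
qed

lemma pushout_diagram:
  assumes "f \<in> Arr C" "g \<in> Arr C" "Dom C f = Dom C g"
  obtains D where "is_functor pushout_shape C D" "fa D 3 = f" "fa D 4 = g"
proof
  let ?D = "bipartite_diagram C {0, 1, 2}
    (\<lambda>v. if v = 0 then Dom C f else if v = 1 then Cod C f else Cod C g) (\<lambda>e. if e = 3 then f else g)"
  show "is_functor pushout_shape C ?D"
    using assms by (intro bipartite_diagram_functor bipartite_shapes) (auto simp: hom_def dom_obj cod_obj)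
  show "fa ?D 3 = f" "fa ?D 4 = g" by (simp_all add: bipartite_diagram_def)
qed

lemma pushout_exists:
  assumes "has_finite_colimits C" "f \<in> Arr C" "g \<in> Arr C" "Dom C f = Dom C g"
  shows "\<exists>p q. is_pushout C f g p q"
proof -
  obtain D where D: "is_functor pushout_shape C D" "fa D 3 = f" "fa D 4 = g"
    using pushout_diagram[OF assms(2-4)] .
  then obtain L i where "is_colimit C pushout_shape D L i"
    using assms(1) finite_shape_bipartite[OF bipartite_shapes(2)] unfolding has_finite_colimits_def
    by blast
  then show ?thesis
    unfolding pushout_iff_colimit[OF D(1)] using D by auto
qed

lemma functor_compose:
  assumes "is_functor J C D" "is_functor C C F"
  shows "is_functor J C \<lparr>fo = \<lambda>j. fo F (fo D j), fa = \<lambda>u. fa F (fa D u)\<rparr>"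
  using assms unfolding is_functor_def hom_def by simp

lemma preserves_coproduct:
  assumes "preserves_finite_colimits C C F" "is_functor C C F" "is_coproduct C X Y p q"
  shows "is_coproduct C (fo F X) (fo F Y) (fa F p) (fa F q)"
proof -
  define D where "D = bipartite_diagram C {0, 1} (\<lambda>v. if v = 0 then X else Y) (\<lambda>_. undefined)"
  have "X \<in> Obj C" "Y \<in> Obj C" using assms(3) by (auto simp: is_coproduct_def dom_obj)
  then have D: "is_functor coproduct_shape C D"
    unfolding D_def using assms by (intro bipartite_diagram_functor bipartite_shapes) auto
  have "is_colimit C coproduct_shape D (Cod C p) (\<lambda>j. if j = 0 then p else q)"
    unfolding coproduct_iff_colimit[OF D] using assms(3) by (simp add: D_def bipartite_diagram_def)
  then have "is_colimit C coproduct_shape \<lparr>fo = \<lambda>j. fo F (fo D j), fa = \<lambda>u. fa F (fa D u)\<rparr>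
      (fo F (Cod C p)) (\<lambda>j. fa F (if j = 0 then p else q))"
    using assms(1) D finite_shape_bipartite[OF bipartite_shapes(1)]
    unfolding preserves_finite_colimits_def by blast
  then show ?thesis
    unfolding coproduct_iff_colimit[OF functor_compose[OF D assms(2)]]
    by (simp add: D_def bipartite_diagram_def)
qed

lemma preserves_pushout:
  assumes "preserves_finite_colimits C C F" "is_functor C C F" "is_pushout C f g p q"
  shows "is_pushout C (fa F f) (fa F g) (fa F p) (fa F q)"
proof -
  have "f \<in> Arr C" "g \<in> Arr C" "Dom C f = Dom C g" using assms(3) by (auto simp: is_pushout_def)
  then obtain D where D: "is_functor pushout_shape C D" "fa D 3 = f" "fa D 4 = g"
    by (rule pushout_diagram)
  let ?i = "\<lambda>j :: nat. if j = 0 then p \<cdot> f else if j = 1 then p else q"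
  have "is_colimit C pushout_shape D (Cod C p) ?i"
    unfolding pushout_iff_colimit[OF D(1)] using assms(3) D by simp
  then have "is_colimit C pushout_shape \<lparr>fo = \<lambda>j. fo F (fo D j), fa = \<lambda>u. fa F (fa D u)\<rparr>
      (fo F (Cod C p)) (\<lambda>j. fa F (?i j))"
    using assms(1) D(1) finite_shape_bipartite[OF bipartite_shapes(2)]
    unfolding preserves_finite_colimits_def by blast
  then show ?thesis
    unfolding pushout_iff_colimit[OF functor_compose[OF D(1) assms(2)]] using D by simp
qed

section \<open>Pushouts and coproducts as glueings along a set of ends\<close>

lemma coproduct_arr:
  assumes "is_coproduct C X Y p q"
  shows "p \<in> Arr C" "q \<in> Arr C" "Dom C p = X" "Dom C q = Y" "Cod C q = Cod C p"
  using assms by (simp_all add: is_coproduct_def)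

lemma pushout_arr:
  assumes "is_pushout C f g p q"
  shows "f \<in> Arr C" "g \<in> Arr C" "Dom C g = Dom C f" "p \<in> Arr C" "q \<in> Arr C"
    "Dom C p = Cod C f" "Dom C q = Cod C g" "Cod C q = Cod C p" "p \<cdot> f = q \<cdot> g"
  using assms by (simp_all add: is_pushout_def)

text \<open>For \<open>T = {i}\<close> this says that \<open>p, e i\<close> are a pushout of \<open>c i, f\<close>; for \<open>T = UNIV\<close> it is the
  pushout of \<open>X \<squnion> X \<rightarrow> Z\<close> and \<open>f \<squnion> f\<close>, with \<open>Y \<squnion> Y\<close> unfolded into two arrows.\<close>

definition is_glueing :: "bool set \<Rightarrow> (bool \<Rightarrow> 'm) \<Rightarrow> 'm \<Rightarrow> 'm \<Rightarrow> (bool \<Rightarrow> 'm) \<Rightarrow> bool" where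
  "is_glueing T c f p e \<longleftrightarrow> f \<in> Arr C \<and> p \<in> Arr C \<and>
     (\<forall>i \<in> T. c i \<in> hom C (Dom C f) (Dom C p) \<and> e i \<in> hom C (Cod C f) (Cod C p) \<and>
        p \<cdot> c i = e i \<cdot> f) \<and>
     (\<forall>Z \<phi> a. \<phi> \<in> hom C (Dom C p) Z \<longrightarrow> (\<forall>i \<in> T. a i \<in> hom C (Cod C f) Z \<and> \<phi> \<cdot> c i = a i \<cdot> f) \<longrightarrow>
        (\<exists>!h. h \<in> hom C (Cod C p) Z \<and> h \<cdot> p = \<phi> \<and> (\<forall>i \<in> T. h \<cdot> e i = a i)))"

lemma glueing_arr:
  assumes "is_glueing T c f p e"
  shows "f \<in> Arr C" "p \<in> Arr C" "i \<in> T \<Longrightarrow> c i \<in> hom C (Dom C f) (Dom C p)"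
    "i \<in> T \<Longrightarrow> e i \<in> hom C (Cod C f) (Cod C p)" "i \<in> T \<Longrightarrow> p \<cdot> c i = e i \<cdot> f"
  using assms by (auto simp: is_glueing_def)

lemma glueing_univ:
  assumes "is_glueing T c f p e" "\<phi> \<in> hom C (Dom C p) Z"
    "\<And>i. i \<in> T \<Longrightarrow> a i \<in> hom C (Cod C f) Z \<and> \<phi> \<cdot> c i = a i \<cdot> f"
  shows "\<exists>!h. h \<in> hom C (Cod C p) Z \<and> h \<cdot> p = \<phi> \<and> (\<forall>i \<in> T. h \<cdot> e i = a i)"
proof -
  have "\<forall>Z \<phi> a. \<phi> \<in> hom C (Dom C p) Z \<longrightarrow> (\<forall>i \<in> T. a i \<in> hom C (Cod C f) Z \<and> \<phi> \<cdot> c i = a i \<cdot> f) \<longrightarrow>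
      (\<exists>!h. h \<in> hom C (Cod C p) Z \<and> h \<cdot> p = \<phi> \<and> (\<forall>i \<in> T. h \<cdot> e i = a i))"
    using assms(1) unfolding is_glueing_def by (elim conjE)
  from this[THEN spec, THEN spec, THEN spec, of \<phi> Z a] show ?thesis
    using assms(2,3) by simp
qed

lemma glueing_ex:
  assumes "is_glueing T c f p e" "\<phi> \<in> hom C (Dom C p) Z"
    "\<And>i. i \<in> T \<Longrightarrow> a i \<in> hom C (Cod C f) Z" "\<And>i. i \<in> T \<Longrightarrow> \<phi> \<cdot> c i = a i \<cdot> f"
  obtains h where "h \<in> hom C (Cod C p) Z" "h \<cdot> p = \<phi>" "\<And>i. i \<in> T \<Longrightarrow> h \<cdot> e i = a i"
  using glueing_univ[of T c f p e \<phi> Z a] assms by blast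

lemma glueing_unique:
  assumes glue: "is_glueing T c f p e" and h: "h \<in> hom C (Cod C p) Z" "h' \<in> hom C (Cod C p) Z"
    and eq: "h \<cdot> p = h' \<cdot> p" "\<And>i. i \<in> T \<Longrightarrow> h \<cdot> e i = h' \<cdot> e i"
  shows "h = h'"
proof -
  have "h' \<cdot> p \<in> hom C (Dom C p) Z"
    using glueing_arr(2)[OF glue] h by (simp add: hom_def)
  moreover have "h' \<cdot> e i \<in> hom C (Cod C f) Z \<and> (h' \<cdot> p) \<cdot> c i = (h' \<cdot> e i) \<cdot> f" if "i \<in> T" for i
    using glueing_arr[OF glue] that h by (simp add: hom_def)
  ultimately have "\<exists>!k. k \<in> hom C (Cod C p) Z \<and> k \<cdot> p = h' \<cdot> p \<and> (\<forall>i \<in> T. k \<cdot> e i = h' \<cdot> e i)"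
    using glueing_univ[OF glue] by presburger
  then show ?thesis using h eq by blast
qed

lemma glueing_of_pushout:
  assumes "is_pushout C (c i) f p (e i)"
  shows "is_glueing {i} c f p e"
  unfolding is_glueing_def
proof (intro conjI ballI allI impI)
  note arr = pushout_arr[OF assms]
  show "f \<in> Arr C" "p \<in> Arr C" using arr by blast+
  show "c j \<in> hom C (Dom C f) (Dom C p)" "e j \<in> hom C (Cod C f) (Cod C p)" "p \<cdot> c j = e j \<cdot> f"
    if "j \<in> {i}" for j
    using that arr by (simp_all add: hom_def)
  show "\<exists>!h. h \<in> hom C (Cod C p) Z \<and> h \<cdot> p = \<phi> \<and> (\<forall>j \<in> {i}. h \<cdot> e j = a j)"
    if "\<phi> \<in> hom C (Dom C p) Z" "\<forall>j \<in> {i}. a j \<in> hom C (Cod C f) Z \<and> \<phi> \<cdot> c j = a j \<cdot> f" for Z \<phi> a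
  proof -
    have "\<phi> \<in> hom C (Cod C (c i)) Z" "a i \<in> hom C (Cod C f) Z" "\<phi> \<cdot> c i = a i \<cdot> f"
      using that arr(6) by simp_all
    then have "\<exists>!h. copairing C p (e i) \<phi> (a i) h"
      using assms unfolding is_pushout_def by blast
    then show ?thesis using that(1) by (simp add: copairing_def hom_def)
  qed
qed

lemma coproduct_unique:
  assumes "is_coproduct C X Y p q" "h \<in> hom C (Cod C p) Z" "h' \<in> hom C (Cod C p) Z"
    "h \<cdot> p = h' \<cdot> p" "h \<cdot> q = h' \<cdot> q"
  shows "h = h'"
proof -
  have "h' \<cdot> p \<in> hom C X Z" "h' \<cdot> q \<in> hom C Y Z"
    using coproduct_arr[OF assms(1)] assms(3) by (simp_all add: hom_def)
  then have "\<exists>!k. copairing C p q (h' \<cdot> p) (h' \<cdot> q) k"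
    using assms(1) unfolding is_coproduct_def by blast
  moreover have "copairing C p q (h' \<cdot> p) (h' \<cdot> q) h" "copairing C p q (h' \<cdot> p) (h' \<cdot> q) h'"
    using coproduct_arr[OF assms(1)] assms(2-5) by (simp_all add: copairing_def hom_def)
  ultimately show ?thesis by blast
qed

text \<open>A map out of Y + Y is a pair of maps, so the universal property of the pushout turns
  into one with two separate arrows out of Y.\<close>

lemma glueing_of_coproduct_pushout:
  assumes i: "is_coproduct C (Dom C f) (Dom C f) i0 i1" and j: "is_coproduct C (Cod C f) (Cod C f) j0 j1"
    and s: "copairing C i0 i1 (j0 \<cdot> f) (j1 \<cdot> f) s" and k: "copairing C i0 i1 (c False) (c True) k"
    and c: "c False \<in> Arr C" "c True \<in> Arr C" "Cod C (c True) = Cod C (c False)"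
    and f: "f \<in> Arr C"
    and po: "is_pushout C k s p q"
  shows "is_glueing UNIV c f p (\<lambda>b. q \<cdot> (if b then j1 else j0))"
proof -
  note [simp] = f c
  have [simp]: "i0 \<in> Arr C" "i1 \<in> Arr C" "Dom C i0 = Dom C f" "Dom C i1 = Dom C f" "Cod C i1 = Cod C i0"
      "j0 \<in> Arr C" "j1 \<in> Arr C" "Dom C j0 = Cod C f" "Dom C j1 = Cod C f" "Cod C j1 = Cod C j0"
    using coproduct_arr[OF i] coproduct_arr[OF j] by simp_all
  have s'[simp]: "s \<in> Arr C" "Dom C s = Cod C i0" "Cod C s = Cod C j0" and
    k'[simp]: "k \<in> Arr C" "Dom C k = Cod C i0" "Cod C k = Cod C (c False)"
    using s k by (simp_all add: copairing_def hom_def)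
  have si: "s \<cdot> i0 = j0 \<cdot> f" "s \<cdot> i1 = j1 \<cdot> f" "k \<cdot> i0 = c False" "k \<cdot> i1 = c True"
    using s k by (simp_all add: copairing_def)
  have p'[simp]: "p \<in> Arr C" "q \<in> Arr C" "Dom C p = Cod C (c False)" "Dom C q = Cod C j0"
      "Cod C q = Cod C p" and pk: "p \<cdot> k = q \<cdot> s"
    using pushout_arr[OF po] by simp_all
  have c_hom: "c i \<in> hom C (Dom C f) (Cod C (c False))" for i
    using arg_cong[OF si(3), of "Dom C"] arg_cong[OF si(4), of "Dom C"] by (cases i) (simp_all add: hom_def)
  have pc: "p \<cdot> c i = (q \<cdot> (if i then j1 else j0)) \<cdot> f" for i
  proof -
    have "p \<cdot> k \<cdot> i0 = q \<cdot> s \<cdot> i0" "p \<cdot> k \<cdot> i1 = q \<cdot> s \<cdot> i1"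
      using comp_extend2[OF pk] by simp_all
    then show ?thesis by (cases i) (simp_all add: si)
  qed
  have univ: "\<exists>!h. h \<in> hom C (Cod C p) Z \<and> h \<cdot> p = \<phi> \<and> (\<forall>i. h \<cdot> q \<cdot> (if i then j1 else j0) = a i)"
    if \<phi>: "\<phi> \<in> hom C (Dom C p) Z" and a: "\<And>i. a i \<in> hom C (Cod C f) Z" "\<And>i. \<phi> \<cdot> c i = a i \<cdot> f"
    for Z \<phi> a
  proof -
    obtain a' where a': "copairing C j0 j1 (a False) (a True) a'"
      using j a(1) unfolding is_coproduct_def by blast
    have [simp]: "\<phi> \<in> Arr C" "Dom C \<phi> = Cod C (c False)" "Cod C \<phi> = Z" "a' \<in> Arr C"
        "Dom C a' = Cod C j0" "Cod C a' = Z" "\<And>i. a i \<in> Arr C" "\<And>i. Dom C (a i) = Cod C f"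
        "\<And>i. Cod C (a i) = Z"
      and a'j: "a' \<cdot> j0 = a False" "a' \<cdot> j1 = a True"
      using \<phi> a(1) a' by (auto simp: hom_def copairing_def)
    \<comment> \<open>Tested on the two summands of X + X, this is the pair of hypotheses on
      \<open>a False\<close> and \<open>a True\<close>.\<close>
    have "\<phi> \<cdot> k = a' \<cdot> s"
      by (rule coproduct_unique[OF i])
        (simp_all add: hom_def si a(2) comp_extend[OF a'j(1)] comp_extend[OF a'j(2)])
    then have "\<exists>!h. copairing C p q \<phi> a' h"
      using po unfolding is_pushout_def by (simp add: hom_def)
    moreover have "copairing C p q \<phi> a' h \<longleftrightarrow>
        h \<in> hom C (Cod C p) Z \<and> h \<cdot> p = \<phi> \<and> (\<forall>i. h \<cdot> q \<cdot> (if i then j1 else j0) = a i)" for h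
    proof
      assume h: "copairing C p q \<phi> a' h"
      then have hq: "h \<cdot> q = a'" and h' [simp]: "h \<in> Arr C" "Dom C h = Cod C p" "Cod C h = Z"
        and hp: "h \<cdot> p = \<phi>"
        by (simp_all add: copairing_def hom_def)
      have "h \<cdot> q \<cdot> j0 = a False" "h \<cdot> q \<cdot> j1 = a True"
        using comp_extend[OF hq, of j0] comp_extend[OF hq, of j1] a'j by simp_all
      then show "h \<in> hom C (Cod C p) Z \<and> h \<cdot> p = \<phi> \<and> (\<forall>i. h \<cdot> q \<cdot> (if i then j1 else j0) = a i)"
        using hp by (simp add: hom_def)
    next
      assume h: "h \<in> hom C (Cod C p) Z \<and> h \<cdot> p = \<phi> \<and> (\<forall>i. h \<cdot> q \<cdot> (if i then j1 else j0) = a i)"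
      then have h' [simp]: "h \<in> Arr C" "Dom C h = Cod C p" "Cod C h = Z" by (auto simp: hom_def)
      have "h \<cdot> q \<cdot> j0 = a False" "h \<cdot> q \<cdot> j1 = a True"
        using h[THEN conjunct2, THEN conjunct2, THEN spec, of False]
          h[THEN conjunct2, THEN conjunct2, THEN spec, of True] by simp_all
      then have "h \<cdot> q = a'"
        by - (rule coproduct_unique[OF j, of _ Z], simp_all add: hom_def a'j)
      then show "copairing C p q \<phi> a' h"
        using h[THEN conjunct1] h[THEN conjunct2, THEN conjunct1] unfolding copairing_def by simp
    qed
    ultimately show ?thesis by (simp only:)
  qed
  show ?thesis
    unfolding is_glueing_def
  proof (intro conjI ballI allI impI)
    fix Z \<phi> a
    assume "\<phi> \<in> hom C (Dom C p) Z" "\<forall>i \<in> UNIV. a i \<in> hom C (Cod C f) Z \<and> \<phi> \<cdot> c i = a i \<cdot> f"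
    then show "\<exists>!h. h \<in> hom C (Cod C p) Z \<and> h \<cdot> p = \<phi> \<and>
        (\<forall>i \<in> UNIV. h \<cdot> q \<cdot> (if i then j1 else j0) = a i)"
      using univ[of \<phi> Z a] by simp
  next
    show "c i \<in> hom C (Dom C f) (Dom C p)" for i using c_hom by simp
    show "q \<cdot> (if i then j1 else j0) \<in> hom C (Cod C f) (Cod C p)" for i
      by (cases i) (simp_all add: hom_def)
  qed (use pc in simp_all)
qed

end

section \<open>Cubical mapping sets\<close>

locale strict_monoidal_functor = category M for M :: "('o, 'm, 'z) cat_scheme" +
  fixes E :: "('o, 'm) cubical_functor"
  assumes strict: "strict_monoidal M E"
begin

abbreviation comp\<^sub>M (infixr "\<cdot>" 70) where "g \<cdot> f \<equiv> Comp M g f"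
abbreviation Qo where "Qo n X \<equiv> fo (fo E n) X"
abbreviation Qa where "Qa n f \<equiv> fa (fo E n) f"
abbreviation ev where "ev u X \<equiv> component (fa E u) X"

lemmas dom_cod_obj [simp] = dom_obj cod_obj

lemma E_functor: "is_functor square (funcat M M) E"
  using strict by (simp add: strict_monoidal_def)

lemma power_functor: "is_functor M M (fo E n)"
  using is_functor_simps(1)[OF E_functor, of n] by (simp add: funcat_def ext_functors_def)

lemmas power_simps [simp] = is_functor_simps[OF power_functor]

lemma zero_simps [simp]: "X \<in> Obj M \<Longrightarrow> Qo 0 X = X" "f \<in> Arr M \<Longrightarrow> Qa 0 f = f"
  using strict by (simp_all add: strict_monoidal_def id_functor_def)

lemma add_simps:
  "X \<in> Obj M \<Longrightarrow> Qo (m + n) X = Qo m (Qo n X)" "f \<in> Arr M \<Longrightarrow> Qa (m + n) f = Qa m (Qa n f)"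
  using strict by (simp_all add: strict_monoidal_def functor_comp_def compose_def)

lemma Suc_simps:
  "X \<in> Obj M \<Longrightarrow> Qo (Suc n) X = Qo n (Qo 1 X)" "f \<in> Arr M \<Longrightarrow> Qa (Suc n) f = Qa n (Qa 1 f)"
  using add_simps[of _ n 1] by simp_all

lemma E_hom: "u \<in> hom square m n \<Longrightarrow> fa E u \<in> hom (funcat M M) (fo E m) (fo E n)"
  using E_functor square_homD(1,2,3)[of u m n] by (auto simp: is_functor_def)

lemma ev_hom: "u \<in> hom square m n \<Longrightarrow> X \<in> Obj M \<Longrightarrow> ev u X \<in> hom M (Qo m X) (Qo n X)"
  using funcat_arrD(3)[OF E_hom] by (simp add: is_nat_trans_def)

lemma ev_simps [simp]:
  assumes "u \<in> hom square m n" "X \<in> Obj M"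
  shows "ev u X \<in> Arr M" "Dom M (ev u X) = Qo m X" "Cod M (ev u X) = Qo n X"
  using ev_hom[OF assms] by (simp_all add: hom_def)

lemma ev_natural:
  "u \<in> hom square m n \<Longrightarrow> f \<in> Arr M \<Longrightarrow> ev u (Cod M f) \<cdot> Qa m f = Qa n f \<cdot> ev u (Dom M f)"
  using funcat_arrD(3)[OF E_hom] by (simp add: is_nat_trans_def)

lemma ev_ide [simp]: "X \<in> Obj M \<Longrightarrow> ev (cube_ide n) X = Ide M (Qo n X)"
  using is_functor_simps(5)[OF E_functor, of n] by (simp add: funcat_def component_def)

lemma ev_comp:
  assumes "u \<in> hom square l m" "v \<in> hom square m n" "X \<in> Obj M"
  shows "ev (cube_comp v u) X = ev v X \<cdot> ev u X"
  using is_functor_simps(6)[OF E_functor, of u v] square_homD[OF assms(1)] square_homD[OF assms(2)] assms(3)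
  by (simp add: funcat_def component_def)

lemma ev_tensor:
  assumes u: "u \<in> hom square m n" and v: "v \<in> hom square m' n'" and X: "X \<in> Obj M"
  shows "ev (cube_tensor u v) X = ev u (Qo n' X) \<cdot> Qa m (ev v X)"
proof -
  have "fa E (cube_tensor u v) = horizontal_comp M (fa E u) (fa E v)"
    using strict square_homD(1)[OF u] square_homD(1)[OF v] by (simp add: strict_monoidal_def)
  also have "\<dots> = horizontal_comp M (fo E m, fo E n, component (fa E u)) (fo E m', fo E n', component (fa E v))"
    using funcat_arrD(5)[OF E_hom[OF u]] funcat_arrD(5)[OF E_hom[OF v]] by simp
  finally show ?thesis using X by (simp add: horizontal_comp_def component_def)
qed

text \<open>The face is an identity tensored with \<open>delta i\<close>, and the identity factor
  contributes an identity component. Here the last direction becomes visible inside Q_n;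
  \<open>ev_coface_Suc\<close> is the counterpart for the other directions.\<close>

lemma ev_coface_last:
  assumes "X \<in> Obj M"
  shows "ev (coface (Suc n) n i) X = Qa n (ev (delta i) X)"
  using assms ev_tensor[OF square.ide_hom[of n] delta_hom, of X i] ev_hom[OF delta_hom assms, of i]
  by (simp add: coface_last hom_def)

lemma ev_coface_Suc:
  assumes "X \<in> Obj M" "k < n"
  shows "ev (coface (Suc n) k i) X = ev (coface n k i) (Qo 1 X)"
  using assms ev_tensor[OF coface_hom[OF assms(2)] square.ide_hom[of 1], of X i]
    ev_hom[OF coface_hom[OF assms(2)], of "Qo 1 X" i]
  by (simp add: coface_Suc hom_def)

lemma cells_map_cset [simp]: "cells (map_cset M E X Y) n = hom M (Qo n X) Y"
  and act_map_cset [simp]: "act (map_cset M E X Y) u \<phi> = \<phi> \<cdot> ev u X"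
  by (simp_all add: map_cset_def)

lemma cubical_set_map_cset:
  assumes "X \<in> Obj M"
  shows "cubical_set (map_cset M E X Y)"
  unfolding cubical_set_def
proof (intro conjI allI impI)
  show "act (map_cset M E X Y) u x \<in> cells (map_cset M E X Y) m"
    if "u \<in> hom square m n" "x \<in> cells (map_cset M E X Y) n" for m n u x
    using comp_hom[OF ev_hom[OF that(1) assms]] that(2) by simp
  show "act (map_cset M E X Y) (Ide square n) x = x" if "x \<in> cells (map_cset M E X Y) n" for n x
    using that comp_ide assms by simp
  show "act (map_cset M E X Y) (Comp square v u) x
      = act (map_cset M E X Y) u (act (map_cset M E X Y) v x)"
    if "u \<in> hom square l m" "v \<in> hom square m n" "x \<in> cells (map_cset M E X Y) n" for l m n u v x
    using that comp_assoc[OF ev_hom[OF that(1) assms] ev_hom[OF that(2) assms]] assms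
    by (simp add: ev_comp)
qed

end

section \<open>Standard cubes, unions of faces, fibre products\<close>

lemma cubical_set_std_cube: "cubical_set (std_cube n)"
  unfolding cubical_set_def std_cube_def
  by (auto simp del: Comp_square Ide_square intro: square.comp_hom square.comp_ide square.comp_assoc)

lemma cubical_set_coface_union:
  assumes "\<And>k i. (k, i) \<in> F \<Longrightarrow> k < n"
  shows "cubical_set (coface_union n F)"
proof -
  have cells: "x \<in> cells (coface_union n F) m \<Longrightarrow> x \<in> cells (std_cube n) m" for m x
    using assms square.comp_hom[OF _ coface_hom] by (auto simp: coface_union_def std_cube_def)
  have act: "act (coface_union n F) = act (std_cube n)"
    by (simp add: coface_union_def)
  have "act (coface_union n F) u x \<in> cells (coface_union n F) l"
    if u: "u \<in> hom square l m" and x: "x \<in> cells (coface_union n F) m" for u x l m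
  proof -
    obtain k i y where ki: "(k, i) \<in> F" and y: "y \<in> hom square m (n - 1)"
      "x = Comp square (coface n k i) y"
      using x by (auto simp: coface_union_def)
    have "Comp square x u = Comp square (coface n k i) (Comp square y u)"
      using square.comp_assoc[OF u y(1) coface_hom[OF assms[OF ki]]] y(2) by metis
    then show ?thesis
      using ki square.comp_hom[OF u y(1)] by (auto simp: coface_union_def std_cube_def)
  qed
  moreover have "cubical_set (std_cube n)" by (rule cubical_set_std_cube)
  ultimately show ?thesis
    using cells unfolding cubical_set_def act by blast
qed

text \<open>One half of the Yoneda lemma: a cell classifies a map out of the cube.\<close>

lemma std_cube_map:
  assumes "cubical_set L" "x \<in> cells L n"
  shows "cubical_map (std_cube n) L (\<lambda>m u. act L u x)"
  using assms cubical_set_std_cube unfolding cubical_map_def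
  by (auto simp: cubical_set_def std_cube_def simp del: Comp_square)

lemma cset_fibre_product_simps [simp]:
  "(x, y) \<in> cells (cset_fibre_product K L p q) n \<longleftrightarrow> x \<in> cells K n \<and> y \<in> cells L n \<and> p n x = q n y"
  "act (cset_fibre_product K L p q) u (x, y) = (act K u x, act L u y)"
  by (simp_all add: cset_fibre_product_def)

lemma cubical_set_fibre_product:
  assumes "cubical_map K N p" "cubical_map L N q"
  shows "cubical_set (cset_fibre_product K L p q)"
proof -
  have "cubical_set K" "cubical_set L"
    "\<And>m n u x. u \<in> hom square m n \<Longrightarrow> x \<in> cells K n \<Longrightarrow> p m (act K u x) = act N u (p n x)"
    "\<And>m n u x. u \<in> hom square m n \<Longrightarrow> x \<in> cells L n \<Longrightarrow> q m (act L u x) = act N u (q n x)"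
    using assms unfolding cubical_map_def by blast+
  then show ?thesis
    unfolding cubical_set_def by (auto simp: cset_fibre_product_def)
qed

section \<open>Gap maps and their lifting problems in \<open>M\<close>\<close>

context strict_monoidal_functor
begin

lemma cubical_map_precomp:
  assumes f: "f \<in> Arr M"
  shows "cubical_map (map_cset M E (Cod M f) Y) (map_cset M E (Dom M f) Y) (precomp M E f)"
  unfolding cubical_map_def
proof (intro conjI allI impI)
  show "cubical_set (map_cset M E (Cod M f) Y)" "cubical_set (map_cset M E (Dom M f) Y)"
    using f by (simp_all add: cubical_set_map_cset)
  show "precomp M E f n x \<in> cells (map_cset M E (Dom M f) Y) n"
    if "x \<in> cells (map_cset M E (Cod M f) Y) n" for n x
    using that f by (simp add: precomp_def hom_def)
  show "precomp M E f m (act (map_cset M E (Cod M f) Y) u x)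
      = act (map_cset M E (Dom M f) Y) u (precomp M E f n x)"
    if "u \<in> hom square m n" "x \<in> cells (map_cset M E (Cod M f) Y) n" for m n u x
  proof -
    have x: "x \<in> Arr M" "Dom M x = Qo n (Cod M f)" using that(2) by (simp_all add: hom_def)
    note [simp] = ev_simps[OF that(1)]
    show ?thesis using f x ev_natural[OF that(1) f] by (simp add: precomp_def)
  qed
qed

lemma cubical_map_postcomp:
  assumes g: "g \<in> Arr M" and X: "X \<in> Obj M"
  shows "cubical_map (map_cset M E X (Dom M g)) (map_cset M E X (Cod M g)) (postcomp M g)"
  unfolding cubical_map_def
proof (intro conjI allI impI)
  show "cubical_set (map_cset M E X (Dom M g))" "cubical_set (map_cset M E X (Cod M g))"
    using X by (simp_all add: cubical_set_map_cset)
  show "postcomp M g n x \<in> cells (map_cset M E X (Cod M g)) n"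
    if "x \<in> cells (map_cset M E X (Dom M g)) n" for n x
    using that g by (simp add: postcomp_def hom_def)
  show "postcomp M g m (act (map_cset M E X (Dom M g)) u x)
      = act (map_cset M E X (Cod M g)) u (postcomp M g n x)"
    if "u \<in> hom square m n" "x \<in> cells (map_cset M E X (Dom M g)) n" for m n u x
    using that g X ev_simps[OF that(1) X] by (simp add: postcomp_def hom_def)
qed

lemma cubical_set_gap_target:
  assumes "f \<in> Arr M" "g \<in> Arr M"
  shows "cubical_set (gap_target M E f g)"
  unfolding gap_target_def
  by (rule cubical_set_fibre_product[OF cubical_map_postcomp cubical_map_precomp]) (use assms in simp_all)

lemma gap_target_cells:
  "(\<phi>, \<psi>) \<in> cells (gap_target M E f g) n \<longleftrightarrow>
    \<phi> \<in> hom M (Qo n (Dom M f)) (Dom M g) \<and> \<psi> \<in> hom M (Qo n (Cod M f)) (Cod M g) \<and>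
    g \<cdot> \<phi> = \<psi> \<cdot> Qa n f"
  by (simp add: gap_target_def postcomp_def precomp_def)

lemma act_gap_target: "act (gap_target M E f g) u (\<phi>, \<psi>) = (\<phi> \<cdot> ev u (Dom M f), \<psi> \<cdot> ev u (Cod M f))"
  by (simp add: gap_target_def)

lemma gap_source_cells: "cells (gap_source M E f g) n = hom M (Qo n (Cod M f)) (Dom M g)"
  and act_gap_source: "act (gap_source M E f g) u \<phi> = \<phi> \<cdot> ev u (Cod M f)"
  by (simp_all add: gap_source_def)

lemma gap_map_eq: "gap_map M E f g n \<phi> = (\<phi> \<cdot> Qa n f, g \<cdot> \<phi>)"
  by (simp add: gap_map_def precomp_def postcomp_def)

lemma cubical_map_gap:
  assumes f: "f \<in> Arr M" and g: "g \<in> Arr M"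
  shows "cubical_map (gap_source M E f g) (gap_target M E f g) (gap_map M E f g)"
  unfolding cubical_map_def
proof (intro conjI allI impI)
  show "cubical_set (gap_source M E f g)" "cubical_set (gap_target M E f g)"
    using f g cubical_set_gap_target cubical_set_map_cset by (simp_all add: gap_source_def)
  show "gap_map M E f g n x \<in> cells (gap_target M E f g) n"
    if "x \<in> cells (gap_source M E f g) n" for n x
    using that f g by (simp add: gap_map_eq gap_target_cells gap_source_cells hom_def)
  show "gap_map M E f g m (act (gap_source M E f g) u x)
      = act (gap_target M E f g) u (gap_map M E f g n x)"
    if u: "u \<in> hom square m n" and x: "x \<in> cells (gap_source M E f g) n" for m n u x
  proof -
    have "x \<in> Arr M" "Dom M x = Qo n (Cod M f)" "Cod M x = Dom M g"
      using x by (simp_all add: gap_source_cells hom_def)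
    moreover note [simp] = ev_simps[OF u]
    ultimately show ?thesis
      using f g ev_natural[OF u f] by (simp add: gap_map_eq act_gap_source act_gap_target)
  qed
qed

text \<open>A lifting problem of the inclusion of \<open>coface_union n F\<close> into the \<open>n\<close>-cube against the gap
  map of \<open>f\<close> and \<open>g\<close>, expressed in \<open>M\<close>: the map to the fibre product is the pair \<open>\<phi>, \<psi>\<close> and
  \<open>a k i\<close> is the restriction of the partial lift to the face \<open>(k, i)\<close>.\<close>

definition lifting_problem where
  "lifting_problem n F f g \<phi> \<psi> a \<longleftrightarrow>
     \<phi> \<in> hom M (Qo n (Dom M f)) (Dom M g) \<and> \<psi> \<in> hom M (Qo n (Cod M f)) (Cod M g) \<and>
     g \<cdot> \<phi> = \<psi> \<cdot> Qa n f \<and>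
     (\<forall>k i. (k, i) \<in> F \<longrightarrow> a k i \<in> hom M (Qo (n - 1) (Cod M f)) (Dom M g) \<and>
        a k i \<cdot> Qa (n - 1) f = \<phi> \<cdot> ev (coface n k i) (Dom M f) \<and>
        g \<cdot> a k i = \<psi> \<cdot> ev (coface n k i) (Cod M f)) \<and>
     (\<forall>k i l j. (k, i) \<in> F \<longrightarrow> (l, j) \<in> F \<longrightarrow> l < k \<longrightarrow>
        a k i \<cdot> ev (coface (n - 1) l j) (Cod M f) = a l j \<cdot> ev (coface (n - 1) (k - 1) i) (Cod M f))"

definition lifts where
  "lifts n F f g \<longleftrightarrow> (\<forall>\<phi> \<psi> a. lifting_problem n F f g \<phi> \<psi> a \<longrightarrow>
     (\<exists>h \<in> hom M (Qo n (Cod M f)) (Dom M g). h \<cdot> Qa n f = \<phi> \<and> g \<cdot> h = \<psi> \<and>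
        (\<forall>k i. (k, i) \<in> F \<longrightarrow> h \<cdot> ev (coface n k i) (Cod M f) = a k i)))"

text \<open>By Yoneda the map on the cube is a pair \<open>\<phi>\<close>, \<open>\<psi>\<close>;
  the partial lift is evaluated at the cofaces, and \<open>coface_coface\<close> makes these values
  agree. The arrow \<open>h\<close> found in \<open>M\<close> then classifies the lift.\<close>

lemma rlp_of_lifts:
  assumes f: "f \<in> Arr M" and g: "g \<in> Arr M" and F: "\<And>k i. (k, i) \<in> F \<Longrightarrow> k < n"
    and lifts: "lifts n F f g"
  shows "cubical_rlp (coface_union n F) (std_cube n) (gap_source M E f g) (gap_target M E f g)
    (gap_map M E f g)"
  unfolding cubical_rlp_def
proof (intro allI impI, elim conjE)
  fix a b
  let ?A = "coface_union n F" and ?K = "gap_source M E f g" and ?L = "gap_target M E f g"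
  assume a: "cubical_map ?A ?K a" and b: "cubical_map (std_cube n) ?L b"
    and ab: "\<forall>m. \<forall>x \<in> cells ?A m. gap_map M E f g m (a m x) = b m x"
  \<comment> \<open>The other half of Yoneda: the identity cell generates the cube.\<close>
  have b_eq: "b m u = act ?L u (b n (cube_ide n))" if "u \<in> hom square m n" for m u
  proof -
    have "cube_ide n \<in> cells (std_cube n) n" "act (std_cube n) u (cube_ide n) = u"
      using square.ide_hom[of n] square.ide_comp[OF that] by (simp_all add: std_cube_def)
    then show ?thesis using b that unfolding cubical_map_def by metis
  qed
  obtain \<phi> \<psi> where \<phi>\<psi>: "b n (cube_ide n) = (\<phi>, \<psi>)" by (cases "b n (cube_ide n)")
  have "(\<phi>, \<psi>) \<in> cells ?L n"
  proof -
    have "cube_ide n \<in> cells (std_cube n) n" using square.ide_hom[of n] by (simp add: std_cube_def)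
    then show ?thesis using b unfolding cubical_map_def \<phi>\<psi>[symmetric] by blast
  qed
  then have hom: "\<phi> \<in> hom M (Qo n (Dom M f)) (Dom M g)" "\<psi> \<in> hom M (Qo n (Cod M f)) (Cod M g)"
    "g \<cdot> \<phi> = \<psi> \<cdot> Qa n f"
    by (simp_all add: gap_target_cells)
  define \<alpha> where "\<alpha> k i = a (n - 1) (coface n k i)" for k i
  have cell: "cube_comp (coface n k i) y \<in> cells ?A m"
    if "(k, i) \<in> F" "y \<in> hom square m (n - 1)" for k i y m
    using that by (auto simp: coface_union_def)
  have a_eq: "a m (cube_comp (coface n k i) y) = \<alpha> k i \<cdot> ev y (Cod M f)"
    if ki: "(k, i) \<in> F" and y: "y \<in> hom square m (n - 1)" for k i y m
  proof -
    have "coface n k i \<in> cells ?A (n - 1)"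
      using cell[OF ki square.ide_hom] square.comp_ide[OF coface_hom[OF F[OF ki]]] by simp
    then have "a m (act ?A y (coface n k i)) = act ?K y (a (n - 1) (coface n k i))"
      using a y unfolding cubical_map_def by blast
    then show ?thesis by (simp add: coface_union_def std_cube_def act_gap_source \<alpha>_def)
  qed
  have "lifting_problem n F f g \<phi> \<psi> \<alpha>"
    unfolding lifting_problem_def
  proof (intro conjI allI impI)
    fix k i assume ki: "(k, i) \<in> F"
    have c: "coface n k i \<in> cells ?A (n - 1)"
      using cell[OF ki square.ide_hom] square.comp_ide[OF coface_hom[OF F[OF ki]]] by simp
    then show "\<alpha> k i \<in> hom M (Qo (n - 1) (Cod M f)) (Dom M g)"
      using a unfolding cubical_map_def \<alpha>_def gap_source_cells[symmetric] by blast
    have "gap_map M E f g (n - 1) (\<alpha> k i) = act ?L (coface n k i) (\<phi>, \<psi>)"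
      using ab c b_eq[OF coface_hom[OF F[OF ki]]] by (simp add: \<alpha>_def \<phi>\<psi>)
    then show "\<alpha> k i \<cdot> Qa (n - 1) f = \<phi> \<cdot> ev (coface n k i) (Dom M f)"
      "g \<cdot> \<alpha> k i = \<psi> \<cdot> ev (coface n k i) (Cod M f)"
      by (simp_all add: gap_map_eq act_gap_target)
  next
    fix k i l j assume kl: "(k, i) \<in> F" "(l, j) \<in> F" "l < k"
    have "k < n" using F kl by blast
    then have "l < n - 1" "k - 1 < n - 1" using kl(3) by simp_all
    then have hom: "coface (n - 1) l j \<in> hom square (n - 1 - 1) (n - 1)"
        "coface (n - 1) (k - 1) i \<in> hom square (n - 1 - 1) (n - 1)"
      by (blast intro: coface_hom)+
    have "cube_comp (coface n k i) (coface (n - 1) l j)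
        = cube_comp (coface n l j) (coface (n - 1) (k - 1) i)"
      by (rule coface_coface) fact+
    then show "\<alpha> k i \<cdot> ev (coface (n - 1) l j) (Cod M f)
        = \<alpha> l j \<cdot> ev (coface (n - 1) (k - 1) i) (Cod M f)"
      using a_eq[OF kl(1) hom(1)] a_eq[OF kl(2) hom(2)] by simp
  qed (use hom in blast)+
  then obtain h where h: "h \<in> hom M (Qo n (Cod M f)) (Dom M g)" "h \<cdot> Qa n f = \<phi>" "g \<cdot> h = \<psi>"
      "\<And>k i. (k, i) \<in> F \<Longrightarrow> h \<cdot> ev (coface n k i) (Cod M f) = \<alpha> k i"
    using lifts unfolding lifts_def by blast
  have h_cell: "h \<in> cells ?K n" using h(1) by (simp add: gap_source_cells)
  have gap: "cubical_map ?K ?L (gap_map M E f g)" by (rule cubical_map_gap[OF f g])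
  have map: "cubical_map (std_cube n) ?K (\<lambda>m u. act ?K u h)"
    using gap h_cell by (intro std_cube_map) (simp_all add: cubical_map_def)
  \<comment> \<open>Each cell of the union factors through one of its cofaces, so agreement on the
    cofaces spreads to all cells.\<close>
  have "act ?K x h = a m x" if x: "x \<in> cells ?A m" for m x
  proof -
    obtain k i y where ki: "(k, i) \<in> F" and y: "y \<in> hom square m (n - 1)"
        "x = cube_comp (coface n k i) y"
      using x by (auto simp: coface_union_def)
    have "h \<cdot> ev (coface n k i) (Cod M f) \<cdot> ev y (Cod M f) = \<alpha> k i \<cdot> ev y (Cod M f)"
      using comp_assoc[OF ev_hom[OF y(1)] ev_hom[OF coface_hom[OF F[OF ki]]] h(1)] f h(4)[OF ki] by simp
    then show ?thesis
      using a_eq[OF ki y(1)] ev_comp[OF y(1) coface_hom[OF F[OF ki]]] f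
      by (simp add: act_gap_source y(2))
  qed
  moreover have "gap_map M E f g m (act ?K x h) = b m x" if "x \<in> cells (std_cube n) m" for m x
  proof -
    have x: "x \<in> hom square m n" using that by (simp add: std_cube_def)
    have "gap_map M E f g m (act ?K x h) = act ?L x (gap_map M E f g n h)"
      using gap x h_cell unfolding cubical_map_def by blast
    also have "gap_map M E f g n h = (\<phi>, \<psi>)" using h by (simp add: gap_map_eq)
    finally show ?thesis using b_eq[OF x] \<phi>\<psi> by simp
  qed
  ultimately show "\<exists>h. cubical_map (std_cube n) ?K h \<and> (\<forall>m. \<forall>x \<in> cells ?A m. h m x = a m x) \<and>
      (\<forall>m. \<forall>x \<in> cells (std_cube n) m. gap_map M E f g m (h m x) = b m x)"
    using map by blast
qed

text \<open>A cell of an endpoint is constant with value \<open>[i]\<close>, so the two endpoints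
  are disjoint.\<close>

lemma endpoint_inj:
  assumes "cube_comp (coface 1 0 i) y = cube_comp (coface 1 0 j) y'"
    "y \<in> hom square m 0" "y' \<in> hom square m 0"
  shows "i = j"
proof -
  obtain u v where uv: "y = (m, 0, u)" "u \<in> cube m \<rightarrow>\<^sub>E cube 0" "y' = (m, 0, v)" "v \<in> cube m \<rightarrow>\<^sub>E cube 0"
    using square_homE[OF assms(2)] square_homE[OF assms(3)] by metis
  \<comment> \<open>Any point of the \<open>m\<close>-cube would do; one is needed in order to
    evaluate.\<close>
  have m: "replicate m True \<in> cube m" by (simp add: cube_def)
  then have "u (replicate m True) = []" "v (replicate m True) = []"
    using uv by (auto simp: cube_def dest!: PiE_mem)
  moreover have "snd (snd (cube_comp (coface 1 0 i) y)) (replicate m True)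
      = snd (snd (cube_comp (coface 1 0 j) y')) (replicate m True)" using assms(1) by simp
  ultimately show ?thesis
    using m by (simp add: uv cube_comp_def coface_eq compose_def cube_def)
qed

text \<open>In dimension one the union of faces is a disjoint union of points, so arbitrary values
  on the chosen endpoints already form a map of cubical sets.\<close>

lemma lifts_of_rlp:
  assumes f: "f \<in> Arr M" and g: "g \<in> Arr M" and F: "\<And>k i. (k, i) \<in> F \<Longrightarrow> k = 0"
    and rlp: "cubical_rlp (coface_union 1 F) (std_cube 1) (gap_source M E f g) (gap_target M E f g)
      (gap_map M E f g)"
  shows "lifts 1 F f g"
  unfolding lifts_def
proof (intro allI impI)
  fix \<phi> \<psi> \<alpha> assume prob: "lifting_problem 1 F f g \<phi> \<psi> \<alpha>"
  let ?A = "coface_union 1 F" and ?K = "gap_source M E f g" and ?L = "gap_target M E f g"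
  let ?X = "Dom M f" and ?X' = "Cod M f"
  have gap: "cubical_map ?K ?L (gap_map M E f g)" by (rule cubical_map_gap[OF f g])
  then have K: "cubical_set ?K" and L: "cubical_set ?L" by (simp_all add: cubical_map_def)
  have A: "cubical_set ?A" using F by (intro cubical_set_coface_union) auto
  have \<phi>\<psi>: "(\<phi>, \<psi>) \<in> cells ?L 1"
    using prob by (simp add: lifting_problem_def gap_target_cells)
  have \<alpha>: "\<alpha> 0 i \<in> cells ?K 0" "gap_map M E f g 0 (\<alpha> 0 i) = act ?L (coface 1 0 i) (\<phi>, \<psi>)"
    if "(0, i) \<in> F" for i
    using prob that by (auto simp: lifting_problem_def gap_source_cells gap_map_eq act_gap_target)
  \<comment> \<open>Well defined because the endpoint is unique by \<open>endpoint_inj\<close> and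
    the factorisation by \<open>hom_square_zero_unique\<close>.\<close>
  define a where "a m x = (THE z. \<exists>i y. (0, i) \<in> F \<and> y \<in> hom square m 0 \<and>
      x = cube_comp (coface 1 0 i) y \<and> z = act ?K y (\<alpha> 0 i))" for m x
  have a_eq: "a m (cube_comp (coface 1 0 i) y) = act ?K y (\<alpha> 0 i)"
    if iy: "(0, i) \<in> F" "y \<in> hom square m 0" for i y m
    unfolding a_def
  proof (rule the_equality)
    show "\<exists>j y'. (0, j) \<in> F \<and> y' \<in> hom square m 0 \<and>
        cube_comp (coface 1 0 i) y = cube_comp (coface 1 0 j) y' \<and> act ?K y (\<alpha> 0 i) = act ?K y' (\<alpha> 0 j)"
      using iy by (intro exI[of _ i] exI[of _ y]) simp
  next
    fix z
    assume "\<exists>j y'. (0, j) \<in> F \<and> y' \<in> hom square m 0 \<and>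
        cube_comp (coface 1 0 i) y = cube_comp (coface 1 0 j) y' \<and> z = act ?K y' (\<alpha> 0 j)"
    then obtain j y' where j: "y' \<in> hom square m 0" "z = act ?K y' (\<alpha> 0 j)"
      "cube_comp (coface 1 0 i) y = cube_comp (coface 1 0 j) y'" by blast
    then show "z = act ?K y (\<alpha> 0 i)"
      using endpoint_inj[OF j(3) iy(2) j(1)] hom_square_zero_unique[OF iy(2) j(1)] by simp
  qed
  have cellE: "\<exists>i y. (0, i) \<in> F \<and> y \<in> hom square m 0 \<and> x = cube_comp (coface 1 0 i) y"
    if "x \<in> cells ?A m" for m x
    using that F by (fastforce simp: coface_union_def)
  have coface: "coface 1 0 i \<in> hom square 0 1" for i
    using coface_hom[of 0 1] by simp
  have a: "cubical_map ?A ?K a"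
    unfolding cubical_map_def
  proof (intro conjI allI impI A K)
    show "a m x \<in> cells ?K m" if x: "x \<in> cells ?A m" for m x
    proof -
      obtain i y where y: "(0, i) \<in> F" "y \<in> hom square m 0" "x = cube_comp (coface 1 0 i) y"
        using cellE[OF x] by blast
      have "act ?K y (\<alpha> 0 i) \<in> cells ?K m"
        using K y(2) \<alpha>(1)[OF y(1)] unfolding cubical_set_def by blast
      then show ?thesis using a_eq[OF y(1,2)] y(3) by simp
    qed
    show "a l (act ?A u x) = act ?K u (a m x)" if u: "u \<in> hom square l m" and x: "x \<in> cells ?A m" for l m u x
    proof -
      obtain i y where y: "(0, i) \<in> F" "y \<in> hom square m 0" "x = cube_comp (coface 1 0 i) y"
        using cellE[OF x] by blast
      have "act ?A u x = cube_comp (coface 1 0 i) (cube_comp y u)"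
        using square.comp_assoc[OF u y(2) coface] y(3) by (simp add: coface_union_def std_cube_def)
      moreover have "cube_comp y u \<in> hom square l 0"
        using square.comp_hom[OF u y(2)] by simp
      moreover have "act ?K (cube_comp y u) (\<alpha> 0 i) = act ?K u (act ?K y (\<alpha> 0 i))"
        using K u y(2) \<alpha>(1)[OF y(1)] unfolding cubical_set_def Comp_square by blast
      ultimately show ?thesis using a_eq[OF y(1)] y(2,3) by simp
    qed
  qed
  have "gap_map M E f g m (a m x) = act ?L x (\<phi>, \<psi>)" if x: "x \<in> cells ?A m" for m x
  proof -
    obtain i y where y: "(0, i) \<in> F" "y \<in> hom square m 0" "x = cube_comp (coface 1 0 i) y"
      using cellE[OF x] by blast
    have "gap_map M E f g m (act ?K y (\<alpha> 0 i)) = act ?L y (gap_map M E f g 0 (\<alpha> 0 i))"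
      using gap y(2) \<alpha>(1)[OF y(1)] unfolding cubical_map_def by blast
    also have "\<dots> = act ?L x (\<phi>, \<psi>)"
    proof -
      have "act ?L (cube_comp (coface 1 0 i) y) (\<phi>, \<psi>) = act ?L y (act ?L (coface 1 0 i) (\<phi>, \<psi>))"
        using L y(2) coface[of i] \<phi>\<psi> unfolding cubical_set_def Comp_square by blast
      then show ?thesis by (simp only: \<alpha>(2)[OF y(1)] y(3))
    qed
    finally show ?thesis using a_eq[OF y(1,2)] y(3) by simp
  qed
  then have "\<exists>h. cubical_map (std_cube 1) ?K h \<and> (\<forall>m. \<forall>x \<in> cells ?A m. h m x = a m x) \<and>
      (\<forall>m. \<forall>x \<in> cells (std_cube 1) m. gap_map M E f g m (h m x) = act ?L x (\<phi>, \<psi>))"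
    using rlp[unfolded cubical_rlp_def, THEN spec, THEN spec, of a "\<lambda>m u. act ?L u (\<phi>, \<psi>)"]
      a std_cube_map[OF L \<phi>\<psi>] by blast
  then obtain h where h: "cubical_map (std_cube 1) ?K h" "\<And>m x. x \<in> cells ?A m \<Longrightarrow> h m x = a m x"
      "\<And>m x. x \<in> cells (std_cube 1) m \<Longrightarrow> gap_map M E f g m (h m x) = act ?L x (\<phi>, \<psi>)"
    by blast
  let ?h = "h 1 (cube_ide 1)"
  have ide: "cube_ide 1 \<in> cells (std_cube 1) 1"
    using square.ide_hom[of 1] by (simp add: std_cube_def)
  then have "?h \<in> cells ?K 1" using h(1) unfolding cubical_map_def by blast
  moreover have "act ?L (cube_ide 1) (\<phi>, \<psi>) = (\<phi>, \<psi>)"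
    using L \<phi>\<psi> unfolding cubical_set_def Ide_square by blast
  then have "gap_map M E f g 1 ?h = (\<phi>, \<psi>)" using h(3)[OF ide] by simp
  moreover have "act ?K (coface 1 0 i) ?h = \<alpha> 0 i" if i: "(0, i) \<in> F" for i
  proof -
    have c: "cube_comp (coface 1 0 i) (cube_ide 0) = coface 1 0 i"
      using square.comp_ide[OF coface] by simp
    then have "coface 1 0 i \<in> cells ?A 0"
      using i square.ide_hom[of 0] by (force simp: coface_union_def)
    then have "h 0 (coface 1 0 i) = act ?K (cube_ide 0) (\<alpha> 0 i)"
      using h(2) a_eq[OF i square.ide_hom[of 0]] c by simp
    also have "\<dots> = \<alpha> 0 i" using K \<alpha>(1)[OF i] unfolding cubical_set_def Ide_square by blast
    finally have "h 0 (coface 1 0 i) = \<alpha> 0 i" .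
    moreover have "h 0 (act (std_cube 1) (coface 1 0 i) (cube_ide 1)) = act ?K (coface 1 0 i) ?h"
      using h(1) coface ide unfolding cubical_map_def by blast
    moreover have "act (std_cube 1) (coface 1 0 i) (cube_ide 1) = coface 1 0 i"
      using square.ide_comp[OF coface] by (simp add: std_cube_def)
    ultimately show ?thesis by simp
  qed
  ultimately show "\<exists>h \<in> hom M (Qo 1 ?X') (Dom M g). h \<cdot> Qa 1 f = \<phi> \<and> g \<cdot> h = \<psi> \<and>
      (\<forall>k i. (k, i) \<in> F \<longrightarrow> h \<cdot> ev (coface 1 k i) ?X' = \<alpha> k i)"
    using F by (intro bexI[of _ ?h]) (auto simp: gap_map_eq act_gap_source gap_source_cells)
qed

end

text \<open>With \<open>1\<close> unfolded to \<open>Suc 0\<close>, the equations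
  \<open>Suc_simps\<close> would split Q_1 into Q_0 after Q_1 without end.\<close>

declare One_nat_def [simp del]

section \<open>Relative cylinders and lifting\<close>

text \<open>\<open>E\<close> stands for the extension picked by \<open>cylinder_ext\<close>; all
  that is used of the choice is that it is strict monoidal and extends \<open>Q\<close>.\<close>

locale cubical_model = model_category M + strict_monoidal_functor M E
  for M :: "('o, 'm) model_cat" and E :: "('o, 'm) cubical_functor" +
  fixes Q :: "('o, 'm) cubical_functor"
  assumes preserves: "preserves_finite_colimits M M (fo E 1)"
    and extends: "extends_cylinder Q E"
begin

lemma Q_eq: "fo Q 1 = fo E 1" "cyl_incl Q i X = ev (delta i) X"
proof -
  show "fo Q 1 = fo E 1"
    using extends by (simp add: extends_cylinder_def square_le1_def full_subcat_def)
  have "delta i \<in> Arr square_le1"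
    using square_homD[OF delta_hom[of i]] by (simp add: square_le1_def full_subcat_def)
  then show "cyl_incl Q i X = ev (delta i) X"
    using extends by (simp add: extends_cylinder_def cyl_incl_def)
qed

lemma delta_simps [simp]:
  assumes "X \<in> Obj M"
  shows "ev (delta i) X \<in> Arr M" "Dom M (ev (delta i) X) = X" "Cod M (ev (delta i) X) = Qo 1 X"
  using ev_simps[OF delta_hom assms] assms by simp_all

lemma delta_natural: "f \<in> Arr M \<Longrightarrow> Qa 1 f \<cdot> ev (delta i) (Dom M f) = ev (delta i) (Cod M f) \<cdot> f"
  using ev_natural[OF delta_hom, of f i] by simp

text \<open>Here Q_1 is split off on the outside, unlike in \<open>Suc_simps\<close>: preservation
  of colimits is known for Q_1 and is passed on to all Q_n by applying Q_1 last.\<close>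

lemma Suc_simps':
  "X \<in> Obj M \<Longrightarrow> Qo (Suc n) X = Qo 1 (Qo n X)" "f \<in> Arr M \<Longrightarrow> Qa (Suc n) f = Qa 1 (Qa n f)"
  using add_simps[of _ 1 n] by (simp_all add: One_nat_def)

lemma power_preserves_coproduct:
  assumes "is_coproduct M X Y p q"
  shows "is_coproduct M (Qo n X) (Qo n Y) (Qa n p) (Qa n q)"
proof (induction n)
  case 0
  have "X \<in> Obj M" "Y \<in> Obj M" using coproduct_arr[OF assms] dom_obj by blast+
  then show ?case using assms coproduct_arr[OF assms] by simp
next
  case (Suc n)
  have "X \<in> Obj M" "Y \<in> Obj M" using coproduct_arr[OF assms] dom_obj by blast+
  then show ?case
    using preserves_coproduct[OF preserves power_functor Suc.IH] coproduct_arr(1,2)[OF assms]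
    by (simp add: Suc_simps')
qed

lemma power_preserves_pushout:
  assumes "is_pushout M f g p q"
  shows "is_pushout M (Qa n f) (Qa n g) (Qa n p) (Qa n q)"
proof (induction n)
  case 0
  then show ?case using assms pushout_arr[OF assms] by simp
next
  case (Suc n)
  then show ?case
    using preserves_pushout[OF preserves power_functor Suc.IH] pushout_arr(1,2,4,5)[OF assms]
    by (simp add: Suc_simps')
qed

lemma power_copairing:
  assumes "copairing M p q a b h" "p \<in> Arr M" "q \<in> Arr M" "Cod M q = Cod M p"
  shows "copairing M (Qa n p) (Qa n q) (Qa n a) (Qa n b) (Qa n h)"
proof -
  have h: "h \<in> Arr M" "Dom M h = Cod M p" "a = h \<cdot> p" "b = h \<cdot> q"
    using assms(1) by (auto simp: copairing_def hom_def)
  show ?thesis unfolding h(3,4) using h(1,2) assms(2-4) by (simp add: copairing_def hom_def)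
qed

text \<open>The relative cylinder map \<open>f'\<close> of \<open>f\<close> with ends \<open>T\<close>. The colimit which is its source is
  required to be preserved by all the \<open>Q\<^sub>n\<close>.\<close>

definition relative_cylinder where
  "relative_cylinder T f f' p e \<longleftrightarrow>
     f \<in> Arr M \<and> p \<in> hom M (Qo 1 (Dom M f)) (Cod M p) \<and>
     f' \<in> hom M (Cod M p) (Qo 1 (Cod M f)) \<and> f' \<cdot> p = Qa 1 f \<and>
     (\<forall>i \<in> T. e i \<in> hom M (Cod M f) (Cod M p) \<and> f' \<cdot> e i = ev (delta i) (Cod M f)) \<and>
     (\<forall>n. is_glueing T (\<lambda>i. Qa n (ev (delta i) (Dom M f))) (Qa n f) (Qa n p) (\<lambda>i. Qa n (e i)))"

lemma end_map_relative_cylinder: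
  assumes f: "f \<in> Arr M" and h: "is_end_map M Q i f h"
  obtains p e where "relative_cylinder {i} f h p e"
proof -
  obtain p q where po: "is_pushout M (ev (delta i) (Dom M f)) f p q"
    and h: "copairing M p q (Qa 1 f) (ev (delta i) (Cod M f)) h"
    using h unfolding is_end_map_def Q_eq by blast
  have "is_glueing {i} (\<lambda>i. Qa n (ev (delta i) (Dom M f))) (Qa n f) (Qa n p) (\<lambda>_. Qa n q)" for n
    using power_preserves_pushout[OF po] by (rule glueing_of_pushout)
  then have "relative_cylinder {i} f h p (\<lambda>_. q)"
    using h f pushout_arr[OF po] by (simp add: relative_cylinder_def copairing_def hom_def)
  then show thesis by (rule that)
qed

lemma boundary_map_relative_cylinder:
  assumes f: "f \<in> Arr M" and h: "is_boundary_map M Q f h"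
  obtains p e where "relative_cylinder UNIV f h p e"
proof -
  let ?X = "Dom M f" and ?X' = "Cod M f"
  obtain i0 i1 j0 j1 s c d p q where i: "is_coproduct M ?X ?X i0 i1"
    and j: "is_coproduct M ?X' ?X' j0 j1" and s: "copairing M i0 i1 (j0 \<cdot> f) (j1 \<cdot> f) s"
    and c: "copairing M i0 i1 (ev (delta False) ?X) (ev (delta True) ?X) c"
    and d: "copairing M j0 j1 (ev (delta False) ?X') (ev (delta True) ?X') d"
    and po: "is_pushout M c s p q" and h: "copairing M p q (Qa 1 f) d h"
    using h unfolding is_boundary_map_def Q_eq by blast
  note arr [simp] = coproduct_arr[OF i] coproduct_arr[OF j] f
  have q: "p \<in> Arr M" "q \<in> Arr M" "Dom M q = Cod M j0" "Cod M q = Cod M p" "Dom M p = Qo 1 ?X"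
    using pushout_arr[OF po] s c by (simp_all add: copairing_def hom_def)
  define e where "e b = q \<cdot> (if b then j1 else j0)" for b
  have "is_glueing UNIV (\<lambda>i. Qa n (ev (delta i) ?X)) (Qa n f) (Qa n p) (\<lambda>b. Qa n (e b))" for n
  proof -
    have "is_glueing UNIV (\<lambda>i. Qa n (ev (delta i) ?X)) (Qa n f) (Qa n p)
        (\<lambda>b. Qa n q \<cdot> (if b then Qa n j1 else Qa n j0))"
    proof (rule glueing_of_coproduct_pushout[of _ "Qa n i0" "Qa n i1" _ _ "Qa n s" _ "Qa n c"])
      show "is_coproduct M (Dom M (Qa n f)) (Dom M (Qa n f)) (Qa n i0) (Qa n i1)"
        using power_preserves_coproduct[OF i] by simp
      show "is_coproduct M (Cod M (Qa n f)) (Cod M (Qa n f)) (Qa n j0) (Qa n j1)"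
        using power_preserves_coproduct[OF j] by simp
      show "copairing M (Qa n i0) (Qa n i1) (Qa n j0 \<cdot> Qa n f) (Qa n j1 \<cdot> Qa n f) (Qa n s)"
        using power_copairing[OF s, of n] by simp
      show "copairing M (Qa n i0) (Qa n i1) (Qa n (ev (delta False) ?X)) (Qa n (ev (delta True) ?X)) (Qa n c)"
        using power_copairing[OF c, of n] by simp
    qed (use power_preserves_pushout[OF po] in simp_all)
    moreover have "Qa n q \<cdot> (if b then Qa n j1 else Qa n j0) = Qa n (e b)" for b
      using q by (simp add: e_def)
    ultimately show ?thesis by simp
  qed
  moreover have "h \<cdot> e b = ev (delta b) ?X'" for b
  proof -
    have "h \<cdot> q = d" "d \<cdot> j0 = ev (delta False) ?X'" "d \<cdot> j1 = ev (delta True) ?X'" "h \<in> Arr M"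
        "Dom M h = Cod M p"
      using h d by (simp_all add: copairing_def hom_def)
    then show ?thesis
      using q comp_extend[of h q d j0] comp_extend[of h q d j1] by (cases b) (simp_all add: e_def)
  qed
  ultimately have "relative_cylinder UNIV f h p e"
    using h q by (simp add: relative_cylinder_def copairing_def hom_def e_def)
  then show thesis by (rule that)
qed

text \<open>Condition 2 speaks of every induced map, so applying it requires that there be one. The
  square to be completed commutes by naturality of the endpoint inclusion.\<close>

lemma end_map_exists:
  assumes f: "f \<in> Arr M"
  obtains h where "is_end_map M Q i f h"
proof -
  obtain p q where po: "is_pushout M (ev (delta i) (Dom M f)) f p q"
    using pushout_exists[OF finite_colimits, of "ev (delta i) (Dom M f)" f] f by auto
  have "\<exists>!h. copairing M p q (Qa 1 f) (ev (delta i) (Cod M f)) h"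
    using po f delta_natural[OF f, of i] unfolding is_pushout_def by (simp add: hom_def)
  then show thesis using po that unfolding is_end_map_def Q_eq by blast
qed

lemma boundary_map_exists:
  assumes f: "f \<in> Arr M"
  obtains h where "is_boundary_map M Q f h"
proof -
  let ?X = "Dom M f" and ?X' = "Cod M f"
  obtain i0 i1 where i: "is_coproduct M ?X ?X i0 i1"
    using coproduct_exists[OF finite_colimits, of ?X ?X] f by auto
  obtain j0 j1 where j: "is_coproduct M ?X' ?X' j0 j1"
    using coproduct_exists[OF finite_colimits, of ?X' ?X'] f by auto
  note arr [simp] = coproduct_arr[OF i] coproduct_arr[OF j] f
  have cop: "\<exists>h. copairing M p q a b h"
    if "is_coproduct M X X p q" "a \<in> hom M X Z" "b \<in> hom M X Z" for X Z p q a b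
    using that unfolding is_coproduct_def by blast
  obtain s where s: "copairing M i0 i1 (j0 \<cdot> f) (j1 \<cdot> f) s"
    using cop[OF i, of "j0 \<cdot> f" "Cod M j0" "j1 \<cdot> f"] by (auto simp: hom_def)
  obtain c where c: "copairing M i0 i1 (ev (delta False) ?X) (ev (delta True) ?X) c"
    using cop[OF i, of "ev (delta False) ?X" "Qo 1 ?X" "ev (delta True) ?X"] by (auto simp: hom_def)
  obtain d where d: "copairing M j0 j1 (ev (delta False) ?X') (ev (delta True) ?X') d"
    using cop[OF j, of "ev (delta False) ?X'" "Qo 1 ?X'" "ev (delta True) ?X'"] by (auto simp: hom_def)
  have s' [simp]: "s \<in> Arr M" "Dom M s = Cod M i0" "Cod M s = Cod M j0"
    and c' [simp]: "c \<in> Arr M" "Dom M c = Cod M i0" "Cod M c = Qo 1 ?X"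
    and d' [simp]: "d \<in> Arr M" "Dom M d = Cod M j0" "Cod M d = Qo 1 ?X'"
    and eqs: "s \<cdot> i0 = j0 \<cdot> f" "s \<cdot> i1 = j1 \<cdot> f" "c \<cdot> i0 = ev (delta False) ?X"
      "c \<cdot> i1 = ev (delta True) ?X" "d \<cdot> j0 = ev (delta False) ?X'" "d \<cdot> j1 = ev (delta True) ?X'"
    using s c d by (simp_all add: copairing_def hom_def)
  obtain p q where po: "is_pushout M c s p q"
    using pushout_exists[OF finite_colimits, of c s] by auto
  \<comment> \<open>On each summand of X + X this is naturality of one endpoint inclusion.\<close>
  have "Qa 1 f \<cdot> c = d \<cdot> s"
  proof (rule coproduct_unique[OF i, of _ "Qo 1 ?X'"])
    show "(Qa 1 f \<cdot> c) \<cdot> i0 = (d \<cdot> s) \<cdot> i0"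
      using comp_extend[OF eqs(5), of f] by (simp add: eqs delta_natural del: One_nat_def)
    show "(Qa 1 f \<cdot> c) \<cdot> i1 = (d \<cdot> s) \<cdot> i1"
      using comp_extend[OF eqs(6), of f] by (simp add: eqs delta_natural del: One_nat_def)
  qed (simp_all add: hom_def)
  then have "\<exists>!h. copairing M p q (Qa 1 f) d h"
    using po unfolding is_pushout_def by (simp add: hom_def)
  then obtain h where "copairing M p q (Qa 1 f) d h" by blast
  then have "is_boundary_map M Q f h"
    unfolding is_boundary_map_def Q_eq using i j s c d po by blast
  then show thesis by (rule that)
qed

text \<open>The faces in the last direction of a lifting problem are absorbed into its source: this uses
  that \<open>Q\<^sub>n\<^sub>+\<^sub>1 = Q\<^sub>n \<circ> Q\<^sub>1\<close> and that \<open>Q\<^sub>n\<close> preserves the source of the relative cylinder map.\<close>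

lemma lifts_Suc:
  assumes cyl: "relative_cylinder T f f' p e" and g: "g \<in> Arr M"
    and F: "\<And>k i. (k, i) \<in> F \<longleftrightarrow> (k < n \<and> (k, i) \<in> F') \<or> (k = n \<and> i \<in> T)"
    and F': "\<And>k i. (k, i) \<in> F' \<Longrightarrow> k < n"
    and lifts: "lifts n F' f' g"
  shows "lifts (Suc n) F f g"
  unfolding lifts_def
proof (intro allI impI)
  fix \<phi> \<psi> a assume prob: "lifting_problem (Suc n) F f g \<phi> \<psi> a"
  let ?X = "Dom M f" and ?X' = "Cod M f" and ?D = "Cod M p" and ?Y = "Dom M g" and ?Y' = "Cod M g"
  have f [simp]: "f \<in> Arr M" and f'_hom: "f' \<in> hom M ?D (Qo 1 ?X')" and f'p: "f' \<cdot> p = Qa 1 f"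
    and f'e: "\<And>i. i \<in> T \<Longrightarrow> f' \<cdot> e i = ev (delta i) ?X'"
    and p_hom: "p \<in> hom M (Qo 1 ?X) ?D" and e_hom: "\<And>i. i \<in> T \<Longrightarrow> e i \<in> hom M ?X' ?D"
    and glue: "\<And>m. is_glueing T (\<lambda>i. Qa m (ev (delta i) ?X)) (Qa m f) (Qa m p) (\<lambda>i. Qa m (e i))"
    using cyl unfolding relative_cylinder_def by blast+
  have [simp]: "f' \<in> Arr M" "Dom M f' = ?D" "Cod M f' = Qo 1 ?X'" "p \<in> Arr M" "Dom M p = Qo 1 ?X"
    "?D \<in> Obj M" and e [simp]: "\<And>i. i \<in> T \<Longrightarrow> e i \<in> Arr M" "\<And>i. i \<in> T \<Longrightarrow> Dom M (e i) = ?X'"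
    "\<And>i. i \<in> T \<Longrightarrow> Cod M (e i) = ?D"
    using f'_hom p_hom e_hom by (simp_all add: hom_def)
  note [simp] = g
  have \<phi>: "\<phi> \<in> hom M (Qo n (Qo 1 ?X)) ?Y" and \<psi>: "\<psi> \<in> hom M (Qo n (Qo 1 ?X')) ?Y'"
    and \<phi>\<psi>: "g \<cdot> \<phi> = \<psi> \<cdot> Qa n (Qa 1 f)"
    using prob by (simp_all add: lifting_problem_def Suc_simps)
  have face: "a k i \<in> hom M (Qo n ?X') ?Y" "a k i \<cdot> Qa n f = \<phi> \<cdot> ev (coface n k i) (Qo 1 ?X)"
      "g \<cdot> a k i = \<psi> \<cdot> ev (coface n k i) (Qo 1 ?X')" if "(k, i) \<in> F'" for k i
  proof -
    have "k < n" "(k, i) \<in> F" using F F' that by blast+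
    then show "a k i \<in> hom M (Qo n ?X') ?Y" "a k i \<cdot> Qa n f = \<phi> \<cdot> ev (coface n k i) (Qo 1 ?X)"
      "g \<cdot> a k i = \<psi> \<cdot> ev (coface n k i) (Qo 1 ?X')"
      using prob by (simp_all add: lifting_problem_def ev_coface_Suc)
  qed
  have last: "a n i \<in> hom M (Qo n ?X') ?Y" "a n i \<cdot> Qa n f = \<phi> \<cdot> Qa n (ev (delta i) ?X)"
      "g \<cdot> a n i = \<psi> \<cdot> Qa n (ev (delta i) ?X')" if "i \<in> T" for i
  proof -
    have "(n, i) \<in> F" using F that by blast
    then show "a n i \<in> hom M (Qo n ?X') ?Y" "a n i \<cdot> Qa n f = \<phi> \<cdot> Qa n (ev (delta i) ?X)"
      "g \<cdot> a n i = \<psi> \<cdot> Qa n (ev (delta i) ?X')"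
      using prob by (simp_all add: lifting_problem_def ev_coface_last)
  qed
  have [simp]: "\<phi> \<in> Arr M" "Dom M \<phi> = Qo n (Qo 1 ?X)" "Cod M \<phi> = ?Y"
      "\<psi> \<in> Arr M" "Dom M \<psi> = Qo n (Qo 1 ?X')" "Cod M \<psi> = ?Y'"
    using \<phi> \<psi> by (simp_all add: hom_def)
  \<comment> \<open>The new top map: \<open>\<phi>\<close> on Q_n(Q_1 X) is glued with the
    prescribed faces \<open>a n i\<close> in the last direction, which fit by their face
    equations.\<close>
  obtain \<phi>' where \<phi>': "\<phi>' \<in> hom M (Qo n ?D) ?Y" and \<phi>'p: "\<phi>' \<cdot> Qa n p = \<phi>"
      and \<phi>'e: "\<And>i. i \<in> T \<Longrightarrow> \<phi>' \<cdot> Qa n (e i) = a n i"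
    using glueing_ex[OF glue[of n], of \<phi> ?Y "a n"] \<phi> last by auto
  have [simp]: "\<phi>' \<in> Arr M" "Dom M \<phi>' = Qo n ?D" "Cod M \<phi>' = ?Y"
    using \<phi>' by (simp_all add: hom_def)
  have Qf'p: "Qa m f' \<cdot> Qa m p = Qa m (Qa 1 f)" and
    Qf'e: "i \<in> T \<Longrightarrow> Qa m f' \<cdot> Qa m (e i) = Qa m (ev (delta i) ?X')" for m i
    using f'p f'e by (simp_all flip: power_simps(6))
  have g\<phi>': "g \<cdot> \<phi>' = \<psi> \<cdot> Qa n f'"
  proof (rule glueing_unique[OF glue[of n], of _ ?Y'])
    show "(g \<cdot> \<phi>') \<cdot> Qa n p = (\<psi> \<cdot> Qa n f') \<cdot> Qa n p"
      using \<phi>\<psi> \<phi>'p Qf'p by simp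
    show "(g \<cdot> \<phi>') \<cdot> Qa n (e i) = (\<psi> \<cdot> Qa n f') \<cdot> Qa n (e i)" if "i \<in> T" for i
      using that last \<phi>'e Qf'e by simp
  qed (simp_all add: hom_def)
  have "lifting_problem n F' f' g \<phi>' \<psi> a"
    unfolding lifting_problem_def
  proof (intro conjI allI impI)
    show "\<phi>' \<in> hom M (Qo n (Dom M f')) ?Y" "\<psi> \<in> hom M (Qo n (Cod M f')) ?Y'" "g \<cdot> \<phi>' = \<psi> \<cdot> Qa n f'"
      using \<phi>' \<psi> g\<phi>' by simp_all
  next
    fix k i assume ki: "(k, i) \<in> F'"
    then have k: "k < n" by (rule F')
    \<comment> \<open>A face (k, i) exists only for positive \<open>n\<close>, so
      \<open>n - 1\<close> is a genuine predecessor and Q_n may be split as Q_m after Q_1.\<close>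
    then obtain m where n: "n = Suc m" by (cases n) auto
    have c: "coface n k i \<in> hom square m n" using coface_hom[OF k] n by simp
    note [simp] = ev_simps[OF c]
    have a_hom: "a k i \<in> hom M (Qo m (Qo 1 ?X')) ?Y"
      using face(1)[OF ki] n by (simp add: Suc_simps)
    then show "a k i \<in> hom M (Qo (n - 1) (Cod M f')) ?Y"
      using n by simp
    have [simp]: "a k i \<in> Arr M" "Dom M (a k i) = Qo m (Qo 1 ?X')" "Cod M (a k i) = ?Y"
      using a_hom by (simp_all add: hom_def)
    show "g \<cdot> a k i = \<psi> \<cdot> ev (coface n k i) (Cod M f')" using face(3)[OF ki] by simp
    \<comment> \<open>Both sides start at Q_m of the source of \<open>f'\<close> and are compared on
      its pieces. On \<open>p\<close> this is the old face equation, on the ends it is the agreement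
      condition.\<close>
    have "a k i \<cdot> Qa m f' = \<phi>' \<cdot> ev (coface n k i) ?D"
    proof (rule glueing_unique[OF glue[of m], of _ ?Y])
      have "a k i \<cdot> Qa m (Qa 1 f) = \<phi> \<cdot> ev (coface n k i) (Qo 1 ?X)"
        using face(2)[OF ki] n by (simp add: Suc_simps)
      moreover have "\<phi>' \<cdot> Qa n p \<cdot> ev (coface n k i) (Qo 1 ?X) = \<phi> \<cdot> ev (coface n k i) (Qo 1 ?X)"
        using comp_extend[OF \<phi>'p] by simp
      ultimately show "(a k i \<cdot> Qa m f') \<cdot> Qa m p = (\<phi>' \<cdot> ev (coface n k i) ?D) \<cdot> Qa m p"
        using ev_natural[OF c, of p] Qf'p by simp
    next
      fix j assume j: "j \<in> T"
      have "(n, j) \<in> F" "(k, i) \<in> F" using F ki k j by blast+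
      \<comment> \<open>Agreement of the face in direction \<open>n\<close> with the one in
        direction \<open>k < n\<close>; the lowered index \<open>n - 1\<close> is again the last
        direction, one dimension down.\<close>
      then have "a n j \<cdot> ev (coface n k i) ?X' = a k i \<cdot> ev (coface n (n - 1) j) ?X'"
        using prob k unfolding lifting_problem_def by (metis diff_Suc_1)
      then have "a n j \<cdot> ev (coface n k i) ?X' = a k i \<cdot> Qa m (ev (delta j) ?X')"
        using n by (simp add: ev_coface_last)
      moreover have "\<phi>' \<cdot> Qa n (e j) \<cdot> ev (coface n k i) ?X' = a n j \<cdot> ev (coface n k i) ?X'"
        using comp_extend[OF \<phi>'e[OF j]] j by simp
      ultimately show "(a k i \<cdot> Qa m f') \<cdot> Qa m (e j) = (\<phi>' \<cdot> ev (coface n k i) ?D) \<cdot> Qa m (e j)"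
        using ev_natural[OF c, of "e j"] Qf'e j by simp
    qed (simp_all add: hom_def)
    then show "a k i \<cdot> Qa (n - 1) f' = \<phi>' \<cdot> ev (coface n k i) (Dom M f')" using n by simp
  next
    fix k i l j assume kl: "(k, i) \<in> F'" "(l, j) \<in> F'" "l < k"
    then have "k < n" using F' by blast
    then obtain m where n: "n = Suc m" by (cases n) auto
    have lk: "l < m" "k - 1 < m" using \<open>k < n\<close> kl(3) n by auto
    have "(k, i) \<in> F" "(l, j) \<in> F" using F F' kl by blast+
    then have "a k i \<cdot> ev (coface n l j) ?X' = a l j \<cdot> ev (coface n (k - 1) i) ?X'"
      using prob kl(3) unfolding lifting_problem_def by (metis diff_Suc_1)
    then show "a k i \<cdot> ev (coface (n - 1) l j) (Cod M f') = a l j \<cdot> ev (coface (n - 1) (k - 1) i) (Cod M f')"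
      using lk by (simp add: n ev_coface_Suc)
  qed
  then obtain h where h: "h \<in> hom M (Qo n (Qo 1 ?X')) ?Y" "h \<cdot> Qa n f' = \<phi>'" "g \<cdot> h = \<psi>"
      "\<And>k i. (k, i) \<in> F' \<Longrightarrow> h \<cdot> ev (coface n k i) (Qo 1 ?X') = a k i"
    using lifts[unfolded lifts_def, rule_format, of \<phi>' \<psi> a] by auto
  have [simp]: "h \<in> Arr M" "Dom M h = Qo n (Qo 1 ?X')" using h(1) by (simp_all add: hom_def)
  have "h \<cdot> Qa (Suc n) f = \<phi>"
    using comp_extend[OF h(2), of "Qa n p"] \<phi>'p Qf'p by (simp add: Suc_simps)
  moreover have "h \<cdot> ev (coface (Suc n) k i) ?X' = a k i" if "(k, i) \<in> F" for k i
  proof (cases "k = n")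
    case True
    then have i: "i \<in> T" using F that by blast
    \<comment> \<open>The absorbed faces reappear because \<open>h\<close> restricts to
      \<open>\<phi>'\<close> along \<open>f'\<close>, and \<open>\<phi>'\<close> to
      \<open>a n i\<close> along the end.\<close>
    then have "h \<cdot> Qa n (ev (delta i) ?X') = a n i"
      using comp_extend[OF h(2), of "Qa n (e i)"] \<phi>'e[OF i] Qf'e[OF i] by simp
    then show ?thesis using True by (simp add: ev_coface_last)
  next
    case False
    then have "k < n" "(k, i) \<in> F'" using F that by blast+
    then show ?thesis using h(4) by (simp add: ev_coface_Suc)
  qed
  ultimately show "\<exists>h \<in> hom M (Qo (Suc n) ?X') ?Y. h \<cdot> Qa (Suc n) f = \<phi> \<and> g \<cdot> h = \<psi> \<and>
      (\<forall>k i. (k, i) \<in> F \<longrightarrow> h \<cdot> ev (coface (Suc n) k i) ?X' = a k i)"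
    using h(1,3) by (intro bexI[of _ h]) (simp_all add: Suc_simps)
qed

text \<open>An arrow out of the source of \<open>f'\<close> is the same as its restrictions to
  Q_1(X) and to the ends. So a square from \<open>f'\<close> to \<open>g\<close> is a
  one-dimensional lifting problem, whose faces all lie in one direction and need no
  agreement.\<close>

lemma llp_of_lifts:
  assumes cyl: "relative_cylinder T f f' p e" and g: "g \<in> Arr M"
    and lifts: "lifts 1 ({0} \<times> T) f g"
    and \<alpha>: "\<alpha> \<in> hom M (Dom M f') (Dom M g)" and \<beta>: "\<beta> \<in> hom M (Cod M f') (Cod M g)"
    and sq: "g \<cdot> \<alpha> = \<beta> \<cdot> f'"
  shows "\<exists>h \<in> hom M (Cod M f') (Dom M g). h \<cdot> f' = \<alpha> \<and> g \<cdot> h = \<beta>"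
proof -
  let ?X = "Dom M f" and ?X' = "Cod M f" and ?D = "Cod M p" and ?Y = "Dom M g"
  have f [simp]: "f \<in> Arr M" and f'_hom: "f' \<in> hom M ?D (Qo 1 ?X')" and f'p: "f' \<cdot> p = Qa 1 f"
    and f'e: "\<And>i. i \<in> T \<Longrightarrow> f' \<cdot> e i = ev (delta i) ?X'"
    and p_hom: "p \<in> hom M (Qo 1 ?X) ?D" and e_hom: "\<And>i. i \<in> T \<Longrightarrow> e i \<in> hom M ?X' ?D"
    and glue: "\<And>m. is_glueing T (\<lambda>i. Qa m (ev (delta i) ?X)) (Qa m f) (Qa m p) (\<lambda>i. Qa m (e i))"
    using cyl unfolding relative_cylinder_def by blast+
  have [simp]: "f' \<in> Arr M" "Dom M f' = ?D" "Cod M f' = Qo 1 ?X'" "p \<in> Arr M" "Dom M p = Qo 1 ?X"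
    "?D \<in> Obj M" and e [simp]: "\<And>i. i \<in> T \<Longrightarrow> e i \<in> Arr M" "\<And>i. i \<in> T \<Longrightarrow> Dom M (e i) = ?X'"
    "\<And>i. i \<in> T \<Longrightarrow> Cod M (e i) = ?D"
    using f'_hom p_hom e_hom by (simp_all add: hom_def)
  note [simp] = g
  have [simp]: "\<alpha> \<in> Arr M" "Dom M \<alpha> = ?D" "Cod M \<alpha> = ?Y" "\<beta> \<in> Arr M" "Dom M \<beta> = Qo 1 ?X'"
      "Cod M \<beta> = Cod M g"
    using \<alpha> \<beta> by (simp_all add: hom_def)
  have coface: "coface 1 0 i = delta i" for i
    using coface_last[of 0 i] by (simp add: ide_zero_tensor One_nat_def cube_arrs.delta)
  have glue0: "p \<cdot> ev (delta i) ?X = e i \<cdot> f" if "i \<in> T" for i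
    using glueing_arr(5)[OF glue[of 0] that] that by simp
  have "lifting_problem 1 ({0} \<times> T) f g (\<alpha> \<cdot> p) \<beta> (\<lambda>k i. \<alpha> \<cdot> e i)"
    using comp_extend2[OF sq] f'p f'e glue0
    by (auto simp: lifting_problem_def hom_def coface)
  then obtain h where h: "h \<in> hom M (Qo 1 ?X') ?Y" "h \<cdot> Qa 1 f = \<alpha> \<cdot> p" "g \<cdot> h = \<beta>"
      "\<And>i. i \<in> T \<Longrightarrow> h \<cdot> ev (delta i) ?X' = \<alpha> \<cdot> e i"
    using lifts[unfolded lifts_def, rule_format, of "\<alpha> \<cdot> p" \<beta> "\<lambda>k i. \<alpha> \<cdot> e i"] by (auto simp: coface)
  have [simp]: "h \<in> Arr M" "Dom M h = Qo 1 ?X'" "Cod M h = ?Y" using h(1) by (simp_all add: hom_def)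
  \<comment> \<open>Glueing at level 0, where Q_0 is the identity, leaves only \<open>p\<close> and
    the ends to compare.\<close>
  have "h \<cdot> f' = \<alpha>"
    by (rule glueing_unique[OF glue[of 0], of _ ?Y]) (use h f'p f'e in \<open>simp_all add: hom_def\<close>)
  then show ?thesis using h by auto
qed

text \<open>The point has no faces and Q_0 is the identity, so the problem is a plain square in
  \<open>M\<close>; the two alternatives are the two lifting axioms.\<close>

lemma lifts_zero:
  assumes "f \<in> Cof M" "g \<in> Fib M" "f \<in> Weq M \<or> g \<in> Weq M"
  shows "lifts 0 {} f g"
proof -
  have "has_llp M f {g}"
    using assms cof_llp acof_llp unfolding has_llp_def by blast
  moreover have "f \<in> Arr M" "g \<in> Arr M"
    using assms cof_subcat fib_subcat by (auto simp: wide_subcat_with_isos_def)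
  ultimately show ?thesis
    unfolding lifts_def lifting_problem_def has_llp_def by auto
qed

end

section \<open>Induction on the dimension and the equivalence\<close>

context cubical_model
begin

lemma cof_arr: "f \<in> Cof M \<Longrightarrow> f \<in> Arr M" and fib_arr: "g \<in> Fib M \<Longrightarrow> g \<in> Arr M"
  using cof_subcat fib_subcat by (auto simp: wide_subcat_with_isos_def)

text \<open>The invariant survives the replacement of \<open>f\<close> by its boundary map:
  condition 1 keeps it a cofibration and passes on acyclicity, while acyclicity of \<open>g\<close>
  is unaffected.\<close>

lemma lifts_boundary:
  assumes boundary: "\<And>f h. f \<in> Cof M \<Longrightarrow> is_boundary_map M Q f h \<Longrightarrow> h \<in> Cof M \<and> (f \<in> Weq M \<longrightarrow> h \<in> Weq M)"
    and f: "f \<in> Cof M" and g: "g \<in> Fib M" and acyclic: "f \<in> Weq M \<or> g \<in> Weq M"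
  shows "lifts n {(k, i). k < n} f g"
  using f acyclic
proof (induction n arbitrary: f)
  case 0
  then show ?case using lifts_zero[OF _ g] by simp
next
  case (Suc n)
  obtain h where h: "is_boundary_map M Q f h"
    using boundary_map_exists[OF cof_arr[OF Suc.prems(1)]] .
  then obtain p e where cyl: "relative_cylinder UNIV f h p e"
    using boundary_map_relative_cylinder[OF cof_arr[OF Suc.prems(1)]] by blast
  have "lifts n {(k, i). k < n} h g"
    using Suc.IH boundary[OF Suc.prems(1) h] Suc.prems(2) by blast
  then show ?case
    by (rule lifts_Suc[OF cyl fib_arr[OF g], rotated 2]) auto
qed

text \<open>Directions after \<open>k\<close> are removed by condition 1, which only has to keep
  \<open>f\<close> a cofibration. At direction \<open>k\<close> condition 2 produces an acyclic
  cofibration, and a full boundary problem remains.\<close>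

lemma lifts_open_box:
  assumes boundary: "\<And>f h. f \<in> Cof M \<Longrightarrow> is_boundary_map M Q f h \<Longrightarrow> h \<in> Cof M \<and> (f \<in> Weq M \<longrightarrow> h \<in> Weq M)"
    and ends: "\<And>f i h. f \<in> Cof M \<Longrightarrow> is_end_map M Q i f h \<Longrightarrow> h \<in> Cof M \<and> h \<in> Weq M"
    and f: "f \<in> Cof M" and g: "g \<in> Fib M" and k: "k < n"
  shows "lifts n ({(j, i). j < n} - {(k, \<epsilon>)}) f g"
  using f k
proof (induction n arbitrary: f)
  case 0
  then show ?case by simp
next
  case (Suc n)
  show ?case
  proof (cases "k = n")
    case True
    \<comment> \<open>With the face at \<open>\<epsilon>\<close> missing, only the opposite end is
      present to be absorbed.\<close>
    obtain h where h: "is_end_map M Q (\<not> \<epsilon>) f h"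
      using end_map_exists[OF cof_arr[OF Suc.prems(1)]] .
    then obtain p e where cyl: "relative_cylinder {\<not> \<epsilon>} f h p e"
      using end_map_relative_cylinder[OF cof_arr[OF Suc.prems(1)]] by blast
    have "lifts n {(k, i). k < n} h g"
      using lifts_boundary[OF boundary _ g] ends[OF Suc.prems(1) h] by blast
    then show ?thesis
      by (rule lifts_Suc[OF cyl fib_arr[OF g], rotated 2]) (use True in auto)
  next
    case False
    obtain h where h: "is_boundary_map M Q f h"
      using boundary_map_exists[OF cof_arr[OF Suc.prems(1)]] .
    then obtain p e where cyl: "relative_cylinder UNIV f h p e"
      using boundary_map_relative_cylinder[OF cof_arr[OF Suc.prems(1)]] by blast
    have "lifts n ({(j, i). j < n} - {(k, \<epsilon>)}) h g"
      using Suc.IH[of h] boundary[OF Suc.prems(1) h] Suc.prems(2) False by simp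
    then show ?thesis
      by (rule lifts_Suc[OF cyl fib_arr[OF g], rotated 2]) (use False in auto)
  qed
qed

lemma iso_ide: "X \<in> Obj M \<Longrightarrow> iso M (Ide M X)"
  using ide_hom[of X] comp_ide[OF ide_hom[of X]] by (auto simp: iso_def hom_def)

text \<open>An arrow between initial objects is an isomorphism, hence a cofibration.\<close>

lemma initial_cofibrant:
  assumes "initial M e"
  shows "cofibrant M e"
  unfolding cofibrant_def
proof (intro conjI allI impI)
  show "e \<in> Obj M" using assms by (simp add: initial_def)
  fix e' i assume e': "initial M e'" and i: "i \<in> hom M e' e"
  have obj: "e \<in> Obj M" "e' \<in> Obj M" using assms e' by (simp_all add: initial_def)
  obtain j where j: "j \<in> hom M e e'" using assms obj(2) unfolding initial_def by blast
  have unique: "u = v" if "initial M x" "u \<in> hom M x y" "v \<in> hom M x y" for u v x y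
  proof -
    have "y \<in> Obj M" using that(2) cod_obj[of u] by (auto simp: hom_def)
    then show ?thesis using that unfolding initial_def by blast
  qed
  have "j \<cdot> i = Ide M e'" "i \<cdot> j = Ide M e"
    using unique[OF e' comp_hom[OF i j] ide_hom[OF obj(2)]]
      unique[OF assms comp_hom[OF j i] ide_hom[OF obj(1)]] by blast+
  then have "iso M i" using i j unfolding iso_def by (auto simp: hom_def)
  then show "i \<in> Cof M" using cof_subcat by (simp add: wide_subcat_with_isos_def)
qed

text \<open>Since Q_0 is the identity, the remaining clauses ask that identities be weak
  equivalences and initial objects cofibrant.\<close>

lemma homotopical_iff:
  "homotopical M E \<longleftrightarrow> (\<forall>f \<in> Cof M. \<forall>g \<in> Fib M.
     cubical_fibration (gap_source M E f g) (gap_target M E f g) (gap_map M E f g) \<and>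
     (f \<in> Weq M \<or> g \<in> Weq M \<longrightarrow>
       cubical_acyclic_fibration (gap_source M E f g) (gap_target M E f g) (gap_map M E f g)))"
proof -
  have "Ide M X \<in> hom M (Qo 0 X) X \<inter> Weq M" if "X \<in> Obj M" for X
    using that iso_ide[OF that] weq_subcat by (simp add: hom_def wide_subcat_with_isos_def)
  moreover have "cofibrant M (Qo 0 e)" if "initial M e" for e
    using that initial_cofibrant[OF that] by (simp add: initial_def)
  ultimately show ?thesis unfolding homotopical_def by blast
qed

text \<open>Gap maps lift against the inclusion of the ends \<open>T\<close> into the interval. By
  \<open>llp_of_lifts\<close> this is the left lifting property of \<open>h\<close>, and the model
  structure characterises both classes of cofibrations by such properties.\<close>

lemma llp_of_homotopical:
  assumes hom: "homotopical M E" and f: "f \<in> Cof M" and cyl: "relative_cylinder T f h p e"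
  shows "T = UNIV \<Longrightarrow> h \<in> Cof M \<and> (f \<in> Weq M \<longrightarrow> h \<in> Weq M)"
    and "T = {i} \<Longrightarrow> h \<in> Cof M \<inter> Weq M"
proof -
  have h: "h \<in> Arr M" using cyl by (auto simp: relative_cylinder_def hom_def)
  have llp: "has_llp M h S"
    if "\<And>g. g \<in> S \<Longrightarrow> g \<in> Arr M \<and> cubical_rlp (coface_union 1 ({0} \<times> T)) (std_cube 1)
      (gap_source M E f g) (gap_target M E f g) (gap_map M E f g)" for S
    unfolding has_llp_def
  proof (intro ballI impI)
    fix g a b assume g: "g \<in> S" and ab: "a \<in> hom M (Dom M h) (Dom M g)" "b \<in> hom M (Cod M h) (Cod M g)"
      "g \<cdot> a = b \<cdot> h"
    have "lifts 1 ({0} \<times> T) f g"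
      using that[OF g] by (intro lifts_of_rlp cof_arr[OF f]) auto
    then show "\<exists>k \<in> hom M (Cod M h) (Dom M g). k \<cdot> h = a \<and> g \<cdot> k = b"
      using llp_of_lifts[OF cyl _ _ ab] that[OF g] by blast
  qed
  show "h \<in> Cof M \<and> (f \<in> Weq M \<longrightarrow> h \<in> Weq M)" if T: "T = UNIV"
  proof -
    have T': "{0 :: nat} \<times> T = {(j, i). j < 1}" using T by auto
    have rlp: "cubical_rlp (coface_union 1 ({0} \<times> T)) (std_cube 1)
        (gap_source M E f g) (gap_target M E f g) (gap_map M E f g)"
      if "g \<in> Fib M" "f \<in> Weq M \<or> g \<in> Weq M" for g
      using hom f that unfolding homotopical_iff cubical_acyclic_fibration_def boundary_def T' by blast
    have "has_llp M h (Fib M \<inter> Weq M)"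
      using rlp fib_arr by (intro llp) auto
    moreover have "has_llp M h (Fib M)" if "f \<in> Weq M"
      using rlp fib_arr that by (intro llp) auto
    ultimately show ?thesis using h cof_llp acof_llp by blast
  qed
  show "h \<in> Cof M \<inter> Weq M" if T: "T = {i}"
  proof -
    \<comment> \<open>The single end \<open>i\<close> is the open box of the interval that lacks the
      opposite end.\<close>
    have T': "{0 :: nat} \<times> T = {(j, i). j < 1} - {(0, \<not> i)}" using T by auto
    have "cubical_rlp (coface_union 1 ({0} \<times> T)) (std_cube 1)
        (gap_source M E f g) (gap_target M E f g) (gap_map M E f g)"
      if "g \<in> Fib M" for g
      using hom f that less_one unfolding homotopical_iff cubical_fibration_def open_box_def T' by blast
    then have "has_llp M h (Fib M)"
      using fib_arr by (intro llp) auto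
    then show ?thesis using h acof_llp by blast
  qed
qed

lemma homotopical_iff_relative_cylinders:
  "homotopical M E \<longleftrightarrow>
    (\<forall>f \<in> Cof M. \<forall>h. is_boundary_map M Q f h \<longrightarrow> h \<in> Cof M \<and> (f \<in> Weq M \<longrightarrow> h \<in> Cof M \<inter> Weq M)) \<and>
    (\<forall>f \<in> Cof M. \<forall>i h. is_end_map M Q i f h \<longrightarrow> h \<in> Cof M \<inter> Weq M)"
proof (intro iffI conjI ballI allI impI)
  fix f h assume hom: "homotopical M E" and f: "f \<in> Cof M" and h: "is_boundary_map M Q f h"
  obtain p e where "relative_cylinder UNIV f h p e"
    using boundary_map_relative_cylinder[OF cof_arr[OF f] h] .
  then show "h \<in> Cof M" "f \<in> Weq M \<Longrightarrow> h \<in> Cof M \<inter> Weq M"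
    using llp_of_homotopical(1)[OF hom f] by blast+
next
  fix f i h assume hom: "homotopical M E" and f: "f \<in> Cof M" and h: "is_end_map M Q i f h"
  obtain p e where "relative_cylinder {i} f h p e"
    using end_map_relative_cylinder[OF cof_arr[OF f] h] .
  then show "h \<in> Cof M \<inter> Weq M"
    using llp_of_homotopical(2)[OF hom f] by blast
next
  assume cond: "(\<forall>f \<in> Cof M. \<forall>h. is_boundary_map M Q f h \<longrightarrow> h \<in> Cof M \<and> (f \<in> Weq M \<longrightarrow> h \<in> Cof M \<inter> Weq M)) \<and>
    (\<forall>f \<in> Cof M. \<forall>i h. is_end_map M Q i f h \<longrightarrow> h \<in> Cof M \<inter> Weq M)"
  have boundary: "h \<in> Cof M \<and> (f \<in> Weq M \<longrightarrow> h \<in> Weq M)"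
    if "f \<in> Cof M" "is_boundary_map M Q f h" for f h
    using cond that by blast
  have ends: "h \<in> Cof M \<and> h \<in> Weq M" if "f \<in> Cof M" "is_end_map M Q i f h" for f i h
    using cond that by blast
  show "homotopical M E"
    unfolding homotopical_iff
  proof (intro ballI conjI impI)
    fix f g assume f: "f \<in> Cof M" and g: "g \<in> Fib M"
    note gap = cubical_map_gap[OF cof_arr[OF f] fib_arr[OF g]]
    show "cubical_fibration (gap_source M E f g) (gap_target M E f g) (gap_map M E f g)"
      unfolding cubical_fibration_def open_box_def
    proof (intro conjI allI impI gap)
      show "cubical_rlp (coface_union n ({(j, i). j < n} - {(k, \<epsilon>)})) (std_cube n)
          (gap_source M E f g) (gap_target M E f g) (gap_map M E f g)" if "k < n" for n k \<epsilon>
        using lifts_open_box[OF boundary ends f g that]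
        by (intro rlp_of_lifts cof_arr[OF f] fib_arr[OF g]) auto
    qed
    show "cubical_acyclic_fibration (gap_source M E f g) (gap_target M E f g) (gap_map M E f g)"
      if "f \<in> Weq M \<or> g \<in> Weq M"
      unfolding cubical_acyclic_fibration_def boundary_def
    proof (intro conjI allI gap)
      show "cubical_rlp (coface_union n {(j, i). j < n}) (std_cube n)
          (gap_source M E f g) (gap_target M E f g) (gap_map M E f g)" for n
        using lifts_boundary[OF boundary f g that]
        by (intro rlp_of_lifts cof_arr[OF f] fib_arr[OF g]) auto
    qed
  qed
qed

end

theorem proposition13:
  fixes M :: "('o, 'm) model_cat" and Q :: "('o, 'm) cubical_functor"
  assumes "model_category M"
    and "natural_cylinder M Q"
    and "preserves_finite_colimits M M (fo Q 1)"
  shows "coherent M Q \<longleftrightarrow>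
    (\<forall>f \<in> Cof M. \<forall>h. is_boundary_map M Q f h \<longrightarrow>
       h \<in> Cof M \<and> (f \<in> Weq M \<longrightarrow> h \<in> Cof M \<inter> Weq M)) \<and>
    (\<forall>f \<in> Cof M. \<forall>i h. is_end_map M Q i f h \<longrightarrow> h \<in> Cof M \<inter> Weq M)"
proof -
  interpret model_category M by fact
  let ?E = "cylinder_ext M Q"
  have E: "strict_monoidal M ?E \<and> extends_cylinder Q ?E"
    unfolding cylinder_ext_def
    by (rule someI_ex) (rule strict_monoidal_extension_exists[OF category_axioms assms(2)])
  then have "fo ?E 1 = fo Q 1"
    by (simp add: extends_cylinder_def square_le1_def full_subcat_def)
  then interpret cubical_model M ?E Q
    using E assms(3) by unfold_locales simp_all
  show ?thesis
    unfolding coherent_def by (rule homotopical_iff_relative_cylinders)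
qed

end
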